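(* The space $\mathcal{A}_{0,S^1}(\mathbb{R})$ is a Banach algebra for the pointwise multiplication.
   Context: All Banach spaces are complex. The Fourier transform of $h\in L^1(\mathbb{R})$ is $\widehat{h}(u)=\int_{\mathbb{R}}h(t)e^{-itu}\,dt$, and $H^1(\mathbb{R})=\{h\in L^1(\mathbb{R}):\widehat{h}(u)=0\ \forall u\leq 0\}$. $S^1$ and $S^\infty$ are the Banach spaces of trace class, resp. compact, operators on $\ell^2$, and $tr$ is the trace on $S^1$. $H^1(\mathbb{R};S^1)$ is the closure of $H^1(\mathbb{R})\otimes S^1$ in the Bochner space $L^1(\mathbb{R};S^1)$. $C_0(\mathbb{R};S^\infty)$ is the space of continuous functions $\mathbb{R}\to S^\infty$ vanishing at infinity, with the supremum norm. For $f\in C_0(\mathbb{R};S^\infty)$ and $h\in H^1(\mathbb{R};S^1)$, define $f\ast h\in C_0(\mathbb{R})$ by $(f\ast h)(s)=\int_{\mathbb{R}}tr(f(t)h(s-t))\,dt$, $s\in\mathbb{R}$. $\mathcal{A}_{0,S^1}(\mathbb{R})$ is the space of all functions $F\colon\mathbb{R}\to\mathbb{C}$ for which there exist sequences $(f_k)_{k\geq1}$ in $C_0(\mathbb{R};S^\infty)$ and $(h_k)_{k\geq1}$ in $H^1(\mathbb{R};S^1)$ satisfying $$\sum_{k=1}^\infty\|f_k\|_\infty\|h_k\|_1<\infty\quad\text{and}\quad F(s)=\sum_{k=1}^\infty(f_k\ast h_k)(s),\ s\in\mathbb{R}.$$ The norm $\|F\|_{\mathcal{A}_{0,S^1}}$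 is the infimum of $\sum_k\|f_k\|_\infty\|h_k\|_1$ over all such pairs of sequences. A Banach algebra is a (not necessarily unital) algebra with a complete norm satisfying $\|FG\|\leq\|F\|\|G\|$. *)

theory Defs
  imports "HOL-Analysis.Analysis"
begin

section \<open>The complex Hilbert space of square-summable sequences\<close>

typedef ell2 = "{x :: nat \<Rightarrow> complex. summable (\<lambda>n. (cmod (x n))\<^sup>2)}"
  morphisms coord Abs_ell2
  by (rule exI [of _ "\<lambda>_. 0"]) simp

setup_lifting type_definition_ell2

lemma summable_coord: "summable (\<lambda>n. (cmod (coord x n))\<^sup>2)"
  using coord by blast

lemma ell2_eqI: "(\<And>n. coord x n = coord y n) \<Longrightarrow> x = y"
  by (metis coord_inject ext)

lemma summable_norm_mult:
  fixes x y :: "nat \<Rightarrow> complex"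
  assumes "summable (\<lambda>n. (cmod (x n))\<^sup>2)" "summable (\<lambda>n. (cmod (y n))\<^sup>2)"
  shows "summable (\<lambda>n. cmod (x n) * cmod (y n))"
proof (rule summable_comparison_test')
  show "summable (\<lambda>n. (cmod (x n))\<^sup>2 + (cmod (y n))\<^sup>2)"
    using assms by (rule summable_add)
  fix n :: nat
  have "2 * (cmod (x n) * cmod (y n)) \<le> (cmod (x n))\<^sup>2 + (cmod (y n))\<^sup>2"
    using sum_squares_bound [of "cmod (x n)" "cmod (y n)"] by simp
  moreover have "0 \<le> cmod (x n) * cmod (y n)" by simp
  ultimately show "norm (cmod (x n) * cmod (y n)) \<le> (cmod (x n))\<^sup>2 + (cmod (y n))\<^sup>2"
    unfolding real_norm_def by linarith
qed

lemma summable_norm_add: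
  fixes x y :: "nat \<Rightarrow> complex"
  assumes "summable (\<lambda>n. (cmod (x n))\<^sup>2)" "summable (\<lambda>n. (cmod (y n))\<^sup>2)"
  shows "summable (\<lambda>n. (cmod (x n + y n))\<^sup>2)"
proof (rule summable_comparison_test')
  show "summable (\<lambda>n. (cmod (x n))\<^sup>2 + (cmod (y n))\<^sup>2 + 2 * (cmod (x n) * cmod (y n)))"
    by (intro summable_add summable_mult assms summable_norm_mult)
  fix n :: nat
  have "(cmod (x n + y n))\<^sup>2 \<le> (cmod (x n) + cmod (y n))\<^sup>2"
    by (intro power_mono norm_triangle_ineq) simp
  then show "norm ((cmod (x n + y n))\<^sup>2)
      \<le> (cmod (x n))\<^sup>2 + (cmod (y n))\<^sup>2 + 2 * (cmod (x n) * cmod (y n))"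
    by (simp add: power2_sum algebra_simps)
qed

lift_definition cscale :: "complex \<Rightarrow> ell2 \<Rightarrow> ell2"  (infixr "*\<^sub>C" 75)
  is "\<lambda>c x n. c * x n"
  by (simp add: norm_mult power_mult_distrib summable_mult)

lift_definition ket :: "nat \<Rightarrow> ell2" is "\<lambda>n k. if k = n then 1 else 0"
  by (rule summable_finite [where N = "{_}"]) auto

definition cinner :: "ell2 \<Rightarrow> ell2 \<Rightarrow> complex"
  where "cinner x y = (\<Sum>n. coord x n * cnj (coord y n))"

lemma summable_cinner: "summable (\<lambda>n. coord x n * cnj (coord y n))"
  by (rule summable_norm_cancel)
    (simp add: norm_mult summable_norm_mult summable_coord)

instantiation ell2 :: real_vector
begin

lift_definition zero_ell2 :: ell2 is "\<lambda>_. 0" by simp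

lift_definition plus_ell2 :: "ell2 \<Rightarrow> ell2 \<Rightarrow> ell2" is "\<lambda>x y n. x n + y n"
  by (rule summable_norm_add)

lift_definition uminus_ell2 :: "ell2 \<Rightarrow> ell2" is "\<lambda>x n. - x n" by simp

lift_definition minus_ell2 :: "ell2 \<Rightarrow> ell2 \<Rightarrow> ell2" is "\<lambda>x y n. x n - y n"
  subgoal for x y using summable_norm_add [of x "\<lambda>n. - y n"] by simp
  done

lift_definition scaleR_ell2 :: "real \<Rightarrow> ell2 \<Rightarrow> ell2" is "\<lambda>r x n. r *\<^sub>R x n"
  by (simp add: power_mult_distrib summable_mult)

instance
proof
  fix x y z :: ell2 and r s :: real
  show "x + y + z = x + (y + z)" by transfer (simp add: algebra_simps)
  show "x + y = y + x" by transfer (simp add: algebra_simps)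
  show "0 + x = x" by transfer simp
  show "- x + x = 0" by transfer simp
  show "x - y = x + - y" by transfer simp
  show "r *\<^sub>R (x + y) = r *\<^sub>R x + r *\<^sub>R y" by transfer (simp add: algebra_simps)
  show "(r + s) *\<^sub>R x = r *\<^sub>R x + s *\<^sub>R x" by transfer (simp add: algebra_simps)
  show "r *\<^sub>R s *\<^sub>R x = (r * s) *\<^sub>R x" by transfer simp
  show "1 *\<^sub>R x = x" by transfer simp
qed

end

text \<open>The library has no class of complex inner product spaces. We make \<open>ell2\<close> a real inner product
  space with the real part of the complex inner product; this yields the usual norm.\<close>

instantiation ell2 :: real_inner
begin

definition inner_ell2 :: "ell2 \<Rightarrow> ell2 \<Rightarrow> real" where "(x :: ell2) \<bullet> y = Re (cinner x y)"
definition norm_ell2 :: "ell2 \<Rightarrow> real" where "norm (x :: ell2) = sqrt (x \<bullet> x)"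
definition dist_ell2 :: "ell2 \<Rightarrow> ell2 \<Rightarrow> real" where "dist x (y :: ell2) = norm (x - y)"
definition sgn_ell2 :: "ell2 \<Rightarrow> ell2" where "sgn (x :: ell2) = x /\<^sub>R norm x"
definition uniformity_ell2 :: "(ell2 \<times> ell2) filter"
  where "uniformity_ell2 = (INF e\<in>{0<..}. principal {(x, y). dist x y < e})"
definition open_ell2 :: "ell2 set \<Rightarrow> bool"
  where "open (S :: ell2 set) = (\<forall>x\<in>S. \<forall>\<^sub>F (x', y) in uniformity. x' = x \<longrightarrow> y \<in> S)"

instance
proof
  fix x y z :: ell2 and r :: real
  show "dist x y = norm (x - y)" by (rule dist_ell2_def)
  show "sgn x = x /\<^sub>R norm x" by (rule sgn_ell2_def)
  show "uniformity = (INF e\<in>{0<..}. principal {(x, y :: ell2). dist x y < e})"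
    by (rule uniformity_ell2_def)
  show "open U = (\<forall>x\<in>U. \<forall>\<^sub>F (x', y) in uniformity. x' = x \<longrightarrow> y \<in> U)" for U :: "ell2 set"
    by (rule open_ell2_def)
  have inner_eq: "a \<bullet> b = (\<Sum>n. Re (coord a n * cnj (coord b n)))" for a b
    unfolding inner_ell2_def cinner_def by (rule Re_suminf [OF summable_cinner])
  have summ: "summable (\<lambda>n. Re (coord a n * cnj (coord b n)))" for a b
    by (rule summable_Re [OF summable_cinner])
  show "x \<bullet> y = y \<bullet> x"
    by (simp add: inner_eq mult.commute)
  show "(x + y) \<bullet> z = x \<bullet> z + y \<bullet> z"
    unfolding inner_eq suminf_add [OF summ summ]
    by (simp add: plus_ell2.rep_eq algebra_simps)
  show "r *\<^sub>R x \<bullet> y = r * (x \<bullet> y)"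
    unfolding inner_eq suminf_mult [OF summ, symmetric]
    by (simp add: scaleR_ell2.rep_eq algebra_simps)
  have self: "x \<bullet> x = (\<Sum>n. (cmod (coord x n))\<^sup>2)"
    unfolding inner_eq by (simp add: complex_norm_square [symmetric] cmod_power2 power2_eq_square)
  show "0 \<le> x \<bullet> x"
    unfolding self by (simp add: suminf_nonneg summable_coord)
  have "x = 0 \<longleftrightarrow> (\<forall>n. coord x n = 0)"
    by (metis ell2_eqI zero_ell2.rep_eq)
  then show "x \<bullet> x = 0 \<longleftrightarrow> x = 0"
    unfolding self by (subst suminf_eq_zero_iff) (simp_all add: summable_coord)
  show "norm x = sqrt (x \<bullet> x)" by (rule norm_ell2_def)
qed

end

lemma norm_ell2_eq: "norm x = sqrt (\<Sum>n. (cmod (coord x n))\<^sup>2)"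
  unfolding norm_ell2_def inner_ell2_def cinner_def Re_suminf [OF summable_cinner]
  by (simp add: cmod_power2 flip: power2_eq_square)


section \<open>Compact and trace class operators\<close>

text \<open>\<open>ell2 \<Rightarrow>\<^sub>L ell2\<close> consists of the real-linear bounded operators; the complex-linear ones are
  singled out by \<open>clinear_op\<close>. Their operator norm is the same over both fields.\<close>

type_synonym oper = "ell2 \<Rightarrow>\<^sub>L ell2"

definition clinear_op :: "oper \<Rightarrow> bool"
  where "clinear_op T \<longleftrightarrow> (\<forall>c x. T (c *\<^sub>C x) = c *\<^sub>C T x)"

definition S_inf :: "oper set"
  where "S_inf = {T. clinear_op T \<and> compact (closure (blinfun_apply T ` cball 0 1))}"

text \<open>The two descriptions below are only meaningful for complex-linear \<open>T\<close>: \<open>adj_op T\<close> is the Hilbert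
  space adjoint and \<open>abs_op T\<close> the positive square root of \<open>T\<^sup>* T\<close>. The quantity \<open>trace_norm T\<close> is
  the trace of \<open>abs_op T\<close>, possibly infinite.\<close>

definition adj_op :: "oper \<Rightarrow> oper"
  where "adj_op T = (THE S :: oper. \<forall>x y. cinner (T x) y = cinner x (S y))"

definition positive_op :: "oper \<Rightarrow> bool"
  where "positive_op P \<longleftrightarrow> clinear_op P \<and> (\<forall>x. cinner (P x) x \<in> \<real>\<^sub>\<ge>\<^sub>0)"

definition abs_op :: "oper \<Rightarrow> oper"
  where "abs_op T = (THE P :: oper. positive_op P \<and> P o\<^sub>L P = adj_op T o\<^sub>L T)"

definition trace_norm :: "oper \<Rightarrow> ennreal"
  where "trace_norm T = (\<Sum>n. ennreal (Re (cinner (abs_op T (ket n)) (ket n))))"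

definition S_one :: "oper set"
  where "S_one = {T. clinear_op T \<and> trace_norm T < \<infinity>}"

definition tr :: "oper \<Rightarrow> complex"
  where "tr T = (\<Sum>n. cinner (T (ket n)) (ket n))"


section \<open>Function spaces\<close>

definition C0_Sinf :: "(real \<Rightarrow> oper) set"
  where "C0_Sinf =
    {f. (\<forall>t. f t \<in> S_inf) \<and> continuous_on UNIV f \<and> (f \<longlongrightarrow> 0) at_infinity}"

definition sup_norm :: "(real \<Rightarrow> oper) \<Rightarrow> real"
  where "sup_norm f = (SUP t. norm (f t))"

definition fourier :: "(real \<Rightarrow> complex) \<Rightarrow> real \<Rightarrow> complex"
  where "fourier h u = (LINT t|lborel. h t * exp (- (\<i> * of_real t * of_real u)))"

definition H1 :: "(real \<Rightarrow> complex) set"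
  where "H1 = {h. integrable lborel h \<and> (\<forall>u\<le>0. fourier h u = 0)}"

text \<open>The library's Bochner integral needs a type of values carrying the relevant norm, whereas the
  trace norm lives on a subset of the operators. So the Bochner space of \<open>S_one\<close>-valued functions is
  defined directly: pointwise limits, in trace norm, of simple functions, with integrable trace norm.
  Its elements are functions rather than classes modulo null sets; as every class of strongly
  measurable functions has a representative that is a limit of Borel simple functions everywhere,
  \<open>lborel\<close> and everywhere convergence lose nothing.\<close>

definition strongly_measurable_S1 :: "(real \<Rightarrow> oper) \<Rightarrow> bool"
  where "strongly_measurable_S1 h \<longleftrightarrow>
    (\<exists>s. (\<forall>n. simple_function lborel (s n) \<and> range (s n) \<subseteq> S_one) \<and>
         (\<forall>t. (\<lambda>n. trace_norm (s n t - h t)) \<longlonglongrightarrow> 0))"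

definition L1_S1 :: "(real \<Rightarrow> oper) set"
  where "L1_S1 = {h. (\<forall>t. h t \<in> S_one) \<and> strongly_measurable_S1 h \<and>
                     (\<integral>\<^sup>+t. trace_norm (h t) \<partial>lborel) < \<infinity>}"

definition L1_norm :: "(real \<Rightarrow> oper) \<Rightarrow> real"
  where "L1_norm h = enn2real (\<integral>\<^sup>+t. trace_norm (h t) \<partial>lborel)"

text \<open>The algebraic tensor product, realised as the functions \<open>t \<mapsto> \<phi>\<^sub>0(t) A\<^sub>0 + \<dots> + \<phi>\<^sub>n\<^sub>-\<^sub>1(t) A\<^sub>n\<^sub>-\<^sub>1\<close>.\<close>

definition H1_tensor_S1 :: "(real \<Rightarrow> oper) set"
  where "H1_tensor_S1 =
    {g. \<exists>n \<phi> A. (\<forall>i<n. \<phi> i \<in> H1 \<and> A i \<in> S_one) \<and>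
          (\<forall>t x. blinfun_apply (g t) x = (\<Sum>i<(n::nat). \<phi> i t *\<^sub>C blinfun_apply (A i) x))}"

definition H1_S1 :: "(real \<Rightarrow> oper) set"
  where "H1_S1 =
    {h \<in> L1_S1. \<forall>\<epsilon>>0. \<exists>g\<in>H1_tensor_S1. (\<integral>\<^sup>+t. trace_norm (h t - g t) \<partial>lborel) < ennreal \<epsilon>}"

definition conv :: "(real \<Rightarrow> oper) \<Rightarrow> (real \<Rightarrow> oper) \<Rightarrow> real \<Rightarrow> complex"
  where "conv f h s = (LINT t|lborel. tr (f t o\<^sub>L h (s - t)))"


section \<open>Series of convolutions\<close>

definition A0_rep ::
    "(real \<Rightarrow> complex) \<Rightarrow> (nat \<Rightarrow> real \<Rightarrow> oper) \<Rightarrow> (nat \<Rightarrow> real \<Rightarrow> oper) \<Rightarrow> bool"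
  where "A0_rep F f h \<longleftrightarrow>
    (\<forall>k. f k \<in> C0_Sinf \<and> h k \<in> H1_S1) \<and>
    summable (\<lambda>k. sup_norm (f k) * L1_norm (h k)) \<and>
    (\<forall>s. (\<lambda>k. conv (f k) (h k) s) sums F s)"

definition A0 :: "(real \<Rightarrow> complex) set"
  where "A0 = {F. \<exists>f h. A0_rep F f h}"

definition A0_norm :: "(real \<Rightarrow> complex) \<Rightarrow> real"
  where "A0_norm F = Inf {(\<Sum>k. sup_norm (f k) * L1_norm (h k)) | f h. A0_rep F f h}"


section \<open>Banach algebras of functions\<close>

text \<open>The algebra axioms themselves are automatic for pointwise operations; what is required is that
  \<open>A\<close> be a complex subspace closed under multiplication and \<open>N\<close> a complete submultiplicative
  norm on it.\<close>

definition banach_algebra_pointwise :: "('a \<Rightarrow> complex) set \<Rightarrow> (('a \<Rightarrow> complex) \<Rightarrow> real) \<Rightarrow> bool"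
  where "banach_algebra_pointwise A N \<longleftrightarrow>
    (\<lambda>_. 0) \<in> A \<and>
    (\<forall>F\<in>A. \<forall>G\<in>A. (\<lambda>s. F s + G s) \<in> A) \<and>
    (\<forall>c. \<forall>F\<in>A. (\<lambda>s. c * F s) \<in> A) \<and>
    (\<forall>F\<in>A. \<forall>G\<in>A. (\<lambda>s. F s * G s) \<in> A) \<and>
    (\<forall>F\<in>A. 0 \<le> N F \<and> (N F = 0 \<longleftrightarrow> F = (\<lambda>_. 0))) \<and>
    (\<forall>F\<in>A. \<forall>G\<in>A. N (\<lambda>s. F s + G s) \<le> N F + N G) \<and>
    (\<forall>c. \<forall>F\<in>A. N (\<lambda>s. c * F s) = cmod c * N F) \<and>
    (\<forall>F\<in>A. \<forall>G\<in>A. N (\<lambda>s. F s * G s) \<le> N F * N G) \<and>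
    (\<forall>X. (\<forall>n::nat. X n \<in> A) \<and>
         (\<forall>\<epsilon>>0. \<exists>M. \<forall>m\<ge>M. \<forall>n\<ge>M. N (\<lambda>s. X m s - X n s) < \<epsilon>) \<longrightarrow>
         (\<exists>F\<in>A. (\<lambda>n. N (\<lambda>s. X n s - F s)) \<longlonglongrightarrow> 0))"

end

theory Submission
  imports Defs "HOL-Probability.Levy"
begin

text \<open>Substituting \<open>t' = t + r\<close> turns a product of two convolutions into
  \<open>(f * h)(g * m) = \<integral> (f \<otimes> g(\<cdot> + r)) * (h \<otimes> m(\<cdot> - r)) dr\<close>, an average of convolutions of the same kind
  once \<open>ell2\<close> is identified with its tensor square: the operator and trace norms are multiplicative under
  \<open>\<otimes>\<close>, and \<open>h \<otimes> m(\<cdot> - r)\<close> is analytic with \<open>\<integral> \<parallel>h \<otimes> m(\<cdot> - r)\<parallel>\<^sub>1 dr = \<parallel>h\<parallel>\<^sub>1 \<parallel>m\<parallel>\<^sub>1\<close>. To obtain a genuine series,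
  \<open>r\<close> is rounded to a grid in the factor \<open>g(\<cdot> + r)\<close> only: each grid cell \<open>I\<close> then contributes a single
  convolution, with \<open>h \<otimes> \<integral>\<^sub>I m(\<cdot> - r) dr\<close>. As \<open>g\<close> is uniformly continuous, these series form a Cauchy
  sequence in \<open>A0\<close> when the grid is refined. Completeness, as well as the passage from finite tensors to
  \<open>H1_S1\<close>, rests on the fact that a double series of convolutions is again a series of convolutions.

  The trace norm is handled through the duality
  \<open>\<parallel>T\<parallel>\<^sub>1 = sup \<bar>\<Sum>\<^sub>n \<langle>Z T e\<^sub>n, e\<^sub>n\<rangle>\<bar>\<close> over partial sums and contractions \<open>Z\<close>, which needs the polar decomposition only up to
  \<open>\<epsilon>\<close> in norm, namely with the contraction \<open>T (\<bar>T\<bar> + \<epsilon>)\<^sup>-\<^sup>1\<close>.\<close>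

text \<open>No single \<open>r\<close> can be treated on its own: for fixed \<open>r\<close> the
  product of \<open>h u\<close> and \<open>m (u - r)\<close> need not be integrable in
  \<open>u\<close>, since neither factor is bounded. Integrating \<open>m (u - r)\<close> over a
  cell makes that factor bounded in \<open>u\<close>. This is why the cells are averaged exactly on
  this side, while rounding is confined to the continuous factor \<open>g\<close>.

  Analyticity of the averaged product says that a Fourier transform vanishes on a half-line; it is
  deduced from the uniqueness theorem for characteristic functions, applied to a correlation
  function.

  The trace class is a subset of a type that carries another norm, so cell integrals with values in
  it are avoided: for finite tensors they are finite sums of scalar integrals. The product estimate
  is therefore proved for finite tensors and then extended by density.

  All estimates are carried by \<open>A0_le F c\<close>, membership and bound at once. It is stable
  under countable sums and under pointwise limits of sequences that are Cauchy in this
  sense.\<close>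

lemmas coord_simps [simp] = zero_ell2.rep_eq plus_ell2.rep_eq minus_ell2.rep_eq uminus_ell2.rep_eq
  scaleR_ell2.rep_eq cscale.rep_eq ket.rep_eq

section \<open>Norm, complex inner product and completeness of \<open>ell2\<close>\<close>

lemma norm_sq_ell2_sums: "(\<lambda>n. (cmod (coord x n))\<^sup>2) sums (norm x)\<^sup>2"
  unfolding norm_ell2_eq
  by (simp add: real_sqrt_pow2 suminf_nonneg summable_coord summable_sums)

lemma norm_sq_ell2: "(norm x)\<^sup>2 = (\<Sum>n. (cmod (coord x n))\<^sup>2)"
  using norm_sq_ell2_sums sums_unique by blast

lemma partial_norm_sq_le: "(\<Sum>n<N. (cmod (coord x n))\<^sup>2) \<le> (norm x)\<^sup>2"
  unfolding norm_sq_ell2 by (rule sum_le_suminf) (auto simp: summable_coord)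

lemma norm_ell2_leI:
  assumes "\<And>N. (\<Sum>n<N. (cmod (coord x n))\<^sup>2) \<le> c\<^sup>2" "0 \<le> c"
  shows "norm x \<le> c"
proof -
  have "(norm x)\<^sup>2 \<le> c\<^sup>2"
    unfolding norm_sq_ell2 by (rule suminf_le_const) (use assms summable_coord in auto)
  then show ?thesis using assms(2) by (rule power2_le_imp_le)
qed

lemma norm_cscale [simp]: "norm (c *\<^sub>C x) = cmod c * norm x"
proof -
  have "(norm (c *\<^sub>C x))\<^sup>2 = (cmod c * norm x)\<^sup>2"
    by (simp add: norm_sq_ell2 norm_mult power_mult_distrib suminf_mult summable_coord)
  then show ?thesis by (simp add: power2_eq_iff_nonneg)
qed

lemma cscale_simps [simp]:
  "1 *\<^sub>C x = x" "0 *\<^sub>C x = 0" "c *\<^sub>C 0 = 0" "c *\<^sub>C d *\<^sub>C x = (c * d) *\<^sub>C x" 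
  "c *\<^sub>C (r *\<^sub>R x) = r *\<^sub>R (c *\<^sub>C x)" "(of_real r) *\<^sub>C x = r *\<^sub>R x"
  by (rule ell2_eqI; simp add: scaleR_conv_of_real)+

lemma bounded_bilinear_cscale: "bounded_bilinear cscale"
proof
  show "\<exists>K. \<forall>c x. norm (c *\<^sub>C x) \<le> norm c * norm x * K" by (rule exI [of _ 1]) simp
qed (rule ell2_eqI; simp add: algebra_simps)+

interpretation cscale: bounded_bilinear cscale by (rule bounded_bilinear_cscale)

lemma cinner_commute: "cinner x y = cnj (cinner y x)"
  unfolding cinner_def bounded_linear.suminf [OF bounded_linear_cnj summable_cinner] by (simp add: mult.commute)

lemma cinner_cscale_left [simp]: "cinner (c *\<^sub>C x) y = c * cinner x y"
  unfolding cinner_def by (simp add: mult.assoc suminf_mult summable_cinner)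

lemma cinner_cscale_right [simp]: "cinner x (c *\<^sub>C y) = cnj c * cinner x y"
  by (metis cinner_commute cinner_cscale_left complex_cnj_mult)

lemma cinner_add_left: "cinner (x + y) z = cinner x z + cinner y z"
  unfolding cinner_def by (simp add: distrib_right suminf_add summable_cinner)

lemma Re_cinner: "Re (cinner x y) = x \<bullet> y"
  by (simp add: inner_ell2_def)

lemma cinner_self: "cinner x x = of_real ((norm x)\<^sup>2)"
proof -
  have "Im (cinner x x) = 0" using cinner_commute [of x x] by (simp add: complex_eq_iff)
  then show ?thesis by (simp add: complex_eq_iff Re_cinner dot_square_norm)
qed

lemma cmod_cinner_le: "cmod (cinner x y) \<le> norm x * norm y"
proof (cases "cinner x y = 0")
  case False
  \<comment> \<open>\<open>c\<close> is the unimodular phase that makes the inner product real and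
    nonnegative, so that the real Cauchy-Schwarz inequality applies.\<close>
  define c where "c = of_real (cmod (cinner x y)) / cinner x y"
  have "cmod (cinner x y) = Re (cinner (c *\<^sub>C x) y)"
    using False by (simp add: c_def)
  also have "\<dots> \<le> norm (c *\<^sub>C x) * norm y" unfolding Re_cinner by (rule norm_cauchy_schwarz)
  also have "\<dots> = norm x * norm y" using False by (simp add: c_def norm_divide)
  finally show ?thesis .
qed simp

lemma bounded_bilinear_cinner: "bounded_bilinear cinner"
proof
  show "\<exists>K. \<forall>x y. norm (cinner x y) \<le> norm x * norm y * K" 
    by (rule exI [of _ 1]) (simp add: cmod_cinner_le)
  show "cinner x (y + z) = cinner x y + cinner x z" for x y z
    by (subst (1 2 3) cinner_commute) (simp add: cinner_add_left)
  show "cinner (r *\<^sub>R x) y = r *\<^sub>R cinner x y" for r x y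
    using cinner_cscale_left [of "of_real r" x y] by (simp add: scaleR_conv_of_real)
  show "cinner x (r *\<^sub>R y) = r *\<^sub>R cinner x y" for r x y
    using cinner_cscale_right [of x "of_real r" y] by (simp add: scaleR_conv_of_real)
qed (rule cinner_add_left)

interpretation cinner: bounded_bilinear cinner by (rule bounded_bilinear_cinner)

lemma cinner_ket_right [simp]: "cinner x (ket n) = coord x n"
proof -
  have "cinner x (ket n) = (\<Sum>k. if k = n then coord x k else 0)"
    unfolding cinner_def by (rule arg_cong [where f = suminf]) auto
  then show ?thesis using sums_single[of n "coord x"] by (simp add: sums_iff)
qed

lemma cinner_ket_left [simp]: "cinner (ket n) x = cnj (coord x n)"
  by (subst cinner_commute) simp

lemma norm_ket [simp]: "norm (ket n) = 1"
proof (rule power2_eq_imp_eq)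
  show "(norm (ket n))\<^sup>2 = 1\<^sup>2" using cinner_self [of "ket n"] by (simp flip: of_real_power)
qed auto

lemma cinner_eqI: "(\<And>z. cinner z x = cinner z y) \<Longrightarrow> x = y"
  by (rule ell2_eqI) (metis cinner_ket_left complex_cnj_cnj)

lemma bounded_linear_coord: "bounded_linear (\<lambda>x. coord x n)"
  using cinner.bounded_linear_left [of "ket n"] by simp

lemma cmod_coord_le: "cmod (coord x n) \<le> norm x"
  using cmod_cinner_le [of x "ket n"] by simp

text \<open>Each coordinate of a Cauchy sequence converges. The Cauchy estimate survives the limit
  on every finite partial sum, with a bound independent of its length; this gives both the square
  summability of the limit \<open>l\<close> and the convergence in norm.\<close>

instance ell2 :: banach
proof
  fix X :: "nat \<Rightarrow> ell2" assume "Cauchy X"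
  define l where "l = (\<lambda>n. lim (\<lambda>k. coord (X k) n))"
  have lim: "(\<lambda>k. coord (X k) n) \<longlonglongrightarrow> l n" for n
    unfolding l_def convergent_LIMSEQ_iff [symmetric]
    by (rule Cauchy_convergent) (rule bounded_linear.Cauchy [OF bounded_linear_coord \<open>Cauchy X\<close>])
  have tail: "\<exists>M. \<forall>m\<ge>M. \<forall>N. (\<Sum>n<N. (cmod (coord (X m) n - l n))\<^sup>2) \<le> e\<^sup>2" if e: "e > 0" for e
  proof -
    obtain M where M: "\<And>m k. m \<ge> M \<Longrightarrow> k \<ge> M \<Longrightarrow> norm (X m - X k) < e"
      using CauchyD [OF \<open>Cauchy X\<close> e] by blast
    have "(\<Sum>n<N. (cmod (coord (X m) n - l n))\<^sup>2) \<le> e\<^sup>2" if m: "m \<ge> M" for m N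
    proof (rule LIMSEQ_le_const2)
      show "(\<lambda>k. \<Sum>n<N. (cmod (coord (X m) n - coord (X k) n))\<^sup>2) \<longlonglongrightarrow> (\<Sum>n<N. (cmod (coord (X m) n - l n))\<^sup>2)"
        by (intro tendsto_intros lim)
      have "(\<Sum>n<N. (cmod (coord (X m) n - coord (X k) n))\<^sup>2) \<le> e\<^sup>2" if "k \<ge> M" for k
        using partial_norm_sq_le [of "X m - X k" N] M [OF m that]
        by (smt (verit) coord_simps(3) norm_ge_zero power_mono sum.cong)
      then show "\<exists>M. \<forall>k\<ge>M. (\<Sum>n<N. (cmod (coord (X m) n - coord (X k) n))\<^sup>2) \<le> e\<^sup>2" by blast
    qed
    then show ?thesis by blast
  qed
  obtain M where "\<And>N. (\<Sum>n<N. (cmod (coord (X M) n - l n))\<^sup>2) \<le> 1\<^sup>2"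
    using tail [of 1] by force
  then have "summable (\<lambda>n. (cmod (coord (X M) n - l n))\<^sup>2)"
    by (intro summableI_nonneg_bounded) auto
  then have "summable (\<lambda>n. (cmod (l n - coord (X M) n))\<^sup>2)" by (simp add: norm_minus_commute)
  from summable_norm_add [OF summable_coord [of "X M"] this]
  have "summable (\<lambda>n. (cmod (l n))\<^sup>2)" by simp
  then obtain L where L: "coord L = l" using Abs_ell2_inverse by blast
  have "X \<longlonglongrightarrow> L"
  proof (rule LIMSEQ_I)
    fix e :: real assume "e > 0"
    then obtain M where M: "\<And>m N. m \<ge> M \<Longrightarrow> (\<Sum>n<N. (cmod (coord (X m) n - l n))\<^sup>2) \<le> (e/2)\<^sup>2"
      using tail [of "e/2"] by force
    have "norm (X m - L) \<le> e/2" if "m \<ge> M" for m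
      by (rule norm_ell2_leI) (use M [OF that] \<open>e > 0\<close> in \<open>auto simp: L\<close>)
    then show "\<exists>M. \<forall>m\<ge>M. norm (X m - L) < e" using \<open>e > 0\<close> by (intro exI [of _ M]) force
  qed
  then show "convergent X" by (auto simp: convergent_def)
qed

section \<open>Truncations, basis expansion and Riesz representation\<close>

definition ket_proj :: "nat \<Rightarrow> ell2 \<Rightarrow> ell2" where "ket_proj N x = (\<Sum>n<N. coord x n *\<^sub>C ket n)"

lemma coord_sum: "coord (\<Sum>i\<in>A. f i) n = (\<Sum>i\<in>A. coord (f i) n)"
  by (induction A rule: infinite_finite_induct) auto

lemma coord_ket_proj: "coord (ket_proj N x) n = (if n < N then coord x n else 0)"
  by (simp add: ket_proj_def coord_sum if_distrib cong: if_cong)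

lemma norm_ket_proj_le: "norm (ket_proj N x) \<le> norm x"
proof (rule norm_ell2_leI)
  fix M
  have "(\<Sum>n<M. (cmod (coord (ket_proj N x) n))\<^sup>2) \<le> (\<Sum>n<M. (cmod (coord x n))\<^sup>2)"
    by (rule sum_mono) (simp add: coord_ket_proj)
  also have "\<dots> \<le> (norm x)\<^sup>2" by (rule partial_norm_sq_le)
  finally show "(\<Sum>n<M. (cmod (coord (ket_proj N x) n))\<^sup>2) \<le> (norm x)\<^sup>2" .
qed simp

text \<open>By Pythagoras the squared truncation error is the squared norm minus its partial sum,
  which tends to 0.\<close>

lemma ket_expansion: "(\<lambda>n. coord x n *\<^sub>C ket n) sums x"
  unfolding sums_def ket_proj_def [symmetric]
proof (rule LIMSEQ_I)
  fix e :: real assume "e > 0"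
  have "norm ((\<Sum>n<N. (cmod (coord x n))\<^sup>2) - norm x^2) = norm (ket_proj N x - x)^2" for N
  proof -
    have "(\<lambda>n. (cmod (coord x n))\<^sup>2 - (if n < N then (cmod (coord x n))\<^sup>2 else 0)) sums
        (norm x^2 - (\<Sum>n<N. (cmod (coord x n))\<^sup>2))"
      using sums_If_finite [of "\<lambda>n. n < N" "\<lambda>n. (cmod (coord x n))\<^sup>2"]
      by (intro sums_diff norm_sq_ell2_sums) (simp add: lessThan_def)
    moreover have "(\<lambda>n. (cmod (coord x n))\<^sup>2 - (if n < N then (cmod (coord x n))\<^sup>2 else 0))
        = (\<lambda>n. (cmod (coord (ket_proj N x - x) n))\<^sup>2)"
      by (auto simp: coord_ket_proj fun_eq_iff)
    ultimately have "norm x^2 - (\<Sum>n<N. (cmod (coord x n))\<^sup>2) = norm (ket_proj N x - x)^2"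
      using sums_unique2 [OF _ norm_sq_ell2_sums [of "ket_proj N x - x"]] by simp
    then have "norm ((\<Sum>n<N. (cmod (coord x n))\<^sup>2) - norm x^2) = norm (norm (ket_proj N x - x)^2)"
      by (metis norm_minus_commute)
    then show ?thesis by simp
  qed
  moreover have "(\<lambda>N. \<Sum>n<N. (cmod (coord x n))\<^sup>2) \<longlonglongrightarrow> norm x^2"
    using norm_sq_ell2_sums unfolding sums_def .
  from LIMSEQ_D [OF this, of "e^2"] \<open>e > 0\<close>
  obtain M where "\<And>N. N \<ge> M \<Longrightarrow> norm ((\<Sum>n<N. (cmod (coord x n))\<^sup>2) - norm x^2) < e^2"
    by (meson zero_less_power)
  ultimately show "\<exists>M. \<forall>N\<ge>M. norm (ket_proj N x - x) < e"
    using \<open>e > 0\<close> by (intro exI [of _ M] allI impI power_less_imp_less_base [of "norm _" 2 e]) simp_all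
qed

lemma ket_proj_tendsto: "(\<lambda>N. ket_proj N x) \<longlonglongrightarrow> x"
  using ket_expansion unfolding sums_def ket_proj_def .

lemma ell2_riesz:
  fixes \<phi> :: "ell2 \<Rightarrow> complex"
  assumes lin: "bounded_linear \<phi>" and scale: "\<And>c x. \<phi> (c *\<^sub>C x) = c * \<phi> x"
  obtains z where "\<And>x. \<phi> x = cinner x z"
proof -
  interpret \<phi>: bounded_linear \<phi> by (rule lin)
  obtain K where K: "\<And>x. cmod (\<phi> x) \<le> norm x * K" "K > 0" using \<phi>.pos_bounded by blast
  have "(\<Sum>n<N. (cmod (\<phi> (ket n)))\<^sup>2) \<le> K\<^sup>2" for N
  proof -
    define s where "s = (\<Sum>n<N. (cmod (\<phi> (ket n)))\<^sup>2)"
    \<comment> \<open>Testing \<open>\<phi>\<close> on \<open>v\<close> gives \<open>s\<close>,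
      which is also the square of \<open>norm v\<close>; boundedness of \<open>\<phi>\<close> then
      forces \<open>norm v \<le> K\<close>.\<close>
    define v where "v = (\<Sum>n<N. cnj (\<phi> (ket n)) *\<^sub>C ket n)"
    have "\<phi> v = (\<Sum>n<N. of_real ((cmod (\<phi> (ket n)))\<^sup>2))"
      by (simp add: v_def \<phi>.sum scale complex_norm_square [symmetric] mult.commute del: of_real_power)
    then have v: "\<phi> v = of_real s" by (simp add: s_def)
    have "coord v n = (if n < N then cnj (\<phi> (ket n)) else 0)" for n
      by (simp add: v_def coord_sum if_distrib cong: if_cong)
    then have "(\<lambda>n. (cmod (coord v n))\<^sup>2) = (\<lambda>n. if n < N then (cmod (\<phi> (ket n)))\<^sup>2 else 0)"
      by auto
    then have n: "(norm v)\<^sup>2 = s"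
      using sums_If_finite [of "\<lambda>n. n < N" "\<lambda>n. (cmod (\<phi> (ket n)))\<^sup>2"]
      by (simp add: norm_sq_ell2 s_def sums_iff lessThan_def)
    have "s \<ge> 0" by (simp add: s_def sum_nonneg)
    have "norm v * norm v \<le> norm v * K" using K(1) [of v] v n \<open>s \<ge> 0\<close> by (simp add: power2_eq_square)
    then have "norm v \<le> K" using K(2) by (cases "norm v = 0") auto
    then show ?thesis using n s_def by (metis norm_ge_zero power_mono)
  qed
  then have "summable (\<lambda>n. (cmod (cnj (\<phi> (ket n))))\<^sup>2)"
    by (intro summableI_nonneg_bounded) auto
  then have "coord (Abs_ell2 (\<lambda>n. cnj (\<phi> (ket n)))) = (\<lambda>n. cnj (\<phi> (ket n)))"
    by (intro Abs_ell2_inverse CollectI)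
  then obtain z where z: "coord z = (\<lambda>n. cnj (\<phi> (ket n)))" ..
  have "\<phi> x = cinner x z" for x
  proof -
    have "(\<lambda>n. \<phi> (coord x n *\<^sub>C ket n)) sums \<phi> x"
      by (rule \<phi>.sums [OF ket_expansion])
    moreover have "(\<lambda>n. cinner (coord x n *\<^sub>C ket n) z) sums cinner x z"
      by (rule bounded_linear.sums [OF cinner.bounded_linear_left ket_expansion])
    ultimately show ?thesis by (simp add: scale z sums_iff)
  qed
  then show thesis by (rule that)
qed

section \<open>Complex-linear operators are determined by the basis and closed under limits\<close>

lemma clinear_opD: "clinear_op T \<Longrightarrow> T (c *\<^sub>C x) = c *\<^sub>C T x"
  by (simp add: clinear_op_def)

lemma clinear_op_expansion:
  assumes "clinear_op T" shows "(\<lambda>n. coord x n *\<^sub>C T (ket n)) sums T x"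
  using bounded_linear.sums [OF blinfun.bounded_linear_right [of T] ket_expansion [of x]]
  by (simp add: clinear_opD [OF assms])

lemma clinear_op_eqI:
  assumes "clinear_op S" "clinear_op T" "\<And>n. S (ket n) = T (ket n)"
  shows "S = T"
proof (rule blinfun_eqI)
  show "S x = T x" for x
    using clinear_op_expansion [OF assms(1), of x] clinear_op_expansion [OF assms(2), of x] assms(3)
    by (simp add: sums_iff)
qed

lemma clinear_op_intros [intro, simp]:
  "clinear_op 0" "clinear_op id_blinfun"
  "clinear_op S \<Longrightarrow> clinear_op T \<Longrightarrow> clinear_op (S o\<^sub>L T)"
  "clinear_op S \<Longrightarrow> clinear_op T \<Longrightarrow> clinear_op (S + T)"
  "clinear_op S \<Longrightarrow> clinear_op T \<Longrightarrow> clinear_op (S - T)"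
  "clinear_op S \<Longrightarrow> clinear_op (- S)"
  "clinear_op S \<Longrightarrow> clinear_op (r *\<^sub>R S)"
  by (simp_all add: clinear_op_def blinfun.add_left blinfun.diff_left blinfun.minus_left blinfun.scaleR_left
    cscale.add_right cscale.diff_right cscale.minus_right)

lemma clinear_op_lim:
  assumes "\<And>n. clinear_op (X n)" "X \<longlonglongrightarrow> T" shows "clinear_op T"
proof -
  have "T (c *\<^sub>C x) = c *\<^sub>C T x" for c x
  proof (rule LIMSEQ_unique)
    show "(\<lambda>n. X n (c *\<^sub>C x)) \<longlonglongrightarrow> T (c *\<^sub>C x)"
      by (intro blinfun.tendsto tendsto_const assms)
    show "(\<lambda>n. X n (c *\<^sub>C x)) \<longlonglongrightarrow> c *\<^sub>C T x"
      unfolding clinear_opD [OF assms(1)]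
      by (intro cscale.tendsto blinfun.tendsto tendsto_const assms)
  qed
  then show ?thesis by (simp add: clinear_op_def)
qed

section \<open>Complex-linear operators on \<open>ell2\<close>\<close>

lemma norm_blinfun_le: "norm T \<le> a \<Longrightarrow> norm (blinfun_apply T x) \<le> a * norm x"
  by (meson mult_right_mono norm_blinfun norm_ge_zero order_trans)

lemma le_of_mult_self_le: "(n :: real) * n \<le> n * m \<Longrightarrow> 0 \<le> n \<Longrightarrow> 0 \<le> m \<Longrightarrow> n \<le> m"
  by (cases "n = 0") (simp_all add: mult_le_cancel_left_pos)

lemma oper_compose_id [simp]: "id_blinfun o\<^sub>L S = S" "S o\<^sub>L id_blinfun = (S :: oper)"
  by (rule blinfun_eqI; simp)+

lemma oper_compose_assoc: "(A o\<^sub>L B) o\<^sub>L C = A o\<^sub>L (B o\<^sub>L (C :: oper))"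
  by (rule blinfun_eqI) simp

section \<open>Adjoints\<close>

lemma adj_op_exists:
  assumes "clinear_op T"
  shows "\<exists>S. clinear_op S \<and> (\<forall>x y. cinner (T x) y = cinner x (S y))"
proof -
  have "\<exists>z. \<forall>x. cinner (T x) y = cinner x z" for y
  proof -
    have "bounded_linear (\<lambda>x. cinner (T x) y)"
      by (rule bounded_linear_compose [OF cinner.bounded_linear_left blinfun.bounded_linear_right])
    from ell2_riesz [OF this] show ?thesis
      by (metis assms cinner_cscale_left clinear_opD)
  qed
  then obtain S where S: "\<And>x y. cinner (T x) y = cinner x (S y)" by metis
  have "bounded_linear S"
  proof (rule bounded_linear_intro [of S "norm T"])
    show "S (x + y) = S x + S y" for x y
      by (rule cinner_eqI) (simp add: S [symmetric] cinner.add_right)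
    show "S (r *\<^sub>R x) = r *\<^sub>R S x" for r x
      by (rule cinner_eqI) (simp add: S [symmetric] cinner.scaleR_right)
    \<comment> \<open>Pairing \<open>T (S x)\<close> with \<open>x\<close> produces the square of
      \<open>norm (S x)\<close>, one factor of which cancels.\<close>
    show "norm (S x) \<le> norm x * norm T" for x
    proof -
      have "norm (S x) * norm (S x) = cmod (cinner (T (S x)) x)"
        by (simp add: S cinner_self power2_eq_square norm_mult)
      also have "\<dots> \<le> norm (T (S x)) * norm x" by (rule cmod_cinner_le)
      also have "\<dots> \<le> norm T * norm (S x) * norm x" by (intro mult_right_mono norm_blinfun) simp
      finally have "norm (S x) * norm (S x) \<le> norm (S x) * (norm x * norm T)"
        by (simp add: ac_simps)
      then show ?thesis by (cases "norm (S x) = 0") (simp_all add: mult_le_cancel_left_pos)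
    qed
  qed
  then have "blinfun_apply (Blinfun S) = S" by (rule bounded_linear_Blinfun_apply)
  moreover have "S (c *\<^sub>C x) = c *\<^sub>C S x" for c x
    by (rule cinner_eqI) (simp add: S [symmetric])
  ultimately show ?thesis using S by (intro exI [of _ "Blinfun S"]) (simp add: clinear_op_def)
qed

lemma adj_op_eqI:
  assumes "\<And>x y. cinner (blinfun_apply T x) y = cinner x (blinfun_apply S y)"
  shows "adj_op T = S"
  unfolding adj_op_def
proof (rule the_equality)
  fix S' :: oper assume S': "\<forall>x y. cinner (T x) y = cinner x (S' y)"
  show "S' = S"
  proof (rule blinfun_eqI, rule cinner_eqI)
    show "cinner z (S' i) = cinner z (S i)" for z i by (metis S' assms)
  qed
qed (use assms in blast)

lemma adj_op:
  assumes "clinear_op T"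
  shows "clinear_op (adj_op T)" and "cinner (T x) y = cinner x (adj_op T y)"
proof -
  obtain S where S: "clinear_op S" "\<forall>x y. cinner (T x) y = cinner x (S y)"
    using adj_op_exists [OF assms] by blast
  then have "adj_op T = S" by (intro adj_op_eqI) blast
  then show "clinear_op (adj_op T)" "cinner (T x) y = cinner x (adj_op T y)" using S by auto
qed

lemma adj_op_left: "clinear_op T \<Longrightarrow> cinner (adj_op T x) y = cinner x (T y)"
  by (metis adj_op(2) cinner_commute)

section \<open>Self-adjoint and positive operators\<close>

definition selfadj_op :: "oper \<Rightarrow> bool"
  where "selfadj_op P \<longleftrightarrow> clinear_op P \<and> (\<forall>x y. cinner (P x) y = cinner x (P y))"

lemma selfadj_opD: "selfadj_op P \<Longrightarrow> cinner (P x) y = cinner x (P y)"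
  by (simp add: selfadj_op_def)

lemma selfadj_op_inner: "selfadj_op P \<Longrightarrow> P x \<bullet> y = x \<bullet> P y"
  by (metis selfadj_op_def Re_cinner)

lemma selfadj_op_clinear: "selfadj_op P \<Longrightarrow> clinear_op P"
  by (simp add: selfadj_op_def)

lemma selfadj_op_intros:
  "selfadj_op 0" "selfadj_op id_blinfun"
  "selfadj_op S \<Longrightarrow> selfadj_op T \<Longrightarrow> selfadj_op (S + T)"
  "selfadj_op S \<Longrightarrow> selfadj_op T \<Longrightarrow> selfadj_op (S - T)"
  "selfadj_op S \<Longrightarrow> selfadj_op (r *\<^sub>R S)"
  "selfadj_op S \<Longrightarrow> selfadj_op (S o\<^sub>L S)"
  by (simp_all add: selfadj_op_def blinfun.add_left blinfun.diff_left blinfun.scaleR_left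
      cinner.add_left cinner.add_right cinner.diff_left cinner.diff_right 
      cinner.scaleR_left cinner.scaleR_right cinner.zero_left cinner.zero_right)

lemma selfadj_op_lim:
  assumes "\<And>n. selfadj_op (X n)" "X \<longlonglongrightarrow> T" shows "selfadj_op T"
proof -
  have "cinner (T x) y = cinner x (T y)" for x y
  proof (rule LIMSEQ_unique)
    show "(\<lambda>n. cinner (X n x) y) \<longlonglongrightarrow> cinner (T x) y"
      by (intro cinner.tendsto blinfun.tendsto tendsto_const assms)
    show "(\<lambda>n. cinner (X n x) y) \<longlonglongrightarrow> cinner x (T y)"
      unfolding selfadj_opD [OF assms(1)]
      by (intro cinner.tendsto blinfun.tendsto tendsto_const assms)
  qed
  then show ?thesis using clinear_op_lim [OF _ assms(2)] assms(1) by (simp add: selfadj_op_def)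
qed

lemma selfadj_op_quadratic: "selfadj_op P \<Longrightarrow> cinner (P x) x = of_real (P x \<bullet> x)"
  using cinner_commute [of "P x" x] by (simp add: selfadj_op_def complex_eq_iff Re_cinner)

text \<open>Over the complex numbers a nonnegative quadratic form forces self-adjointness. The
  defect \<open>\<phi>\<close> vanishes on the diagonal, hence is antisymmetric; putting
  \<open>\<i> *\<^sub>C x\<close> for \<open>x\<close> in the antisymmetry makes it symmetric as
  well.\<close>

lemma positive_op_iff: "positive_op P \<longleftrightarrow> selfadj_op P \<and> (\<forall>x. 0 \<le> P x \<bullet> x)"
proof
  assume P: "positive_op P"
  then have cl: "clinear_op P" by (simp add: positive_op_def)
  define \<phi> where "\<phi> x y = cinner (P x) y - cinner x (P y)" for x y
  have zero: "\<phi> x x = 0" for x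
    using P cinner_commute [of x "P x"]
    by (simp add: positive_op_def \<phi>_def complex_nonneg_Reals_iff complex_eq_iff)
  have "\<phi> x y = 0" for x y
  proof -
    have "\<phi> (x + y) (x + y) = \<phi> x x + \<phi> y y + (\<phi> x y + \<phi> y x)" for x y
      by (simp add: \<phi>_def blinfun.add_right cinner.add_left cinner.add_right algebra_simps)
    then have sym: "\<phi> x y + \<phi> y x = 0" for x y by (simp add: zero)
    have "\<i> * \<phi> x y - \<i> * \<phi> y x = 0"
      using sym [of "\<i> *\<^sub>C x" y] by (simp add: \<phi>_def clinear_opD [OF cl] algebra_simps)
    then show ?thesis using sym [of x y] by (simp add: add_eq_0_iff)
  qed
  then have "selfadj_op P" by (simp add: \<phi>_def selfadj_op_def cl)
  moreover have "0 \<le> P x \<bullet> x" for x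
    using P by (simp add: positive_op_def complex_nonneg_Reals_iff Re_cinner)
  ultimately show "selfadj_op P \<and> (\<forall>x. 0 \<le> P x \<bullet> x)" by blast
next
  assume "selfadj_op P \<and> (\<forall>x. 0 \<le> P x \<bullet> x)"
  then show "positive_op P"
    by (simp add: positive_op_def selfadj_op_clinear selfadj_op_quadratic)
qed

lemma quadratic_nonneg_discriminant:
  fixes a b d :: real
  assumes "\<And>t. 0 \<le> a + 2 * t * b + t\<^sup>2 * d"
  shows "b\<^sup>2 \<le> a * d"
proof (cases "d = 0")
  case True
  have "b = 0"
  proof (rule ccontr)
    assume "b \<noteq> 0"
    \<comment> \<open>At this \<open>t\<close> the expression equals -1.\<close>
    then show False using assms [of "- (a + 1) / (2 * b)"] True by (simp add: field_simps)
  qed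
  then show ?thesis using True by simp
next
  case False
  have "d > 0"
  proof (rule ccontr)
    assume "\<not> d > 0"
    then have "d < 0" using False by simp
    \<comment> \<open>\<open>t\<close> is taken so large that the negative quadratic term outweighs
      the constant and the linear term.\<close>
    define t where "t = (\<bar>a\<bar> + 1 + 2 * \<bar>b\<bar>) / (- d) + 1"
    have "t \<ge> 1" using \<open>d < 0\<close> by (simp add: t_def divide_nonneg_neg)
    have "t * (-d) \<ge> \<bar>a\<bar> + 1 + 2 * \<bar>b\<bar>" using \<open>d < 0\<close> by (simp add: t_def field_simps)
    then have "t * (t * (-d)) \<ge> t * (\<bar>a\<bar> + 1 + 2 * \<bar>b\<bar>)" using \<open>t \<ge> 1\<close> by (intro mult_left_mono) auto
    moreover have "t * (\<bar>a\<bar> + 1) \<ge> 1 * (\<bar>a\<bar> + 1)" using \<open>t \<ge> 1\<close> by (intro mult_right_mono) auto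
    moreover have "t * b \<le> t * \<bar>b\<bar>" using \<open>t \<ge> 1\<close> by (intro mult_left_mono) auto
    ultimately show False using assms [of t] by (simp add: algebra_simps power2_eq_square)
  qed
  then show ?thesis using assms [of "- b / d"] by (simp add: field_simps power2_eq_square)
qed

lemma positive_op_Cauchy_Schwarz:
  assumes "positive_op P"
  shows "(P x \<bullet> y)\<^sup>2 \<le> (P x \<bullet> x) * (P y \<bullet> y)"
proof (rule quadratic_nonneg_discriminant)
  fix t :: real
  have "0 \<le> P (x + t *\<^sub>R y) \<bullet> (x + t *\<^sub>R y)" using assms positive_op_iff by blast
  also have "\<dots> = P x \<bullet> x + 2 * t * (P x \<bullet> y) + t\<^sup>2 * (P y \<bullet> y)"
    using assms positive_op_iff selfadj_op_inner [of P y x]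
    by (simp add: blinfun.add_right blinfun.scaleR_right inner_add algebra_simps power2_eq_square inner_commute)
  finally show "0 \<le> P x \<bullet> x + 2 * t * (P x \<bullet> y) + t\<^sup>2 * (P y \<bullet> y)" .
qed

lemma positive_op_apply_eq_0:
  assumes "positive_op P" "P x \<bullet> x = 0" shows "P x = 0"
  using positive_op_Cauchy_Schwarz [OF assms(1), of x "P x"] assms(2) by simp

text \<open>As quadratic forms, \<open>0 \<le> a - P \<le> a\<close>. The Cauchy-Schwarz inequality
  for the form of \<open>?K\<close>, tested on \<open>x\<close> and \<open>?K x\<close>, turns this
  into a bound on the operator norm. Divided by a scalar, \<open>a - P\<close> becomes the small
  operator needed both for the square root iteration and for the Neumann series of the
  resolvent.\<close>

lemma norm_diff_positive_le:
  assumes P: "positive_op P" and a: "norm P \<le> a"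
  shows "norm (a *\<^sub>R id_blinfun - P) \<le> a"
proof (rule norm_blinfun_bound)
  show "0 \<le> a" using a norm_ge_zero order_trans by blast
  let ?K = "a *\<^sub>R id_blinfun - P"
  have K: "?K x \<bullet> x = a * (norm x)\<^sup>2 - P x \<bullet> x" for x
    by (simp add: blinfun.diff_left blinfun.scaleR_left inner_diff_left dot_square_norm)
  have "P x \<bullet> x \<le> a * (norm x)\<^sup>2" for x
  proof -
    have "P x \<bullet> x \<le> norm (P x) * norm x" by (rule norm_cauchy_schwarz)
    also have "\<dots> \<le> (a * norm x) * norm x"
      by (intro mult_right_mono norm_blinfun_le a) simp
    finally show ?thesis by (simp add: power2_eq_square)
  qed
  moreover have "selfadj_op ?K" using P by (intro selfadj_op_intros) (simp add: positive_op_iff)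
  ultimately have pos: "positive_op ?K" by (simp add: positive_op_iff K)
  have le: "?K x \<bullet> x \<le> a * (norm x)\<^sup>2" "0 \<le> ?K x \<bullet> x" for x 
    using P pos K by (simp_all add: positive_op_iff)
  fix x
  have "(norm (?K x))\<^sup>2 * (norm (?K x))\<^sup>2 = (?K x \<bullet> ?K x)\<^sup>2" by (simp add: dot_square_norm power2_eq_square)
  also have "\<dots> \<le> (?K x \<bullet> x) * (?K (?K x) \<bullet> ?K x)" by (rule positive_op_Cauchy_Schwarz [OF pos])
  also have "\<dots> \<le> (a * (norm x)\<^sup>2) * (a * (norm (?K x))\<^sup>2)" using le \<open>0 \<le> a\<close> by (intro mult_mono) auto
  finally have "(norm (?K x))\<^sup>2 * (norm (?K x))\<^sup>2 \<le> (norm (?K x))\<^sup>2 * (a * norm x)\<^sup>2"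
    by (simp add: power_mult_distrib power2_eq_square ac_simps)
  then have "(norm (?K x))\<^sup>2 \<le> (a * norm x)\<^sup>2"
    by (rule le_of_mult_self_le) simp_all
  then show "norm (?K x) \<le> a * norm x" by (rule power2_le_imp_le) (simp add: \<open>0 \<le> a\<close>)
qed

section \<open>Square roots, absolute values and the approximate polar decomposition\<close>

interpretation compose: bounded_bilinear "(o\<^sub>L) :: oper \<Rightarrow> oper \<Rightarrow> oper"
  by (rule bounded_bilinear_blinfun_compose)

lemma norm_compose_le: "norm (S o\<^sub>L T) \<le> norm S * norm (T :: oper)"
  by (rule norm_blinfun_compose)

text \<open>The iteration \<open>Y \<mapsto> (K + Y\<^sup>2) / 2\<close> increases, from \<open>0\<close>, to the solution of \<open>(1 - Y)\<^sup>2 = 1 - K\<close>; it is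
  dominated in norm by the same scalar iteration with \<open>K = 1\<close>.\<close>

lemma contraction_sqrt:
  fixes K :: oper
  assumes K: "selfadj_op K" "norm K \<le> 1"
  obtains Y where "selfadj_op Y" "norm Y \<le> 1" "2 *\<^sub>R Y = K + (Y o\<^sub>L Y)"
    "\<And>S. S o\<^sub>L K = K o\<^sub>L S \<Longrightarrow> S o\<^sub>L Y = Y o\<^sub>L S"
proof -
  define Y where "Y = rec_nat 0 (\<lambda>_ Y. (1/2) *\<^sub>R (K + (Y o\<^sub>L Y)))"
  define y where "y = rec_nat 0 (\<lambda>_ y :: real. (1 + y * y) / 2)"
  have Y: "Y 0 = 0" "Y (Suc n) = (1/2) *\<^sub>R (K + (Y n o\<^sub>L Y n))" for n by (auto simp: Y_def)
  have y: "y 0 = 0" "y (Suc n) = (1 + y n * y n) / 2" for n by (auto simp: y_def)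
  have y01: "0 \<le> y n \<and> y n \<le> 1" for n
    by (induction n) (auto simp: y intro: mult_le_one)
  have comm: "S o\<^sub>L Y n = Y n o\<^sub>L S" if "S o\<^sub>L K = K o\<^sub>L S" for S n
  proof (induction n)
    case (Suc n)
    have "S o\<^sub>L (Y n o\<^sub>L Y n) = (Y n o\<^sub>L Y n) o\<^sub>L S" by (metis Suc oper_compose_assoc)
    then show ?case by (simp add: Y that compose.scaleR_left compose.scaleR_right compose.add_left compose.add_right)
  qed (simp add: Y)
  have commY: "Y m o\<^sub>L Y n = Y n o\<^sub>L Y m" for m n by (rule comm) (rule comm [symmetric], rule refl)
  have sa: "selfadj_op (Y n)" for n by (induction n) (auto simp: Y intro!: selfadj_op_intros K)
  have nY: "norm (Y n) \<le> y n" for n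
  proof (induction n)
    case (Suc n)
    have "norm (K + (Y n o\<^sub>L Y n)) \<le> 1 + y n * y n"
      by (intro norm_triangle_le add_mono K order_trans [OF norm_compose_le] mult_mono Suc) (use y01 in auto)
    then show ?case by (simp add: Y y)
  qed (simp add: Y y)
  have step: "norm (Y (Suc n) - Y n) \<le> y (Suc n) - y n" for n
  proof (induction n)
    case 0
    show ?case using K by (simp add: Y y)
  next
    case (Suc n)
    \<comment> \<open>The iterates commute, so the difference of squares factors, exactly as in the
      scalar iteration.\<close>
    have "(Y (Suc n) o\<^sub>L Y (Suc n)) - (Y n o\<^sub>L Y n) = (Y (Suc n) + Y n) o\<^sub>L (Y (Suc n) - Y n)"
      by (simp add: compose.add_left compose.diff_right commY [of "Suc n" n])
    then have "Y (Suc (Suc n)) - Y (Suc n) = (1/2) *\<^sub>R ((Y (Suc n) + Y n) o\<^sub>L (Y (Suc n) - Y n))"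
      by (simp add: Y(2) [of "Suc n"] Y(2) [of n] algebra_simps flip: scaleR_diff_right)
    moreover have "norm ((Y (Suc n) + Y n) o\<^sub>L (Y (Suc n) - Y n)) \<le> (y (Suc n) + y n) * (y (Suc n) - y n)"
      by (intro order_trans [OF norm_compose_le] mult_mono Suc norm_triangle_le add_mono nY) (use y01 in auto)
    ultimately have "norm (Y (Suc (Suc n)) - Y (Suc n)) \<le> (1/2) * ((y (Suc n) + y n) * (y (Suc n) - y n))"
      by simp
    also have "\<dots> = y (Suc (Suc n)) - y (Suc n)" 
      unfolding y(2) [of "Suc n"] y(2) [of n] by (simp add: field_simps)
    finally show ?case .
  qed
  have mono: "norm (Y (n + k) - Y n) \<le> y (n + k) - y n" for n k
  proof (induction k)
    case (Suc k)
    have "norm (Y (n + Suc k) - Y n) \<le> norm (Y (Suc (n + k)) - Y (n + k)) + norm (Y (n + k) - Y n)"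
      using norm_triangle_ineq [of "Y (Suc (n + k)) - Y (n + k)" "Y (n + k) - Y n"] by simp
    then show ?case using step [of "n + k"] Suc by simp
  qed simp
  have "convergent y"
  proof (rule Bseq_mono_convergent)
    show "Bseq y" by (rule BseqI' [of _ 1]) (use y01 in auto)
    show "\<forall>m n. m \<le> n \<longrightarrow> y m \<le> y n"
      using mono by (metis add_increasing2 diff_ge_0_iff_ge le_add_diff_inverse norm_ge_zero order_trans)
  qed
  then have "Cauchy y" by (rule convergent_Cauchy)
  \<comment> \<open>The scalar sequence \<open>y\<close> is monotone and bounded, hence Cauchy, and
    its increments dominate those of \<open>Y\<close>.\<close>
  have "Cauchy Y"
  proof (rule CauchyI')
    fix e :: real assume "e > 0"
    then obtain M where M: "\<And>m n. m \<ge> M \<Longrightarrow> n \<ge> M \<Longrightarrow> norm (y m - y n) < e"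
      using CauchyD [OF \<open>Cauchy y\<close>] by blast
    have "norm (Y m - Y n) < e" if "m \<ge> M" "n > m" for m n
      using mono [of m "n - m"] M [of n m] that by (simp add: norm_minus_commute)
    then show "\<exists>M. \<forall>m\<ge>M. \<forall>n>m. dist (Y m) (Y n) < e" unfolding dist_norm by blast
  qed
  then obtain L where L: "Y \<longlonglongrightarrow> L" using Cauchy_convergent convergent_def by blast
  show thesis
  proof (rule that [of L])
    show "selfadj_op L" by (rule selfadj_op_lim [OF sa L])
    show "norm L \<le> 1"
      by (rule LIMSEQ_le_const2 [OF tendsto_norm [OF L]]) (use nY y01 order_trans in blast)
    show "2 *\<^sub>R L = K + (L o\<^sub>L L)"
    proof (rule LIMSEQ_unique)
      show "(\<lambda>n. 2 *\<^sub>R Y (Suc n)) \<longlonglongrightarrow> 2 *\<^sub>R L" by (intro tendsto_intros LIMSEQ_Suc L)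
      show "(\<lambda>n. 2 *\<^sub>R Y (Suc n)) \<longlonglongrightarrow> K + (L o\<^sub>L L)"
        by (simp add: Y) (intro tendsto_intros compose.tendsto L)
    qed
    show "S o\<^sub>L L = L o\<^sub>L S" if "S o\<^sub>L K = K o\<^sub>L S" for S
    proof (rule LIMSEQ_unique)
      show "(\<lambda>n. S o\<^sub>L Y n) \<longlonglongrightarrow> (S o\<^sub>L L)" by (intro tendsto_intros compose.tendsto L)
      show "(\<lambda>n. S o\<^sub>L Y n) \<longlonglongrightarrow> (L o\<^sub>L S)"
        unfolding comm [OF that] by (intro tendsto_intros compose.tendsto L)
    qed
  qed
qed

text \<open>With \<open>K = 1 - A/a\<close>, the equation solved by \<open>contraction_sqrt\<close>
  reads \<open>(1 - Y)^2 = A/a\<close>. The commutation clause is what makes the root comparable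
  with any other root in \<open>positive_sqrt_unique\<close>.\<close>

lemma positive_sqrt_exists:
  assumes A: "positive_op A"
  obtains P where "positive_op P" "P o\<^sub>L P = A" "\<And>S. S o\<^sub>L A = A o\<^sub>L S \<Longrightarrow> S o\<^sub>L P = P o\<^sub>L S"
proof -
  define a where "a = norm A + 1"
  have a: "a > 0" "norm A \<le> a" by (auto simp: a_def add_nonneg_pos)
  define K where "K = (1/a) *\<^sub>R (a *\<^sub>R id_blinfun - A)"
  have K: "selfadj_op K" "norm K \<le> 1"
    using A norm_diff_positive_le [OF A a(2)] a(1)
    by (auto simp: K_def positive_op_iff intro!: selfadj_op_intros)
  obtain Y where Y: "selfadj_op Y" "norm Y \<le> 1" "2 *\<^sub>R Y = K + (Y o\<^sub>L Y)"
    "\<And>S. S o\<^sub>L K = K o\<^sub>L S \<Longrightarrow> S o\<^sub>L Y = Y o\<^sub>L S"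
    using contraction_sqrt [OF K] by blast
  define P where "P = sqrt a *\<^sub>R (id_blinfun - Y)"
  have "Y x \<bullet> x \<le> x \<bullet> x" for x
  proof -
    have "Y x \<bullet> x \<le> norm (Y x) * norm x" by (rule norm_cauchy_schwarz)
    also have "\<dots> \<le> (1 * norm x) * norm x"
      by (intro mult_right_mono norm_blinfun_le Y) simp
    finally show ?thesis by (simp add: power2_eq_square dot_square_norm)
  qed
  then have "positive_op P"
    using a(1) by (auto simp: P_def positive_op_iff blinfun.diff_left blinfun.scaleR_left inner_diff_left
        intro!: selfadj_op_intros Y)
  moreover have "P o\<^sub>L P = A"
  proof -
    have "(id_blinfun - Y) o\<^sub>L (id_blinfun - Y) = id_blinfun - 2 *\<^sub>R Y + (Y o\<^sub>L Y)"
      by (simp add: compose.diff_left compose.diff_right scaleR_2)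
    also have "\<dots> = id_blinfun - K" by (simp add: Y(3))
    also have "\<dots> = (1/a) *\<^sub>R A" using a(1) by (simp add: K_def scaleR_diff_right)
    finally have "a *\<^sub>R ((id_blinfun - Y) o\<^sub>L (id_blinfun - Y)) = A" using a(1) by simp
    then show ?thesis
      using a(1) by (simp add: P_def compose.scaleR_left compose.scaleR_right)
  qed
  moreover have "S o\<^sub>L P = P o\<^sub>L S" if "S o\<^sub>L A = A o\<^sub>L S" for S
  proof -
    have "S o\<^sub>L K = (1/a) *\<^sub>R (a *\<^sub>R S - (S o\<^sub>L A))"
      by (simp only: K_def compose.diff_right compose.scaleR_right oper_compose_id)
    also have "\<dots> = K o\<^sub>L S"
      by (simp only: K_def compose.diff_left compose.scaleR_left oper_compose_id that)
    finally have "S o\<^sub>L K = K o\<^sub>L S" .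
    from Y(4) [OF this] show ?thesis
      by (simp only: P_def compose.diff_left compose.diff_right compose.scaleR_left compose.scaleR_right oper_compose_id)
  qed
  ultimately show thesis by (rule that)
qed

text \<open>Both roots are compared with the constructed root \<open>R\<close>, which commutes with
  whatever commutes with the square. For \<open>D = P - R\<close> the product
  \<open>(P + R) D\<close> vanishes; as \<open>P\<close> and \<open>R\<close> are positive, each of
  them annihilates the range of \<open>D\<close>. Hence \<open>D^2 = 0\<close>, and
  \<open>D = 0\<close> because \<open>D\<close> is self-adjoint.\<close>

lemma positive_sqrt_unique:
  assumes P: "positive_op P" and Q: "positive_op Q" and eq: "P o\<^sub>L P = Q o\<^sub>L Q"
  shows "P = Q"
proof -
  have "(Q o\<^sub>L Q) x \<bullet> x = Q x \<bullet> Q x" for x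
    using Q by (metis blinfun_apply_blinfun_compose positive_op_iff selfadj_op_inner)
  then have "positive_op (Q o\<^sub>L Q)"
    using Q by (auto simp: positive_op_iff intro: selfadj_op_intros)
  then obtain R where R: "positive_op R" "R o\<^sub>L R = Q o\<^sub>L Q" 
    "\<And>S. S o\<^sub>L (Q o\<^sub>L Q) = (Q o\<^sub>L Q) o\<^sub>L S \<Longrightarrow> S o\<^sub>L R = R o\<^sub>L S"
    using positive_sqrt_exists by blast
  have "P = R" if P: "positive_op P" and sq: "P o\<^sub>L P = Q o\<^sub>L Q" for P
  proof -
    have "P o\<^sub>L (Q o\<^sub>L Q) = (Q o\<^sub>L Q) o\<^sub>L P" by (metis sq oper_compose_assoc)
    then have comm: "P o\<^sub>L R = R o\<^sub>L P" by (rule R(3))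
    define D where "D = P - R"
    have sa: "selfadj_op D" using P R(1) by (simp add: D_def positive_op_iff selfadj_op_intros)
    have zero: "(P + R) o\<^sub>L D = 0"
      by (simp add: D_def compose.add_left compose.diff_right sq R(2) comm)
    have "D x = 0" for x
    proof -
      have "P (D x) \<bullet> D x + R (D x) \<bullet> D x = ((P + R) o\<^sub>L D) x \<bullet> D x" by (simp add: blinfun.add_left inner_add_left)
      also have "\<dots> = 0" by (simp add: zero)
      finally have "P (D x) \<bullet> D x = 0" "R (D x) \<bullet> D x = 0" 
        using P R(1) by (metis add_nonneg_eq_0_iff positive_op_iff)+
      then have "P (D x) = 0" "R (D x) = 0" using P R(1) positive_op_apply_eq_0 by blast+
      then have "D (D x) = 0" by (simp add: D_def blinfun.diff_left)
      then have "D x \<bullet> D x = 0" by (simp add: selfadj_op_inner [OF sa])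
      then show ?thesis by simp
    qed
    then have "D = 0" by (simp add: blinfun_eqI)
    then show ?thesis by (simp add: D_def)
  qed
  from this [OF P eq] this [OF Q refl] show ?thesis by simp
qed

lemma abs_op_eqI:
  assumes "positive_op P" "P o\<^sub>L P = adj_op T o\<^sub>L T"
  shows "abs_op T = P"
  unfolding abs_op_def by (rule the_equality) (use assms positive_sqrt_unique in auto)

lemma abs_op:
  assumes "clinear_op T"
  shows "positive_op (abs_op T)" "abs_op T o\<^sub>L abs_op T = adj_op T o\<^sub>L T" "norm (abs_op T x) = norm (T x)"
proof -
  have "positive_op (adj_op T o\<^sub>L T)"
    unfolding positive_op_def by (simp add: assms adj_op(1) adj_op_left [OF assms] cinner_self flip: of_real_power)
  then obtain P where P: "positive_op P" "P o\<^sub>L P = adj_op T o\<^sub>L T"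
    using positive_sqrt_exists by blast
  then have eq: "abs_op T = P" by (rule abs_op_eqI)
  then show "positive_op (abs_op T)" "abs_op T o\<^sub>L abs_op T = adj_op T o\<^sub>L T" using P by auto
  have "cinner (P x) (P x) = cinner ((P o\<^sub>L P) x) x"
    using P(1) by (simp add: positive_op_iff selfadj_opD)
  also have "\<dots> = cinner (T x) (T x)" using P(2) by (simp add: adj_op_left [OF assms])
  finally have "(norm (P x))\<^sup>2 = (norm (T x))\<^sup>2" by (simp add: cinner_self flip: of_real_power)
  then show "norm (abs_op T x) = norm (T x)" by (simp add: eq)
qed

text \<open>\<open>P + e = c (1 - K)\<close> with \<open>norm K \<le> norm P / c < 1\<close>, so the
  Neumann series inverts it. The contraction bounds follow from positivity: the cross term in the
  square of \<open>norm (P y + e y)\<close> is nonnegative, so that square dominates the sum of the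
  squares of both parts.\<close>

lemma positive_resolvent:
  assumes P: "positive_op P" and e: "e > 0"
  obtains Q where "selfadj_op Q" "\<And>x. P (Q x) + e *\<^sub>R Q x = x" "\<And>x. Q (P x + e *\<^sub>R x) = x"
    "\<And>x. norm (P (Q x)) \<le> norm x" "\<And>x. norm (e *\<^sub>R Q x) \<le> norm x"
proof -
  define c where "c = norm P + e"
  have c: "c > 0" using e by (simp add: c_def add_nonneg_pos)
  define K where "K = (1/c) *\<^sub>R (norm P *\<^sub>R id_blinfun - P)"
  define q where "q = norm P / c"
  have nK: "norm K \<le> q" using norm_diff_positive_le [OF P order_refl] c by (simp add: K_def q_def divide_right_mono)
  have q: "0 \<le> q" "q < 1" using c e by (auto simp: q_def c_def)
  define Kp where "Kp n = ((o\<^sub>L) K ^^ n) id_blinfun" for n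
  have Kp: "norm (Kp n) \<le> q ^ n" for n
  proof (induction n)
    case 0
    show ?case by (simp add: Kp_def norm_blinfun_id_le)
  next
    case (Suc n)
    then show ?case unfolding Kp_def
      by simp (intro order_trans [OF norm_compose_le] mult_mono nK, auto simp: q)
  qed
  have sumK: "summable Kp"
    by (rule summable_comparison_test' [of "\<lambda>n. q ^ n"]) (use q Kp in \<open>auto intro: summable_geometric\<close>)
  define S where "S = suminf Kp"
  have "K o\<^sub>L S = (\<Sum>n. K o\<^sub>L Kp n)"
    unfolding S_def by (rule bounded_linear.suminf [OF compose.bounded_linear_right sumK])
  also have "\<dots> = (\<Sum>n. Kp (Suc n))" by (simp add: Kp_def)
  also have "\<dots> = S - id_blinfun" 
    unfolding S_def suminf_split_head [OF sumK] by (simp add: Kp_def)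
  finally have KS: "K (S x) = S x - x" for x
    by (metis blinfun.diff_left blinfun_apply_blinfun_compose blinfun_apply_id_blinfun id_apply)
  define Q where "Q = (1/c) *\<^sub>R S"
  have right: "P (Q x) + e *\<^sub>R Q x = x" for x
  proof -
    have PK: "P y = norm P *\<^sub>R y - c *\<^sub>R K y" for y 
      using c by (simp add: K_def blinfun.diff_left blinfun.scaleR_left)
    have "P (S x) = norm P *\<^sub>R S x - c *\<^sub>R (S x - x)" by (simp only: PK [of "S x"] KS)
    then have "P (S x) + e *\<^sub>R S x = c *\<^sub>R x" by (simp add: c_def algebra_simps)
    then have "(1/c) *\<^sub>R (P (S x) + e *\<^sub>R S x) = x" using c by simp
    then show ?thesis by (simp add: Q_def blinfun.scaleR_left blinfun.scaleR_right scaleR_add_right mult.commute)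
  qed
  have bound: "(norm (P y + e *\<^sub>R y))\<^sup>2 \<ge> (norm (P y))\<^sup>2 + (norm (e *\<^sub>R y))\<^sup>2" for y
  proof -
    have "(norm (P y + e *\<^sub>R y))\<^sup>2 = (norm (P y))\<^sup>2 + (norm (e *\<^sub>R y))\<^sup>2 + 2 * e * (P y \<bullet> y)"
      unfolding power2_norm_eq_inner by (simp add: inner_add inner_commute algebra_simps)
    moreover have "P y \<bullet> y \<ge> 0" using P positive_op_iff by blast
    ultimately show ?thesis using e by simp
  qed
  have inj: "y = 0" if "P y + e *\<^sub>R y = 0" for y
    using bound [of y] e by (simp add: that sum_power2_le_zero_iff)
  have inj2: "y = z" if "P y + e *\<^sub>R y = P z + e *\<^sub>R z" for y z
    using inj [of "y - z"] that by (simp add: blinfun.diff_right algebra_simps)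
  have clP: "P (d *\<^sub>C x) = d *\<^sub>C P x" for d x using P clinear_opD positive_op_def by blast
  have clQ: "Q (d *\<^sub>C x) = d *\<^sub>C Q x" for d x
    by (rule inj2) (simp add: right clP flip: cscale_simps(5) cscale.add_right)
  have saP: "cinner (P x) y = cinner x (P y)" for x y using P positive_op_iff selfadj_opD by blast
  have "cinner (Q x) y = cinner x (Q y)" for x y
  proof -
    have "cinner (Q x) y = cinner (Q x) (P (Q y) + e *\<^sub>R Q y)" by (simp add: right)
    also have "\<dots> = cinner (P (Q x) + e *\<^sub>R Q x) (Q y)"
      by (simp add: cinner.add_left cinner.add_right saP cinner.scaleR_left cinner.scaleR_right)
    finally show ?thesis by (simp add: right)
  qed
  then have sa: "selfadj_op Q" by (simp add: selfadj_op_def clinear_op_def clQ)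
  have left: "Q (P x + e *\<^sub>R x) = x" for x by (rule inj2) (simp add: right)
  have nle: "norm (P (Q x)) \<le> norm x" "norm (e *\<^sub>R Q x) \<le> norm x" for x
  proof -
    have "(norm (P (Q x)))\<^sup>2 \<le> (norm x)\<^sup>2" "(norm (e *\<^sub>R Q x))\<^sup>2 \<le> (norm x)\<^sup>2"
      using bound [of "Q x"] zero_le_power2 [of "norm (P (Q x))"] zero_le_power2 [of "norm (e *\<^sub>R Q x)"]
      unfolding right by linarith+
    then show "norm (P (Q x)) \<le> norm x" "norm (e *\<^sub>R Q x) \<le> norm x"
      using power2_le_imp_le norm_ge_zero by blast+
  qed
  show thesis by (rule that [OF sa right left nle])
qed

text \<open>With \<open>Q\<close> the resolvent of \<open>|T|\<close> at \<open>e\<close>, the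
  errors are exactly \<open>T - W |T| = e T Q\<close> and \<open>|T| - V T = e |T| Q\<close>. Both
  are small because \<open>T Q\<close> and \<open>|T| Q\<close> have the same norm on each vector,
  at most that of the vector. \<open>V\<close> is the adjoint of \<open>W\<close> and inherits its
  bound.\<close>

lemma approx_polar:
  assumes T: "clinear_op T" and e: "e > 0"
  obtains V W where "clinear_op V" "clinear_op W" "norm V \<le> 1" "norm W \<le> 1"
    "norm (T - (W o\<^sub>L abs_op T)) \<le> e" "norm (abs_op T - (V o\<^sub>L T)) \<le> e"
proof -
  let ?P = "abs_op T"
  note P = abs_op [OF T]
  obtain Q where Q: "selfadj_op Q" "\<And>x. ?P (Q x) + e *\<^sub>R Q x = x" "\<And>x. Q (?P x + e *\<^sub>R x) = x"
    "\<And>x. norm (?P (Q x)) \<le> norm x" "\<And>x. norm (e *\<^sub>R Q x) \<le> norm x"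
    using positive_resolvent [OF P(1) e] by blast
  have PQ: "?P (Q x) = x - e *\<^sub>R Q x" for x using Q(2) [of x] by (simp add: eq_diff_eq)
  have QP: "Q (?P x) = x - e *\<^sub>R Q x" for x using Q(3) [of x] by (simp add: blinfun.add_right blinfun.scaleR_right eq_diff_eq)
  define W where "W = T o\<^sub>L Q"
  define V where "V = Q o\<^sub>L adj_op T"
  have cl: "clinear_op V" "clinear_op W" using Q(1) T adj_op by (auto simp: V_def W_def selfadj_op_def)
  have W: "norm (W x) \<le> norm x" for x using Q(4) [of x] by (simp add: W_def P)
  have VW: "cinner (W x) y = cinner x (V y)" for x y
    using Q(1) by (simp add: V_def W_def adj_op [OF T] selfadj_opD)
  have "norm (V x) \<le> norm x" for x
  proof -
    have "norm (V x) * norm (V x) = cmod (cinner (W (V x)) x)"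
      by (simp add: VW cinner_self power2_eq_square norm_mult)
    also have "\<dots> \<le> norm (W (V x)) * norm x" by (rule cmod_cinner_le)
    also have "\<dots> \<le> norm (V x) * norm x" by (intro mult_right_mono W) simp
    finally show ?thesis by (cases "norm (V x) = 0") (simp_all add: mult_le_cancel_left_pos)
  qed
  then have nV: "norm V \<le> 1" by (intro norm_blinfun_bound) auto
  have nW: "norm W \<le> 1" using W by (intro norm_blinfun_bound) auto
  have aT: "norm (T - (W o\<^sub>L ?P)) \<le> e"
  proof (rule norm_blinfun_bound)
    fix x
    have "norm ((T - (W o\<^sub>L ?P)) x) = e * norm (T (Q x))"
      using e by (simp add: W_def QP blinfun.diff_left blinfun.diff_right blinfun.scaleR_right)
    also have "\<dots> \<le> e * norm x" using Q(4) [of x] e by (simp add: P)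
    finally show "norm ((T - (W o\<^sub>L ?P)) x) \<le> e * norm x" .
  qed (use e in auto)
  have aP: "norm (?P - (V o\<^sub>L T)) \<le> e"
  proof (rule norm_blinfun_bound)
    fix x
    have "(V o\<^sub>L T) x = Q ((adj_op T o\<^sub>L T) x)" by (simp add: V_def)
    also have "\<dots> = Q (?P (?P x))" by (simp flip: P(2))
    finally have "norm ((?P - (V o\<^sub>L T)) x) = e * norm (Q (?P x))"
      using e by (simp add: QP blinfun.diff_left)
    also have "Q (?P x) = ?P (Q x)" by (simp add: QP PQ)
    also have "e * norm (?P (Q x)) \<le> e * norm x" using Q(4) [of x] e by simp
    finally show "norm ((?P - (V o\<^sub>L T)) x) \<le> e * norm x" .
  qed (use e in auto)
  show thesis by (rule that [OF cl nV nW aT aP])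
qed

section \<open>Trace norm and trace\<close>

lemma ennreal_norm_sq_ell2: "ennreal ((norm x)\<^sup>2) = (\<Sum>n. ennreal ((cmod (coord x n))\<^sup>2))"
  unfolding norm_sq_ell2 by (simp add: suminf_ennreal2 summable_coord)

lemma ennreal_suminf_swap: "(\<Sum>n. \<Sum>m. f n m) = (\<Sum>m. \<Sum>n. (f n m :: ennreal))"
proof -
  have "(\<integral>\<^sup>+n. (\<Sum>m. f n m) \<partial>count_space UNIV) = (\<Sum>m. \<integral>\<^sup>+n. f n m \<partial>count_space UNIV)"
    by (rule nn_integral_suminf) simp
  then show ?thesis by (simp add: nn_integral_count_space_nat)
qed

text \<open>Both sides are the double sum of the squared moduli of the matrix entries.\<close>

lemma hilbert_schmidt_adj:
  assumes "clinear_op T"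
  shows "(\<Sum>n. ennreal ((norm (adj_op T (ket n)))\<^sup>2)) = (\<Sum>n. ennreal ((norm (T (ket n)))\<^sup>2))"
proof -
  have "cmod (coord (adj_op T (ket n)) m) = cmod (coord (T (ket m)) n)" for m n
    using adj_op_left [OF assms, of "ket n" "ket m"] by simp
  then show ?thesis unfolding ennreal_norm_sq_ell2 by (subst ennreal_suminf_swap) simp
qed

lemma trace_norm_hilbert_schmidt:
  assumes "selfadj_op R" "R o\<^sub>L R = abs_op T"
  shows "trace_norm T = (\<Sum>n. ennreal ((norm (R (ket n)))\<^sup>2))"
proof -
  have "Re (cinner (abs_op T x) x) = (norm (R x))\<^sup>2" for x
    using assms by (simp add: selfadj_opD cinner_self flip: assms(2))
  then show ?thesis by (simp add: trace_norm_def del: cinner_ket_right)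
qed

lemma sum_le_of_ennreal_suminf:
  assumes "(\<Sum>n. ennreal (f n)) \<le> ennreal t" "\<And>n. 0 \<le> f n" "0 \<le> t"
  shows "(\<Sum>n<N. f n) \<le> t"
proof -
  have "ennreal (\<Sum>n<N. f n) = (\<Sum>n<N. ennreal (f n))" using assms(2) by simp
  also have "\<dots> \<le> (\<Sum>n. ennreal (f n))" by (rule sum_le_suminf) auto
  finally have "ennreal (\<Sum>n<N. f n) \<le> ennreal t" using assms(1) by (rule order_trans)
  then show ?thesis using assms(3) by (simp add: ennreal_le_iff)
qed

text \<open>Up to \<open>\<epsilon>\<close>, \<open>Z T = (Z W) R R\<close> with \<open>R\<^sup>2 = |T|\<close> and \<open>W\<close> a contraction; AM-GM then bounds the
  diagonal by half the sum of the Hilbert-Schmidt norms of \<open>R\<close> and of \<open>(Z W R)\<^sup>*\<close>.\<close>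

lemma trace_pairing_le:
  assumes T: "clinear_op T" and Z: "clinear_op Z" "norm Z \<le> 1"
  shows "ennreal (\<Sum>n<N. cmod (cinner (Z (T (ket n))) (ket n))) \<le> trace_norm T"
proof (cases "trace_norm T = \<infinity>")
  case False
  then obtain t where t: "trace_norm T = ennreal t" "0 \<le> t" by (cases "trace_norm T") auto
  obtain R where R: "positive_op R" "R o\<^sub>L R = abs_op T"
    using positive_sqrt_exists [OF abs_op(1) [OF T]] by blast
  have sa: "selfadj_op R" using R positive_op_iff by blast
  note clR = selfadj_op_clinear [OF sa]
  have RR: "R (R x) = abs_op T x" for x by (simp flip: R(2))
  have hsR: "(\<Sum>n<N. (norm (R (ket n)))\<^sup>2) \<le> t"
    by (rule sum_le_of_ennreal_suminf) (use t trace_norm_hilbert_schmidt [OF sa R(2)] in auto)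
  have "(\<Sum>n<N. cmod (cinner (Z (T (ket n))) (ket n))) \<le> t + e" if e: "e > 0" for e
  proof -
    \<comment> \<open>The error \<open>d\<close> is incurred once for each of the \<open>N\<close>
      diagonal entries; the summand 1 covers \<open>N = 0\<close>.\<close>
    define d where "d = e / (real N + 1)"
    have d: "d > 0" "real N * d \<le> e" using e by (auto simp: d_def field_simps)
    obtain V W where W: "clinear_op W" "norm W \<le> 1" "norm (T - (W o\<^sub>L abs_op T)) \<le> d"
      using approx_polar [OF T d(1)] by metis
    define C where "C = Z o\<^sub>L W"
    have C: "clinear_op C" "norm C \<le> 1"
      using W Z by (auto simp: C_def intro!: order_trans [OF norm_compose_le] mult_le_one)
    have cl: "clinear_op (C o\<^sub>L R)" using C clR by simp
    have "(\<Sum>n. ennreal ((norm (adj_op (C o\<^sub>L R) (ket n)))\<^sup>2)) \<le> (\<Sum>n. ennreal ((norm (R (ket n)))\<^sup>2))"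
      unfolding hilbert_schmidt_adj [OF cl]
      using norm_blinfun_le [OF C(2)] by (intro suminf_le) (auto intro!: ennreal_leI power_mono)
    then have hsC: "(\<Sum>n<N. (norm (adj_op (C o\<^sub>L R) (ket n)))\<^sup>2) \<le> t"
      using t trace_norm_hilbert_schmidt [OF sa R(2)] by (intro sum_le_of_ennreal_suminf) auto
    have "cmod (cinner (Z (T (ket n))) (ket n))
        \<le> d + ((norm (R (ket n)))\<^sup>2 + (norm (adj_op (C o\<^sub>L R) (ket n)))\<^sup>2) / 2" for n
    proof -
      let ?u = "(T - (W o\<^sub>L abs_op T)) (ket n)"
      have "Z (T (ket n)) = Z ?u + C (R (R (ket n)))"
        by (simp add: C_def RR blinfun.diff_left blinfun.diff_right)
      then have "cmod (cinner (Z (T (ket n))) (ket n))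
          \<le> cmod (cinner (Z ?u) (ket n)) + cmod (cinner (C (R (R (ket n)))) (ket n))"
        by (simp only: cinner.add_left norm_triangle_ineq)
      moreover have "cmod (cinner (Z ?u) (ket n)) \<le> d"
      proof -
        have "cmod (cinner (Z ?u) (ket n)) \<le> norm (Z ?u)" using cmod_cinner_le [of "Z ?u" "ket n"] by simp
        also have "\<dots> \<le> norm ?u" using norm_blinfun_le [OF Z(2), of ?u] by simp
        also have "\<dots> \<le> d" using norm_blinfun_le [OF W(3), of "ket n"] by simp
        finally show ?thesis .
      qed
      moreover have "cmod (cinner (C (R (R (ket n)))) (ket n))
          \<le> ((norm (R (ket n)))\<^sup>2 + (norm (adj_op (C o\<^sub>L R) (ket n)))\<^sup>2) / 2"
      proof -
        have "cmod (cinner (C (R (R (ket n)))) (ket n)) = cmod (cinner (R (ket n)) (adj_op (C o\<^sub>L R) (ket n)))"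
          using adj_op(2) [OF cl, of "R (ket n)" "ket n"] by simp
        also have "\<dots> \<le> norm (R (ket n)) * norm (adj_op (C o\<^sub>L R) (ket n))" by (rule cmod_cinner_le)
        also have "\<dots> \<le> ((norm (R (ket n)))\<^sup>2 + (norm (adj_op (C o\<^sub>L R) (ket n)))\<^sup>2) / 2"
          using sum_squares_bound [of "norm (R (ket n))" "norm (adj_op (C o\<^sub>L R) (ket n))"] by simp
        finally show ?thesis .
      qed
      ultimately show ?thesis by linarith
    qed
    then have "(\<Sum>n<N. cmod (cinner (Z (T (ket n))) (ket n)))
        \<le> (\<Sum>n<N. d + ((norm (R (ket n)))\<^sup>2 + (norm (adj_op (C o\<^sub>L R) (ket n)))\<^sup>2) / 2)"
      by (intro sum_mono)
    also have "\<dots> = real N * d + ((\<Sum>n<N. (norm (R (ket n)))\<^sup>2) + (\<Sum>n<N. (norm (adj_op (C o\<^sub>L R) (ket n)))\<^sup>2)) / 2"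
      by (simp add: sum.distrib flip: sum_divide_distrib)
    also have "\<dots> \<le> e + (t + t) / 2" using d(2) hsR hsC by (intro add_mono divide_right_mono) auto
    finally show ?thesis by simp
  qed
  then have "(\<Sum>n<N. cmod (cinner (Z (T (ket n))) (ket n))) \<le> t" by (rule field_le_epsilon)
  then show ?thesis by (simp add: t ennreal_leI)
qed simp

text \<open>The converse half of the duality: pairing with the contraction \<open>V\<close> of the
  approximate polar decomposition recovers the diagonal of \<open>abs_op T\<close> up to
  \<open>e\<close>. The absolute value is not additive in \<open>T\<close>, whereas the diagonal
  sums are linear; upper bounds on trace norms of sums and integrals are therefore obtained through
  this rule.\<close>

lemma trace_norm_leI:
  assumes T: "clinear_op T"
    and le: "\<And>Z N. clinear_op Z \<Longrightarrow> norm Z \<le> 1 \<Longrightarrow> ennreal (cmod (\<Sum>n<N. cinner (Z (T (ket n))) (ket n))) \<le> c"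
  shows "trace_norm T \<le> c"
  unfolding trace_norm_def
proof (rule suminf_le_const)
  fix N
  have pos: "0 \<le> Re (cinner (abs_op T x) x)" for x
    using abs_op(1) [OF T] by (simp add: positive_op_iff Re_cinner)
  show "(\<Sum>n<N. ennreal (Re (cinner (abs_op T (ket n)) (ket n)))) \<le> c"
  proof (rule ennreal_le_epsilon)
    fix e :: real assume e: "0 < e"
    define d where "d = e / (real N + 1)"
    have d: "d > 0" "real N * d \<le> e" using e by (auto simp: d_def field_simps)
    obtain V W where V: "clinear_op V" "norm V \<le> 1" "norm (abs_op T - (V o\<^sub>L T)) \<le> d"
      using approx_polar [OF T d(1)] by metis
    have "Re (cinner (abs_op T (ket n)) (ket n)) \<le> d + Re (cinner (V (T (ket n))) (ket n))" for n
    proof -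
      let ?u = "(abs_op T - (V o\<^sub>L T)) (ket n)"
      have "Re (cinner (abs_op T (ket n)) (ket n)) = Re (cinner ?u (ket n)) + Re (cinner (V (T (ket n))) (ket n))"
        by (simp add: blinfun.diff_left del: cinner_ket_right) (simp add: cinner.diff_left)
      moreover have "Re (cinner ?u (ket n)) \<le> norm ?u * norm (ket n)"
        using cmod_cinner_le complex_Re_le_cmod order_trans by blast
      moreover have "norm ?u \<le> d" using norm_blinfun_le [OF V(3), of "ket n"] by simp
      ultimately show ?thesis by simp
    qed
    then have "(\<Sum>n<N. Re (cinner (abs_op T (ket n)) (ket n))) \<le> (\<Sum>n<N. d + Re (cinner (V (T (ket n))) (ket n)))"
      by (intro sum_mono)
    also have "\<dots> = real N * d + Re (\<Sum>n<N. cinner (V (T (ket n))) (ket n))" by (simp add: sum.distrib)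
    also have "\<dots> \<le> e + cmod (\<Sum>n<N. cinner (V (T (ket n))) (ket n))"
      by (intro add_mono d complex_Re_le_cmod)
    finally have "ennreal (\<Sum>n<N. Re (cinner (abs_op T (ket n)) (ket n)))
        \<le> ennreal (e + cmod (\<Sum>n<N. cinner (V (T (ket n))) (ket n)))" by (rule ennreal_leI)
    also have "\<dots> \<le> ennreal e + c" using e le [OF V(1,2)] by (simp add: ennreal_plus add_left_mono)
    finally show "(\<Sum>n<N. ennreal (Re (cinner (abs_op T (ket n)) (ket n)))) \<le> c + ennreal e"
      using pos by (simp add: add.commute del: cinner_ket_right)
  qed
qed simp

section \<open>The trace class as a complex normed space\<close>

lemma trace_norm_add:
  assumes "clinear_op S" "clinear_op T"
  shows "trace_norm (S + T) \<le> trace_norm S + trace_norm T"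
proof (rule trace_norm_leI)
  fix Z :: oper and N assume Z: "clinear_op Z" "norm Z \<le> 1"
  have "cmod (\<Sum>n<N. cinner (Z ((S + T) (ket n))) (ket n))
      \<le> (\<Sum>n<N. cmod (cinner (Z (S (ket n))) (ket n))) + (\<Sum>n<N. cmod (cinner (Z (T (ket n))) (ket n)))"
    by (simp add: blinfun.add_left blinfun.add_right norm_triangle_ineq flip: sum.distrib)
      (intro order_trans [OF norm_sum] sum_mono norm_triangle_ineq)
  then have "ennreal (cmod (\<Sum>n<N. cinner (Z ((S + T) (ket n))) (ket n)))
      \<le> ennreal (\<Sum>n<N. cmod (cinner (Z (S (ket n))) (ket n))) + ennreal (\<Sum>n<N. cmod (cinner (Z (T (ket n))) (ket n)))"
    by (simp add: sum_nonneg ennreal_leI flip: ennreal_plus)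
  also have "\<dots> \<le> trace_norm S + trace_norm T"
    by (intro add_mono trace_pairing_le assms Z)
  finally show "ennreal (cmod (\<Sum>n<N. cinner (Z ((S + T) (ket n))) (ket n))) \<le> trace_norm S + trace_norm T" .
qed (use assms in simp)

text \<open>Operators are real-linear maps, so \<open>scaleR\<close> only supplies their real
  multiples.\<close>

definition cscale_op :: "complex \<Rightarrow> oper \<Rightarrow> oper"
  where "cscale_op c T = Blinfun (\<lambda>x. c *\<^sub>C T x)"

lemma cscale_op_apply [simp]: "cscale_op c T x = c *\<^sub>C T x"
  unfolding cscale_op_def
  by (subst bounded_linear_Blinfun_apply)
    (auto intro!: bounded_linear_compose [OF cscale.bounded_linear_right] blinfun.bounded_linear_right)

lemma bounded_bilinear_cscale_op: "bounded_bilinear cscale_op"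
proof
  show "\<exists>K. \<forall>c T. norm (cscale_op c T) \<le> norm c * norm T * K"
    by (intro exI [of _ 1] allI norm_blinfun_bound)
      (simp_all add: mult.assoc mult_left_mono norm_blinfun)
qed (rule blinfun_eqI; simp add: blinfun.add_left blinfun.scaleR_left cscale.add_left cscale.add_right 
      cscale.scaleR_left cscale.scaleR_right)+

interpretation cscale_op: bounded_bilinear cscale_op by (rule bounded_bilinear_cscale_op)

lemma norm_cscale_op_le: "norm (cscale_op c T) \<le> cmod c * norm T"
  by (rule norm_blinfun_bound) (simp_all add: mult.assoc mult_left_mono norm_blinfun)

lemma clinear_cscale_op [simp, intro]: "clinear_op T \<Longrightarrow> clinear_op (cscale_op c T)"
  by (simp add: clinear_op_def mult.commute)

lemma trace_norm_cscale_op: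
  assumes "clinear_op T"
  shows "trace_norm (cscale_op c T) \<le> ennreal (cmod c) * trace_norm T"
proof (rule trace_norm_leI)
  fix Z :: oper and N assume Z: "clinear_op Z" "norm Z \<le> 1"
  have "cmod (\<Sum>n<N. cinner (Z (cscale_op c T (ket n))) (ket n))
      \<le> cmod c * (\<Sum>n<N. cmod (cinner (Z (T (ket n))) (ket n)))"
    by (simp add: clinear_opD [OF Z(1)] norm_mult mult_left_mono norm_sum flip: sum_distrib_left)
  then have "ennreal (cmod (\<Sum>n<N. cinner (Z (cscale_op c T (ket n))) (ket n)))
      \<le> ennreal (cmod c) * ennreal (\<Sum>n<N. cmod (cinner (Z (T (ket n))) (ket n)))"
    by (simp add: sum_nonneg ennreal_leI flip: ennreal_mult)
  also have "\<dots> \<le> ennreal (cmod c) * trace_norm T"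
    by (intro mult_left_mono trace_pairing_le assms Z) simp
  finally show "ennreal (cmod (\<Sum>n<N. cinner (Z (cscale_op c T (ket n))) (ket n))) \<le> ennreal (cmod c) * trace_norm T" .
qed (use assms in simp)

lemma trace_norm_0 [simp]: "trace_norm 0 = 0"
proof -
  have "trace_norm 0 \<le> 0" by (rule trace_norm_leI) (simp_all add: cinner.zero_left)
  then show ?thesis by simp
qed

lemma cscale_op_minus_one: "cscale_op (- 1) T = - T"
  by (rule blinfun_eqI) (simp add: blinfun.minus_left cscale.minus_left)

lemma trace_norm_minus: "clinear_op T \<Longrightarrow> trace_norm (- T) = trace_norm T"
  using trace_norm_cscale_op [of T "- 1"] trace_norm_cscale_op [of "- T" "- 1"]
  by (simp add: cscale_op_minus_one)

lemma trace_norm_diff: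
  "clinear_op S \<Longrightarrow> clinear_op T \<Longrightarrow> trace_norm (S - T) \<le> trace_norm S + trace_norm T"
  using trace_norm_add [of S "- T"] by (simp add: trace_norm_minus)

lemma S_one_clinear: "T \<in> S_one \<Longrightarrow> clinear_op T"
  by (simp add: S_one_def)

lemma S_one_intros [intro, simp]:
  "0 \<in> S_one"
  "S \<in> S_one \<Longrightarrow> T \<in> S_one \<Longrightarrow> S + T \<in> S_one"
  "S \<in> S_one \<Longrightarrow> T \<in> S_one \<Longrightarrow> S - T \<in> S_one"
  "T \<in> S_one \<Longrightarrow> cscale_op c T \<in> S_one"
proof -
  show "S + T \<in> S_one" if "S \<in> S_one" "T \<in> S_one"
    using that trace_norm_add [of S T] by (auto simp: S_one_def intro: le_less_trans)
  show "S - T \<in> S_one" if "S \<in> S_one" "T \<in> S_one"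
    using that trace_norm_diff [of S T] by (auto simp: S_one_def intro: le_less_trans)
  show "cscale_op c T \<in> S_one" if "T \<in> S_one"
    using that trace_norm_cscale_op [of T c] by (auto simp: S_one_def ennreal_mult_less_top intro: le_less_trans)
qed (simp add: S_one_def)

text \<open>\<open>enn2real\<close> sends an infinite trace norm to 0, so inequalities for
  \<open>tn\<close> are stated on \<open>S_one\<close>.\<close>

definition tn :: "oper \<Rightarrow> real" where "tn T = enn2real (trace_norm T)"

lemma tn_nonneg [simp]: "0 \<le> tn T" by (simp add: tn_def)

lemma trace_norm_tn: "T \<in> S_one \<Longrightarrow> trace_norm T = ennreal (tn T)"
  by (simp add: S_one_def tn_def)

lemma tn_add: "S \<in> S_one \<Longrightarrow> T \<in> S_one \<Longrightarrow> tn (S + T) \<le> tn S + tn T"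
  using trace_norm_add [of S T] by (simp add: trace_norm_tn S_one_clinear flip: ennreal_plus)

lemma tn_diff: "S \<in> S_one \<Longrightarrow> T \<in> S_one \<Longrightarrow> tn (S - T) \<le> tn S + tn T"
  using trace_norm_diff [of S T] by (simp add: trace_norm_tn S_one_clinear flip: ennreal_plus)

lemma tn_minus_commute: "S \<in> S_one \<Longrightarrow> T \<in> S_one \<Longrightarrow> tn (S - T) = tn (T - S)"
  using trace_norm_minus [of "S - T"] by (simp add: tn_def S_one_clinear)

text \<open>Rescaling \<open>A\<close> to a contraction reduces this to
  \<open>trace_pairing_le\<close>. It makes the trace series of \<open>A o\<^sub>L T\<close>
  absolutely convergent and yields the pairing bound \<open>cmod_tr_le\<close>.\<close>

lemma trace_diagonal_bound:
  assumes T: "T \<in> S_one" and A: "clinear_op A"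
  shows "(\<Sum>n<N. cmod (cinner ((A o\<^sub>L T) (ket n)) (ket n))) \<le> norm A * tn T"
proof (cases "A = 0")
  case False
  then have n: "norm A > 0" by simp
  define Z where "Z = (1 / norm A) *\<^sub>R A"
  have "clinear_op Z" "norm Z \<le> 1" using A n by (auto simp: Z_def)
  from trace_pairing_le [OF S_one_clinear [OF T] this]
  have "(\<Sum>n<N. cmod (cinner (Z (T (ket n))) (ket n))) \<le> tn T"
    by (simp add: trace_norm_tn [OF T] sum_nonneg)
  moreover have "(\<Sum>n<N. cmod (cinner (Z (T (ket n))) (ket n))) 
      = (\<Sum>n<N. cmod (cinner ((A o\<^sub>L T) (ket n)) (ket n))) / norm A"
    using n by (simp add: Z_def blinfun.scaleR_left sum_divide_distrib norm_mult)
  ultimately show ?thesis using n by (simp add: pos_divide_le_eq mult.commute)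
qed (simp add: cinner.zero_left)

lemma trace_diagonal_summable:
  assumes "T \<in> S_one" "clinear_op A"
  shows "summable (\<lambda>n. cmod (cinner ((A o\<^sub>L T) (ket n)) (ket n)))"
  using trace_diagonal_bound [OF assms] by (intro summableI_nonneg_bounded) auto

lemma tr_sums:
  assumes "T \<in> S_one" "clinear_op A"
  shows "(\<lambda>n. cinner ((A o\<^sub>L T) (ket n)) (ket n)) sums tr (A o\<^sub>L T)"
  unfolding tr_def by (rule summable_sums [OF summable_norm_cancel [OF trace_diagonal_summable [OF assms]]])

lemma cmod_tr_le:
  assumes "T \<in> S_one" "clinear_op A"
  shows "cmod (tr (A o\<^sub>L T)) \<le> norm A * tn T"
proof -
  have "cmod (tr (A o\<^sub>L T)) \<le> (\<Sum>n. cmod (cinner ((A o\<^sub>L T) (ket n)) (ket n)))"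
    unfolding tr_def by (intro summable_norm trace_diagonal_summable assms)
  also have "\<dots> \<le> norm A * tn T"
    by (intro suminf_le_const trace_diagonal_summable trace_diagonal_bound assms)
  finally show ?thesis .
qed

lemma tr_add_right:
  "S \<in> S_one \<Longrightarrow> T \<in> S_one \<Longrightarrow> clinear_op A \<Longrightarrow> tr (A o\<^sub>L (S + T)) = tr (A o\<^sub>L S) + tr (A o\<^sub>L T)"
  using sums_add [OF tr_sums tr_sums, of S A T A] tr_sums [of "S + T" A]
  by (simp add: sums_iff blinfun.add_left blinfun.add_right)

lemma tr_diff_right:
  "S \<in> S_one \<Longrightarrow> T \<in> S_one \<Longrightarrow> clinear_op A \<Longrightarrow> tr (A o\<^sub>L (S - T)) = tr (A o\<^sub>L S) - tr (A o\<^sub>L T)"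
  using sums_diff [OF tr_sums tr_sums, of S A T A] tr_sums [of "S - T" A]
  by (simp add: sums_iff blinfun.diff_left blinfun.diff_right)

lemma tr_diff_left:
  "T \<in> S_one \<Longrightarrow> clinear_op A \<Longrightarrow> clinear_op B \<Longrightarrow> tr ((A - B) o\<^sub>L T) = tr (A o\<^sub>L T) - tr (B o\<^sub>L T)"
  using sums_diff [OF tr_sums tr_sums, of T A T B] tr_sums [of T "A - B"]
  by (simp add: sums_iff blinfun.diff_left)

lemma tr_cscale_right:
  "T \<in> S_one \<Longrightarrow> clinear_op A \<Longrightarrow> tr (A o\<^sub>L cscale_op c T) = c * tr (A o\<^sub>L T)"
  using sums_mult [OF tr_sums, of T A c] tr_sums [of "cscale_op c T" A]
  by (simp add: sums_iff clinear_opD)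

lemma tr_cscale_left:
  "T \<in> S_one \<Longrightarrow> clinear_op A \<Longrightarrow> tr (cscale_op c A o\<^sub>L T) = c * tr (A o\<^sub>L T)"
  using sums_mult [OF tr_sums, of T A c] tr_sums [of T "cscale_op c A"]
  by (simp add: sums_iff)

lemma S_one_sum: "(\<And>i. i \<in> I \<Longrightarrow> A i \<in> S_one) \<Longrightarrow> (\<Sum>i\<in>I. A i) \<in> S_one"
  by (induction I rule: infinite_finite_induct) auto

lemma tr_sum_right:
  assumes "finite I" "\<And>i. i \<in> I \<Longrightarrow> B i \<in> S_one" "clinear_op A"
  shows "tr (A o\<^sub>L (\<Sum>i\<in>I. B i)) = (\<Sum>i\<in>I. tr (A o\<^sub>L B i))"
  using assms(1,2)
proof induction
  case (insert i I)
  have "B i \<in> S_one" "(\<Sum>i\<in>I. B i) \<in> S_one" using insert.prems by (simp, intro S_one_sum) simp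
  then have "tr (A o\<^sub>L (B i + (\<Sum>i\<in>I. B i))) = tr (A o\<^sub>L B i) + tr (A o\<^sub>L (\<Sum>i\<in>I. B i))"
    by (rule tr_add_right) (rule assms(3))
  moreover have "tr (A o\<^sub>L (\<Sum>i\<in>I. B i)) = (\<Sum>i\<in>I. tr (A o\<^sub>L B i))"
    by (rule insert.IH) (rule insert.prems, simp)
  ultimately show ?case using insert.hyps by simp
qed (simp add: tr_def cinner.zero_left)

section \<open>Tensor products of operators\<close>

text \<open>\<open>ell2\<close> is identified with its Hilbert tensor square: the coordinate \<open>prod_encode (j, i)\<close> belongs
  to \<open>ket i\<close> tensored with \<open>ket j\<close>, so that \<open>ell2_col j x\<close> lists the coordinates of \<open>x\<close> along \<open>j\<close>.\<close>

lemma coord_Abs_ell2: "summable (\<lambda>n. (cmod (f n))\<^sup>2) \<Longrightarrow> coord (Abs_ell2 f) = f"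
  by (rule Abs_ell2_inverse) simp

lift_definition ell2_col :: "nat \<Rightarrow> ell2 \<Rightarrow> ell2" is "\<lambda>j x i. x (prod_encode (j, i))"
proof -
  fix j and x :: "nat \<Rightarrow> complex" assume x: "summable (\<lambda>n. (cmod (x n))\<^sup>2)"
  have "inj (\<lambda>i. prod_encode (j, i))" by (auto intro: injI)
  from summable_reindex [OF x this] show "summable (\<lambda>i. (cmod (x (prod_encode (j, i))))\<^sup>2)" by (simp add: o_def)
qed

lemma inj_prod_swap: "inj (\<lambda>n. prod_encode (prod.swap (prod_decode n)))"
  by (rule injI) (metis prod_decode_eq prod_encode_eq swap_swap)

lift_definition ell2_flip :: "ell2 \<Rightarrow> ell2" is "\<lambda>x n. x (prod_encode (prod.swap (prod_decode n)))"
proof -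
  fix x :: "nat \<Rightarrow> complex" assume "summable (\<lambda>n. (cmod (x n))\<^sup>2)"
  from summable_reindex [OF this inj_prod_swap]
  show "summable (\<lambda>n. (cmod (x (prod_encode (prod.swap (prod_decode n)))))\<^sup>2)" by (simp add: o_def)
qed

lemma ennreal_norm_sq_double:
  fixes x :: "nat \<Rightarrow> ell2"
  shows
  "(\<Sum>n. ennreal ((cmod (coord (x (fst (prod_decode n))) (snd (prod_decode n))))\<^sup>2))
    = (\<Sum>j. ennreal ((norm (x j))\<^sup>2))"
proof -
  have "(\<Sum>n. (\<lambda>(j, i). ennreal ((cmod (coord (x j) i))\<^sup>2)) (prod_decode n)) = (\<Sum>j. ennreal ((norm (x j))\<^sup>2))"
    by (rule suminf_ennreal_2dimen) (simp only: ennreal_norm_sq_ell2 prod.case)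
  then show ?thesis by (simp only: case_prod_unfold)
qed

lemma ennreal_norm_sq_cols: "ennreal ((norm x)\<^sup>2) = (\<Sum>j. ennreal ((norm (ell2_col j x))\<^sup>2))"
  unfolding ennreal_norm_sq_double [symmetric] by (simp add: ennreal_norm_sq_ell2 ell2_col.rep_eq)

text \<open>Assembles an element of the tensor square from its columns; \<open>left_raw\<close> and
  \<open>vtens\<close> both obtain their vectors in this way.\<close>

lemma ell2_glue:
  fixes x :: "nat \<Rightarrow> ell2"
  assumes "(\<Sum>j. ennreal ((norm (x j))\<^sup>2)) \<noteq> top"
  obtains y where "\<And>n. coord y n = coord (x (fst (prod_decode n))) (snd (prod_decode n))"
proof -
  have "summable (\<lambda>n. (cmod (coord (x (fst (prod_decode n))) (snd (prod_decode n))))\<^sup>2)"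
    using assms by (intro summable_suminf_not_top) (simp_all add: ennreal_norm_sq_double)
  from coord_Abs_ell2 [OF this] show thesis using that by metis
qed

text \<open>This is \<open>A \<otimes> 1\<close>: \<open>A\<close> acts on every column. The choice
  is unambiguous because a vector is determined by its coordinates; that one exists follows from
  \<open>left_cols_le\<close>.\<close>

definition left_raw :: "oper \<Rightarrow> ell2 \<Rightarrow> ell2"
  where "left_raw A x = (SOME y. \<forall>n. coord y n = coord (A (ell2_col (fst (prod_decode n)) x)) (snd (prod_decode n)))"

lemma left_cols_le:
  fixes A :: oper
  shows "(\<Sum>j. ennreal ((norm (A (ell2_col j x)))\<^sup>2)) \<le> ennreal ((norm A * norm x)\<^sup>2)"
proof -
  have "(\<Sum>j. ennreal ((norm (A (ell2_col j x)))\<^sup>2)) \<le> (\<Sum>j. ennreal ((norm A)\<^sup>2) * ennreal ((norm (ell2_col j x))\<^sup>2))"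
    by (intro suminf_le)
      (auto simp flip: ennreal_mult power_mult_distrib intro!: ennreal_leI power_mono norm_blinfun)
  also have "\<dots> = ennreal ((norm A * norm x)\<^sup>2)"
    by (simp add: power_mult_distrib ennreal_mult flip: ennreal_norm_sq_cols)
  finally show ?thesis .
qed

lemma coord_left_raw: "coord (left_raw A x) n = coord (A (ell2_col (fst (prod_decode n)) x)) (snd (prod_decode n))"
proof -
  have "(\<Sum>j. ennreal ((norm (A (ell2_col j x)))\<^sup>2)) \<noteq> top"
    using left_cols_le [of A x] by (auto simp: top_unique)
  from ell2_glue [OF this] have "\<exists>y. \<forall>n. coord y n = coord (A (ell2_col (fst (prod_decode n)) x)) (snd (prod_decode n))"
    by metis
  from someI_ex [OF this] show ?thesis unfolding left_raw_def by blast
qed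

lemma norm_left_raw_le: "norm (left_raw A x) \<le> norm A * norm x"
proof -
  have "ennreal ((norm (left_raw A x))\<^sup>2) = (\<Sum>j. ennreal ((norm (A (ell2_col j x)))\<^sup>2))"
    unfolding ennreal_norm_sq_ell2 [of "left_raw A x"] coord_left_raw
    using ennreal_norm_sq_double [of "\<lambda>j. A (ell2_col j x)"] by simp
  also have "\<dots> \<le> ennreal ((norm A * norm x)\<^sup>2)" by (rule left_cols_le)
  finally have "(norm (left_raw A x))\<^sup>2 \<le> (norm A * norm x)\<^sup>2" by simp
  then show ?thesis by (rule power2_le_imp_le) simp
qed

lemma ell2_col_linear:
  "ell2_col j (x + y) = ell2_col j x + ell2_col j y" "ell2_col j (r *\<^sub>R x) = r *\<^sub>R ell2_col j x"
  "ell2_col j (c *\<^sub>C x) = c *\<^sub>C ell2_col j x"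
  by (rule ell2_eqI; simp add: ell2_col.rep_eq)+

lemma bounded_linear_left_raw: "bounded_linear (left_raw A)"
  by (rule bounded_linear_intro [of _ "norm A"])
    (auto intro!: ell2_eqI simp: coord_left_raw ell2_col_linear blinfun.add_right blinfun.scaleR_right
      norm_left_raw_le mult.commute [of _ "norm A"])

definition left_op :: "oper \<Rightarrow> oper" where "left_op A = Blinfun (left_raw A)"

lemma left_op_apply: "left_op A x = left_raw A x"
  by (simp add: left_op_def bounded_linear_Blinfun_apply bounded_linear_left_raw)

lemma norm_left_op_le: "norm (left_op A) \<le> norm A"
  by (rule norm_blinfun_bound) (simp_all add: left_op_apply norm_left_raw_le)

lemma bounded_linear_left_op: "bounded_linear left_op"
  by (rule bounded_linear_intro [of _ 1])
    (auto intro!: blinfun_eqI ell2_eqI simp: left_op_apply coord_left_raw blinfun.add_left blinfun.scaleR_left norm_left_op_le)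

lemma clinear_left_op: "clinear_op A \<Longrightarrow> clinear_op (left_op A)"
  unfolding clinear_op_def [of "left_op A"] left_op_apply
  by (auto intro!: ell2_eqI simp: coord_left_raw ell2_col_linear clinear_opD)

lemma norm_ell2_flip_le: "norm (ell2_flip x) \<le> norm x"
proof (rule power2_le_imp_le)
  show "(norm (ell2_flip x))\<^sup>2 \<le> (norm x)\<^sup>2"
    unfolding norm_sq_ell2 ell2_flip.rep_eq
    using suminf_reindex_mono [OF summable_coord inj_prod_swap, of x] by (simp add: o_def)
qed simp

lemma bounded_linear_ell2_flip: "bounded_linear ell2_flip"
  by (rule bounded_linear_intro [of _ 1])
    (auto intro!: ell2_eqI simp: ell2_flip.rep_eq norm_ell2_flip_le)

definition flip_op :: oper where "flip_op = Blinfun ell2_flip"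

lemma flip_op_apply: "flip_op x = ell2_flip x"
  by (simp add: flip_op_def bounded_linear_Blinfun_apply bounded_linear_ell2_flip)

lemma norm_flip_op_le: "norm flip_op \<le> 1"
  by (rule norm_blinfun_bound) (simp_all add: flip_op_apply norm_ell2_flip_le)

lemma clinear_flip_op: "clinear_op flip_op"
  by (auto simp: clinear_op_def flip_op_apply ell2_flip.rep_eq intro!: ell2_eqI)

text \<open>Conjugating \<open>left_op B\<close> by the exchange of the two tensor factors gives
  \<open>1 \<otimes> B\<close>, so bounds and linearity in \<open>B\<close> follow from those of
  \<open>left_op\<close>.\<close>

definition tens_op :: "oper \<Rightarrow> oper \<Rightarrow> oper"  (infixr "\<otimes>\<^sub>o" 70)
  where "A \<otimes>\<^sub>o B = left_op A o\<^sub>L (flip_op o\<^sub>L (left_op B o\<^sub>L flip_op))"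

lemma clinear_tens_op [simp, intro]: "clinear_op A \<Longrightarrow> clinear_op B \<Longrightarrow> clinear_op (A \<otimes>\<^sub>o B)"
  by (simp add: tens_op_def clinear_left_op clinear_flip_op)

lemma norm_tens_op_le: "norm (A \<otimes>\<^sub>o B) \<le> norm A * norm B"
proof -
  have "norm (flip_op o\<^sub>L (left_op B o\<^sub>L flip_op)) \<le> 1 * (norm B * 1)"
    by (intro order_trans [OF norm_compose_le] mult_mono norm_flip_op_le norm_left_op_le) auto
  then have le: "norm (flip_op o\<^sub>L (left_op B o\<^sub>L flip_op)) \<le> norm B" by simp
  have "norm (A \<otimes>\<^sub>o B) \<le> norm (left_op A) * norm (flip_op o\<^sub>L (left_op B o\<^sub>L flip_op))"
    unfolding tens_op_def by (rule norm_compose_le)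
  also have "\<dots> \<le> norm A * norm B" by (intro mult_mono norm_left_op_le le) auto
  finally show ?thesis .
qed

lemma bounded_bilinear_tens_op: "bounded_bilinear (\<otimes>\<^sub>o)"
proof -
  interpret left: bounded_linear left_op by (rule bounded_linear_left_op)
  show ?thesis
  proof
    show "\<exists>K. \<forall>A B. norm (A \<otimes>\<^sub>o B) \<le> norm A * norm B * K"
      by (intro exI [of _ 1]) (simp add: norm_tens_op_le)
  qed (simp_all add: tens_op_def left.add left.scaleR compose.add_left compose.add_right
      compose.scaleR_left compose.scaleR_right)
qed

interpretation tens_op: bounded_bilinear "(\<otimes>\<^sub>o)" by (rule bounded_bilinear_tens_op)

section \<open>Elementary tensors; adjoints, absolute values and traces of tensor products\<close>

definition vtens :: "ell2 \<Rightarrow> ell2 \<Rightarrow> ell2"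
  where "vtens x y = (SOME z. \<forall>n. coord z n = coord y (fst (prod_decode n)) * coord x (snd (prod_decode n)))"

lemma coord_vtens: "coord (vtens x y) n = coord y (fst (prod_decode n)) * coord x (snd (prod_decode n))"
proof -
  have "(\<Sum>j. ennreal ((norm (coord y j *\<^sub>C x))\<^sup>2)) = (\<Sum>j. ennreal ((cmod (coord y j))\<^sup>2)) * ennreal ((norm x)\<^sup>2)"
    by (simp add: power_mult_distrib ennreal_mult flip: ennreal_suminf_multc)
  also have "\<dots> \<noteq> top" by (simp add: ennreal_mult_eq_top_iff flip: ennreal_norm_sq_ell2)
  finally obtain z where "\<And>n. coord z n = coord (coord y (fst (prod_decode n)) *\<^sub>C x) (snd (prod_decode n))"
    using ell2_glue by metis
  then have "\<exists>z. \<forall>n. coord z n = coord y (fst (prod_decode n)) * coord x (snd (prod_decode n))"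
    by (metis cscale.rep_eq)
  from someI_ex [OF this] show ?thesis unfolding vtens_def by blast
qed

text \<open>Through this, identities between complex-linear operators, which
  \<open>clinear_op_eqI\<close> reduces to basis vectors, become computations on elementary
  tensors.\<close>

lemma ket_eq_vtens: "ket n = vtens (ket (snd (prod_decode n))) (ket (fst (prod_decode n)))"
proof (rule ell2_eqI)
  fix k
  have "k = n \<longleftrightarrow> fst (prod_decode k) = fst (prod_decode n) \<and> snd (prod_decode k) = snd (prod_decode n)"
    by (metis prod_decode_eq prod_eq_iff)
  then show "coord (ket n) k = coord (vtens (ket (snd (prod_decode n))) (ket (fst (prod_decode n)))) k"
    by (simp add: coord_vtens)
qed

lemma tens_op_vtens:
  assumes "clinear_op A" "clinear_op B"
  shows "(A \<otimes>\<^sub>o B) (vtens x y) = vtens (A x) (B y)"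
proof -
  have flip: "ell2_flip (vtens x y) = vtens y x" for x y
    by (rule ell2_eqI) (simp add: ell2_flip.rep_eq coord_vtens)
  have "ell2_col j (vtens x y) = coord y j *\<^sub>C x" for j x y
    by (rule ell2_eqI) (simp add: ell2_col.rep_eq coord_vtens)
  then have left: "left_raw A (vtens x y) = vtens (A x) y" if "clinear_op A" for A x y
    by (intro ell2_eqI) (simp add: coord_left_raw coord_vtens clinear_opD [OF that])
  show ?thesis
    using assms by (simp add: tens_op_def left_op_apply flip_op_apply flip left)
qed

lemma tens_op_ket:
  assumes "clinear_op A" "clinear_op B"
  shows "(A \<otimes>\<^sub>o B) (ket n) = vtens (A (ket (snd (prod_decode n)))) (B (ket (fst (prod_decode n))))"
  by (subst ket_eq_vtens) (rule tens_op_vtens [OF assms])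

lemma tens_op_compose:
  assumes "clinear_op A" "clinear_op B" "clinear_op C" "clinear_op D"
  shows "(A \<otimes>\<^sub>o B) o\<^sub>L (C \<otimes>\<^sub>o D) = (A o\<^sub>L C) \<otimes>\<^sub>o (B o\<^sub>L D)"
  by (rule clinear_op_eqI) (use assms in \<open>simp_all add: tens_op_ket tens_op_vtens\<close>)

lemma adj_op_eqI_ket:
  assumes "clinear_op T" "clinear_op S" "\<And>m n. coord (T (ket m)) n = cnj (coord (S (ket n)) m)"
  shows "adj_op T = S"
proof (rule clinear_op_eqI)
  show "adj_op T (ket n) = S (ket n)" for n
  proof (rule ell2_eqI)
    show "coord (adj_op T (ket n)) m = coord (S (ket n)) m" for m
      using adj_op(2) [OF assms(1), of "ket m" "ket n"] assms(3) [of m n] by simp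
  qed
qed (use assms adj_op in auto)

lemma coord_adj_op: "clinear_op T \<Longrightarrow> coord (T (ket m)) n = cnj (coord (adj_op T (ket n)) m)"
  using adj_op(2) [of T "ket m" "ket n"] by simp

lemma adj_op_tens:
  assumes "clinear_op A" "clinear_op B"
  shows "adj_op (A \<otimes>\<^sub>o B) = adj_op A \<otimes>\<^sub>o adj_op B"
  by (rule adj_op_eqI_ket)
    (use assms adj_op(1) in \<open>simp_all add: tens_op_ket coord_vtens coord_adj_op [of A] coord_adj_op [of B]\<close>)

lemma selfadj_op_iff_adj: "selfadj_op P \<longleftrightarrow> clinear_op P \<and> adj_op P = P"
  by (metis adj_op(2) adj_op_eqI selfadj_op_def)

lemma positive_op_square: "selfadj_op R \<Longrightarrow> positive_op (R o\<^sub>L R)"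
  unfolding positive_op_iff
  by (metis blinfun_apply_blinfun_compose inner_ge_zero selfadj_op_inner selfadj_op_intros(6))

text \<open>\<open>|A| \<otimes> |B|\<close> is positive because it is the square of the
  self-adjoint operator \<open>R \<otimes> S\<close> built from the roots of both factors. Its own
  square is the required one, and positive roots are unique.\<close>

lemma abs_op_tens:
  assumes "clinear_op A" "clinear_op B"
  shows "abs_op (A \<otimes>\<^sub>o B) = abs_op A \<otimes>\<^sub>o abs_op B"
proof (rule abs_op_eqI)
  note pos = abs_op(1) [OF assms(1)] abs_op(1) [OF assms(2)]
  obtain R S where R: "positive_op R" "R o\<^sub>L R = abs_op A" and S: "positive_op S" "S o\<^sub>L S = abs_op B"
    using pos positive_sqrt_exists by metis
  have cl: "clinear_op R" "clinear_op S" "clinear_op (abs_op A)" "clinear_op (abs_op B)"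
    using R(1) S(1) pos by (simp_all add: positive_op_def)
  have "selfadj_op (R \<otimes>\<^sub>o S)"
    using R(1) S(1) cl by (simp add: positive_op_iff selfadj_op_iff_adj adj_op_tens)
  from positive_op_square [OF this] show "positive_op (abs_op A \<otimes>\<^sub>o abs_op B)"
    using cl by (simp add: tens_op_compose R S)
  show "(abs_op A \<otimes>\<^sub>o abs_op B) o\<^sub>L (abs_op A \<otimes>\<^sub>o abs_op B) = adj_op (A \<otimes>\<^sub>o B) o\<^sub>L (A \<otimes>\<^sub>o B)"
    using cl assms by (simp add: tens_op_compose adj_op_tens adj_op(1) abs_op(2))
qed

lemma trace_norm_tens:
  assumes "clinear_op A" "clinear_op B"
  shows "trace_norm (A \<otimes>\<^sub>o B) = trace_norm A * trace_norm B"
proof -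
  let ?a = "\<lambda>T n. cinner (abs_op T (ket n)) (ket n)"
  have real: "?a T n \<in> \<real>" "0 \<le> Re (?a T n)" if "clinear_op T" for T n
    using abs_op(1) [OF that] by (auto simp: positive_op_iff selfadj_op_quadratic Re_cinner simp del: cinner_ket_right)
  have cl: "clinear_op (abs_op A)" "clinear_op (abs_op B)"
    using abs_op(1) assms by (simp_all add: positive_op_def)
  have "?a (A \<otimes>\<^sub>o B) n = ?a B (fst (prod_decode n)) * ?a A (snd (prod_decode n))" for n
    using assms cl by (simp add: abs_op_tens tens_op_ket coord_vtens)
  then have "ennreal (Re (?a (A \<otimes>\<^sub>o B) n))
      = ennreal (Re (?a B (fst (prod_decode n)))) * ennreal (Re (?a A (snd (prod_decode n))))" for n
    using real assms by (simp add: complex_is_Real_iff flip: ennreal_mult)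
  then have "trace_norm (A \<otimes>\<^sub>o B)
      = (\<Sum>n. (\<lambda>(j, i). ennreal (Re (?a B j)) * ennreal (Re (?a A i))) (prod_decode n))"
    unfolding trace_norm_def by (simp add: case_prod_unfold)
  also have "\<dots> = (\<Sum>j. ennreal (Re (?a B j)) * trace_norm A)"
    unfolding trace_norm_def by (rule suminf_ennreal_2dimen) simp
  also have "\<dots> = trace_norm B * trace_norm A"
    unfolding trace_norm_def by simp
  finally show ?thesis by (simp add: mult.commute)
qed

lemma S_one_tens [intro, simp]: "A \<in> S_one \<Longrightarrow> B \<in> S_one \<Longrightarrow> A \<otimes>\<^sub>o B \<in> S_one"
  by (simp add: S_one_def trace_norm_tens ennreal_mult_less_top)

text \<open>Fubini for absolutely convergent double series, along the pairing enumeration. It serves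
  traces of tensor products, double series of convolutions and products of two series of
  convolutions.\<close>

lemma sums_prod_decode:
  fixes f :: "nat \<Rightarrow> nat \<Rightarrow> 'a :: banach"
  assumes "\<And>j. summable (\<lambda>k. norm (f j k))" "summable (\<lambda>j. \<Sum>k. norm (f j k))"
  shows "summable (\<lambda>n. norm (case prod_decode n of (j, k) \<Rightarrow> f j k))"
    and "(\<lambda>n. case prod_decode n of (j, k) \<Rightarrow> f j k) sums (\<Sum>j. \<Sum>k. f j k)"
proof -
  have "(\<lambda>p. norm (case_prod f p)) summable_on (SIGMA j:UNIV. UNIV)"
  proof (rule summable_on_SigmaI [where g = "\<lambda>j. \<Sum>k. norm (f j k)"])
    show "((\<lambda>k. norm (case_prod f (j, k))) has_sum (\<Sum>k. norm (f j k))) UNIV" for j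
      using assms(1) [of j] by (simp add: sums_nonneg_imp_has_sum summable_sums)
    show "(\<lambda>j. \<Sum>k. norm (f j k)) summable_on UNIV"
      using assms by (intro summable_nonneg_imp_summable_on) (auto intro: suminf_nonneg)
  qed auto
  then have abs: "(\<lambda>p. norm (case_prod f p)) summable_on UNIV" by simp
  then have "(\<lambda>n. norm (case_prod f (prod_decode n))) summable_on UNIV"
    using summable_on_reindex_bij_betw [OF bij_prod_decode, of "\<lambda>p. norm (case_prod f p)"] by simp
  then show sumn: "summable (\<lambda>n. norm (case prod_decode n of (j, k) \<Rightarrow> f j k))"
    by (rule summable_on_imp_summable)
  obtain s where s: "(case_prod f has_sum s) UNIV"
    using abs_summable_summable [OF abs] by (auto simp: summable_on_def)
  then have "((\<lambda>n. case_prod f (prod_decode n)) has_sum s) UNIV"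
    using has_sum_reindex_bij_betw [OF bij_prod_decode] by blast
  then have 1: "(\<lambda>n. case prod_decode n of (j, k) \<Rightarrow> f j k) sums s" by (rule has_sum_imp_sums)
  have "((\<lambda>j. \<Sum>k. f j k) has_sum s) UNIV"
  proof (rule has_sum_SigmaD [where f = "case_prod f" and g = "\<lambda>j. \<Sum>k. f j k" and B = "\<lambda>_. UNIV"])
    show "(case_prod f has_sum s) (SIGMA j:UNIV. UNIV)" using s by simp
    show "((\<lambda>k. case_prod f (j, k)) has_sum (\<Sum>k. f j k)) UNIV" for j
      using norm_summable_imp_has_sum [OF assms(1) [of j] summable_sums [OF summable_norm_cancel [OF assms(1) [of j]]]]
      by simp
  qed
  then have "(\<lambda>j. \<Sum>k. f j k) sums s" by (rule has_sum_imp_sums)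
  with 1 show "(\<lambda>n. case prod_decode n of (j, k) \<Rightarrow> f j k) sums (\<Sum>j. \<Sum>k. f j k)" by (simp add: sums_iff)
qed

text \<open>The identity that merges two convolution integrands into one: a product of two trace
  pairings is the trace pairing of the tensor products.\<close>

lemma tr_tens:
  assumes A: "clinear_op A" "clinear_op B" and C: "C \<in> S_one" "D \<in> S_one"
  shows "tr ((A \<otimes>\<^sub>o B) o\<^sub>L (C \<otimes>\<^sub>o D)) = tr (A o\<^sub>L C) * tr (B o\<^sub>L D)"
proof -
  note cl = S_one_clinear [OF C(1)] S_one_clinear [OF C(2)]
  let ?a = "\<lambda>n. cinner ((A o\<^sub>L C) (ket n)) (ket n)" and ?b = "\<lambda>n. cinner ((B o\<^sub>L D) (ket n)) (ket n)"
  have sa: "summable (\<lambda>n. cmod (?a n))" "summable (\<lambda>n. cmod (?b n))"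
    using trace_diagonal_summable A C by blast+
  have eq: "cinner (((A \<otimes>\<^sub>o B) o\<^sub>L (C \<otimes>\<^sub>o D)) (ket n)) (ket n) = (case prod_decode n of (j, i) \<Rightarrow> ?b j * ?a i)" for n
    using A cl by (simp add: tens_op_compose tens_op_ket coord_vtens case_prod_unfold)
  have "(\<lambda>n. case prod_decode n of (j, i) \<Rightarrow> ?b j * ?a i) sums (\<Sum>j. \<Sum>i. ?b j * ?a i)"
  proof (rule sums_prod_decode)
    show "summable (\<lambda>i. cmod (?b j * ?a i))" for j using summable_mult [OF sa(1), of "cmod (?b j)"] by (simp only: norm_mult)
    have "(\<Sum>i. cmod (?b j * ?a i)) = cmod (?b j) * (\<Sum>i. cmod (?a i))" for j
      using suminf_mult [OF sa(1), of "cmod (?b j)"] by (simp only: norm_mult)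
    then show "summable (\<lambda>j. \<Sum>i. cmod (?b j * ?a i))" using summable_mult2 [OF sa(2)] by (simp only:)
  qed
  moreover have "(\<Sum>i. ?b j * ?a i) = ?b j * (\<Sum>i. ?a i)" for j 
    by (rule suminf_mult [OF summable_norm_cancel [OF sa(1)]])
  moreover have "(\<Sum>j. ?b j * (\<Sum>i. ?a i)) = (\<Sum>j. ?b j) * (\<Sum>i. ?a i)" 
    by (rule suminf_mult2 [OF summable_norm_cancel [OF sa(2)], symmetric])
  ultimately have "(\<lambda>n. case prod_decode n of (j, i) \<Rightarrow> ?b j * ?a i) sums ((\<Sum>j. ?b j) * (\<Sum>i. ?a i))"
    by simp
  then show ?thesis unfolding tr_def eq by (simp add: sums_iff mult.commute)
qed

section \<open>Compact operators as norm limits of truncations\<close>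

lemma bounded_linear_ket_proj: "bounded_linear (ket_proj N)"
  by (rule bounded_linear_intro [of _ 1]) (auto intro!: ell2_eqI simp: coord_ket_proj norm_ket_proj_le)

definition proj_op :: "nat \<Rightarrow> oper" where "proj_op N = Blinfun (ket_proj N)"

lemma proj_op_apply [simp]: "proj_op N x = ket_proj N x"
  by (simp add: proj_op_def bounded_linear_Blinfun_apply bounded_linear_ket_proj)

lemma clinear_proj_op [simp, intro]: "clinear_op (proj_op N)"
  by (auto simp: clinear_op_def coord_ket_proj intro!: ell2_eqI)

lemma norm_blinfun_unit_ball:
  assumes "\<And>x. norm x \<le> 1 \<Longrightarrow> norm (blinfun_apply T x) \<le> e" "0 \<le> e"
  shows "norm T \<le> e"
proof (rule norm_blinfun_bound)
  fix x
  show "norm (T x) \<le> e * norm x"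
  proof (cases "x = 0")
    case False
    then show ?thesis using assms(1) [of "(1 / norm x) *\<^sub>R x"]
      by (simp add: blinfun.scaleR_right pos_divide_le_eq)
  qed simp
qed (rule assms(2))

lemma S_inf_clinear: "T \<in> S_inf \<Longrightarrow> clinear_op T"
  by (simp add: S_inf_def)

text \<open>Truncations converge pointwise, hence uniformly on a finite net of the image of the unit
  ball. They are contractions, so the error at a nearby point exceeds that at a net point by at most
  twice the distance; the three errors of \<open>e/6\<close> add up to \<open>e/2\<close>.\<close>

lemma S_inf_approx:
  assumes "T \<in> S_inf"
  shows "(\<lambda>N. proj_op N o\<^sub>L T) \<longlonglongrightarrow> T"
proof (rule LIMSEQ_I)
  fix e :: real assume e: "e > 0"
  let ?K = "closure (blinfun_apply T ` cball 0 1)"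
  have "compact ?K" using assms by (simp add: S_inf_def)
  then obtain k where k: "finite k" "?K \<subseteq> (\<Union>x\<in>k. ball x (e/6))"
    using e unfolding compact_eq_totally_bounded by (metis zero_less_divide_iff zero_less_numeral)
  have "\<forall>c\<in>k. eventually (\<lambda>N. norm (ket_proj N c - c) < e/6) sequentially"
    unfolding dist_norm [symmetric] using e by (intro ballI tendstoD [OF ket_proj_tendsto]) simp
  then have "eventually (\<lambda>N. \<forall>c\<in>k. norm (ket_proj N c - c) < e/6) sequentially"
    using k(1) by (simp add: eventually_ball_finite)
  then obtain M where M: "\<And>N c. N \<ge> M \<Longrightarrow> c \<in> k \<Longrightarrow> norm (ket_proj N c - c) < e/6"
    by (auto simp: eventually_sequentially)
  have "norm ((proj_op N o\<^sub>L T) - T) \<le> e/2" if N: "N \<ge> M" for N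
  proof (rule norm_blinfun_unit_ball)
    fix x :: ell2 assume "norm x \<le> 1"
    then have "T x \<in> ?K" using closure_subset by fastforce
    then obtain c where c: "c \<in> k" "norm (T x - c) < e/6" using k(2) by (auto simp: dist_norm norm_minus_commute)
    have "norm (ket_proj N (T x - c)) < e/6" using norm_ket_proj_le c(2) by (rule le_less_trans)
    moreover have "ket_proj N (T x) - T x = ket_proj N (T x - c) + (ket_proj N c - c) - (T x - c)"
      by (simp add: bounded_linear.linear [OF bounded_linear_ket_proj, THEN linear_diff])
    then have "norm (ket_proj N (T x) - T x) \<le> norm (ket_proj N (T x - c)) + norm (ket_proj N c - c) + norm (T x - c)"
      by (metis norm_triangle_ineq norm_triangle_ineq4 order_trans add_right_mono)
    ultimately show "norm (((proj_op N o\<^sub>L T) - T) x) \<le> e/2"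
      using c(2) M [OF N c(1)] by (simp add: blinfun.diff_left)
  qed (use e in auto)
  then show "\<exists>M. \<forall>N\<ge>M. norm ((proj_op N o\<^sub>L T) - T) < e" using e by (intro exI [of _ M]) force
qed

text \<open>Each further dimension adds the compact image of a disc along one more basis
  vector.\<close>

lemma compact_ket_span: "compact {\<Sum>n<N. c n *\<^sub>C ket n | c :: nat \<Rightarrow> complex. \<forall>n<N. cmod (c n) \<le> r}"
proof (induction N)
  case (Suc N)
  let ?D = "\<lambda>N. {\<Sum>n<N. c n *\<^sub>C ket n | c :: nat \<Rightarrow> complex. \<forall>n<N. cmod (c n) \<le> r}"
  have "compact ((\<lambda>c. c *\<^sub>C ket N) ` cball 0 r)"
    by (intro compact_continuous_image linear_continuous_on cscale.bounded_linear_left compact_cball)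
  from compact_sums [OF Suc this]
  have "compact {x + y | x y. x \<in> ?D N \<and> y \<in> (\<lambda>c. c *\<^sub>C ket N) ` cball 0 r}" .
  moreover have "{x + y | x y. x \<in> ?D N \<and> y \<in> (\<lambda>c. c *\<^sub>C ket N) ` cball 0 r} = ?D (Suc N)"
  proof (intro equalityI subsetI)
    fix z assume "z \<in> {x + y | x y. x \<in> ?D N \<and> y \<in> (\<lambda>c. c *\<^sub>C ket N) ` cball 0 r}"
    then obtain c d where cd: "\<forall>n<N. cmod (c n) \<le> r" "cmod d \<le> r" "z = (\<Sum>n<N. c n *\<^sub>C ket n) + d *\<^sub>C ket N"
      by auto
    then have "z = (\<Sum>n<Suc N. (c(N := d)) n *\<^sub>C ket n)" "\<forall>n<Suc N. cmod ((c(N := d)) n) \<le> r"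
      by (auto simp: less_Suc_eq)
    then show "z \<in> ?D (Suc N)" by blast
  next
    fix z assume "z \<in> ?D (Suc N)"
    then obtain c where "\<forall>n<Suc N. cmod (c n) \<le> r" "z = (\<Sum>n<N. c n *\<^sub>C ket n) + c N *\<^sub>C ket N"
      by auto
    moreover from this have "(\<Sum>n<N. c n *\<^sub>C ket n) \<in> ?D N" "c N *\<^sub>C ket N \<in> (\<lambda>c. c *\<^sub>C ket N) ` cball 0 r"
      by auto
    ultimately show "z \<in> {x + y | x y. x \<in> ?D N \<and> y \<in> (\<lambda>c. c *\<^sub>C ket N) ` cball 0 r}"
      by blast
  qed
  ultimately show ?case by simp
qed simp

lemma S_inf_proj:
  assumes "clinear_op T"
  shows "proj_op N o\<^sub>L T \<in> S_inf"
proof -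
  let ?D = "{\<Sum>n<N. c n *\<^sub>C ket n | c :: nat \<Rightarrow> complex. \<forall>n<N. cmod (c n) \<le> norm T}"
  have "blinfun_apply (proj_op N o\<^sub>L T) ` cball 0 1 \<subseteq> ?D"
  proof safe
    fix x :: ell2 assume "x \<in> cball 0 1"
    then have "norm (T x) \<le> norm T" using norm_blinfun [of T x] mult_left_le [of "norm x" "norm T"] by simp
    then have "cmod (coord (T x) n) \<le> norm T" for n using cmod_coord_le order_trans by blast
    then show "\<exists>c. (proj_op N o\<^sub>L T) x = (\<Sum>n<N. c n *\<^sub>C ket n) \<and> (\<forall>n<N. cmod (c n) \<le> norm T)"
      by (intro exI [of _ "coord (T x)"]) (simp add: ket_proj_def)
  qed
  then have "closure (blinfun_apply (proj_op N o\<^sub>L T) ` cball 0 1) \<subseteq> ?D"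
    by (intro closure_minimal compact_imp_closed compact_ket_span)
  then have "closure (blinfun_apply (proj_op N o\<^sub>L T) ` cball 0 1)
      = ?D \<inter> closure (blinfun_apply (proj_op N o\<^sub>L T) ` cball 0 1)" by blast
  moreover have "compact \<dots>"
    by (intro compact_Int_closed compact_ket_span closed_closure)
  ultimately have "compact (closure (blinfun_apply (proj_op N o\<^sub>L T) ` cball 0 1))" by (simp only:)
  then show ?thesis using assms by (simp add: S_inf_def)
qed

lemma S_inf_lim:
  assumes "\<And>n. X n \<in> S_inf" "X \<longlonglongrightarrow> T"
  shows "T \<in> S_inf"
proof -
  let ?K = "closure (blinfun_apply T ` cball 0 1)"
  have "compact ?K"
    unfolding compact_eq_totally_bounded complete_eq_closed
  proof (intro conjI allI impI closed_closure)
    fix e :: real assume e: "e > 0"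
    obtain n where n: "norm (X n - T) < e/4"
      using LIMSEQ_D [OF assms(2), of "e/4"] e by (auto intro: le_refl)
    have "compact (closure (blinfun_apply (X n) ` cball 0 1))" using assms(1) by (simp add: S_inf_def)
    then obtain k where k: "finite k" "closure (blinfun_apply (X n) ` cball 0 1) \<subseteq> (\<Union>x\<in>k. ball x (e/4))"
      using e unfolding compact_eq_totally_bounded by (metis zero_less_divide_iff zero_less_numeral)
    \<comment> \<open>Closed balls are used so that the cover extends to the closure; those of
      radius \<open>e/2\<close> lie inside the open balls of radius \<open>e\<close>.\<close>
    have "blinfun_apply T ` cball 0 1 \<subseteq> (\<Union>c\<in>k. cball c (e/2))"
    proof safe
      fix x :: ell2 assume x: "x \<in> cball 0 1"
      then have "X n x \<in> closure (blinfun_apply (X n) ` cball 0 1)"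
        by (intro closure_subset [THEN subsetD] imageI)
      then have "X n x \<in> (\<Union>x\<in>k. ball x (e/4))" using k(2) by (rule subsetD [rotated])
      then obtain c where c: "c \<in> k" "dist c (X n x) < e/4" by auto
      have "norm ((X n - T) x) \<le> e/4 * norm x" using n by (intro norm_blinfun_le) simp
      also have "\<dots> \<le> e/4" using x e by (simp add: mult_left_le)
      finally have "dist (X n x) (T x) \<le> e/4" by (simp add: dist_norm blinfun.diff_left)
      then have "dist c (T x) \<le> e/2" using c(2) dist_triangle [of c "T x" "X n x"] by simp
      then show "T x \<in> (\<Union>c\<in>k. cball c (e/2))" using c(1) by auto
    qed
    then have "?K \<subseteq> (\<Union>c\<in>k. cball c (e/2))" using k(1) by (intro closure_minimal closed_UN) auto
    also have "\<dots> \<subseteq> (\<Union>c\<in>k. ball c e)" using e by (intro UN_mono order_refl) auto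
    finally show "\<exists>k. finite k \<and> ?K \<subseteq> (\<Union>x\<in>k. ball x e)" using k(1) by blast
  qed
  moreover have "clinear_op T" by (rule clinear_op_lim [OF _ assms(2)]) (rule S_inf_clinear [OF assms(1)])
  ultimately show ?thesis by (simp add: S_inf_def)
qed

text \<open>Turns compactness into a statement about limits, from which closure under differences
  and complex multiples is immediate.\<close>

lemma S_inf_iff: "T \<in> S_inf \<longleftrightarrow> clinear_op T \<and> (\<lambda>N. proj_op N o\<^sub>L T) \<longlonglongrightarrow> T"
  using S_inf_approx S_inf_clinear S_inf_lim S_inf_proj by meson

lemma S_inf_intros [intro, simp]:
  "0 \<in> S_inf"
  "S \<in> S_inf \<Longrightarrow> T \<in> S_inf \<Longrightarrow> S - T \<in> S_inf"
  "T \<in> S_inf \<Longrightarrow> cscale_op c T \<in> S_inf"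
proof -
  show "0 \<in> S_inf" by (simp add: S_inf_iff compose.zero_right)
  show "S - T \<in> S_inf" if "S \<in> S_inf" "T \<in> S_inf"
    using that tendsto_diff by (fastforce simp: S_inf_iff compose.diff_right)
  show "cscale_op c T \<in> S_inf" if "T \<in> S_inf"
  proof -
    have "proj_op N o\<^sub>L cscale_op c T = cscale_op c (proj_op N o\<^sub>L T)" for N
      by (intro blinfun_eqI ell2_eqI) (simp add: coord_ket_proj)
    then show ?thesis
      using that cscale_op.tendsto [OF tendsto_const] by (auto simp: S_inf_iff)
  qed
qed

lemma S_inf_tens [intro, simp]:
  assumes A: "A \<in> S_inf" and B: "B \<in> S_inf"
  shows "A \<otimes>\<^sub>o B \<in> S_inf"
proof (rule S_inf_lim)
  show "(\<lambda>N. (proj_op N o\<^sub>L A) \<otimes>\<^sub>o (proj_op N o\<^sub>L B)) \<longlonglongrightarrow> A \<otimes>\<^sub>o B"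
    by (intro tens_op.tendsto S_inf_approx A B)
  fix N
  note cl = S_inf_clinear [OF A] S_inf_clinear [OF B]
  \<comment> \<open>\<open>M\<close> exceeds the codes of all pairs below \<open>N\<close>, so
    \<open>proj_op M\<close> fixes everything in the range of
    \<open>proj_op N \<otimes>\<^sub>o proj_op N\<close>.\<close>
  obtain M where M: "\<And>i j. i < N \<Longrightarrow> j < N \<Longrightarrow> prod_encode (j, i) < M"
  proof -
    have "finite (prod_encode ` ({..<N} \<times> {..<N}))" by simp
    then obtain M where "\<forall>n\<in>prod_encode ` ({..<N} \<times> {..<N}). n < M" using finite_nat_set_iff_bounded by blast
    then show thesis using that [of M] by auto
  qed
  have ket: "ket_proj N (ket i) = (if i < N then ket i else 0)" for N i
    by (rule ell2_eqI) (auto simp: coord_ket_proj)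
  have "proj_op M o\<^sub>L (proj_op N \<otimes>\<^sub>o proj_op N) = proj_op N \<otimes>\<^sub>o proj_op N"
  proof (rule clinear_op_eqI)
    fix n
    have "vtens (ket_proj N (ket (snd (prod_decode n)))) (ket_proj N (ket (fst (prod_decode n))))
        = (if snd (prod_decode n) < N \<and> fst (prod_decode n) < N then ket n else 0)"
      by (subst (3) ket_eq_vtens) (auto simp: ket coord_vtens intro!: ell2_eqI)
    moreover have "n < M" if "snd (prod_decode n) < N" "fst (prod_decode n) < N"
      using M [OF that] by simp
    ultimately show "(proj_op M o\<^sub>L (proj_op N \<otimes>\<^sub>o proj_op N)) (ket n) = (proj_op N \<otimes>\<^sub>o proj_op N) (ket n)"
      using ket [of M] by (auto simp: tens_op_ket coord_ket_proj intro!: ell2_eqI)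
  qed auto
  then have "(proj_op N o\<^sub>L A) \<otimes>\<^sub>o (proj_op N o\<^sub>L B) = proj_op M o\<^sub>L ((proj_op N o\<^sub>L A) \<otimes>\<^sub>o (proj_op N o\<^sub>L B))"
    using cl by (simp flip: tens_op_compose oper_compose_assoc)
  then show "(proj_op N o\<^sub>L A) \<otimes>\<^sub>o (proj_op N o\<^sub>L B) \<in> S_inf"
    using S_inf_proj [of "(proj_op N o\<^sub>L A) \<otimes>\<^sub>o (proj_op N o\<^sub>L B)" M] cl by simp
qed

section \<open>Integrable functions with values in the trace class\<close>

definition S1_measurable :: "(real \<Rightarrow> oper) \<Rightarrow> bool"
  where "S1_measurable h \<longleftrightarrow> (\<forall>t. h t \<in> S_one) \<and> strongly_measurable_S1 h"

lemma S1_measurableE: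
  assumes "S1_measurable h"
  obtains s where "\<And>n. simple_function lborel (s n)" "\<And>n t. s n t \<in> S_one" "\<And>t. (\<lambda>n. tn (s n t - h t)) \<longlonglongrightarrow> 0"
proof -
  obtain s where s: "\<And>n. simple_function lborel (s n)" "\<And>n t. s n t \<in> S_one"
    "\<And>t. (\<lambda>n. trace_norm (s n t - h t)) \<longlonglongrightarrow> 0"
    using assms unfolding S1_measurable_def strongly_measurable_S1_def by blast
  have "(\<lambda>n. tn (s n t - h t)) \<longlonglongrightarrow> 0" for t
    unfolding tn_def by (rule tendsto_enn2real) (use s(3) in auto)
  with s show thesis using that by blast
qed

lemma S1_measurableI:
  assumes "\<And>t. h t \<in> S_one" "\<And>n. simple_function lborel (s n)" "\<And>n t. s n t \<in> S_one"
    "\<And>t. (\<lambda>n. tn (s n t - h t)) \<longlonglongrightarrow> 0"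
  shows "S1_measurable h"
proof -
  have "(\<lambda>n. trace_norm (s n t - h t)) \<longlonglongrightarrow> 0" for t
    using tendsto_ennrealI [OF assms(4)] by (simp add: trace_norm_tn assms)
  then show ?thesis unfolding S1_measurable_def strongly_measurable_S1_def
    using assms(1-3) by (intro conjI allI exI [of _ s]) auto
qed

text \<open>The simple functions converge to \<open>h\<close> in trace norm, which is all that a map
  Lipschitz in trace norm sees. Its values along \<open>h\<close> are thus pointwise limits of
  measurable functions.\<close>

lemma S1_measurable_lipschitz:
  fixes G :: "oper \<Rightarrow> 'b :: metric_space"
  assumes h: "S1_measurable h"
    and G: "\<And>S T. S \<in> S_one \<Longrightarrow> T \<in> S_one \<Longrightarrow> dist (G S) (G T) \<le> C * tn (S - T)"
  shows "(\<lambda>t. G (h t)) \<in> borel_measurable borel"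
proof -
  obtain s where s: "\<And>n. simple_function lborel (s n)" "\<And>n t. s n t \<in> S_one" "\<And>t. (\<lambda>n. tn (s n t - h t)) \<longlonglongrightarrow> 0"
    using S1_measurableE [OF h] by blast
  have "(\<lambda>t. G (h t)) \<in> borel_measurable lborel"
  proof (rule borel_measurable_LIMSEQ_metric)
    show "(\<lambda>t. G (s n t)) \<in> borel_measurable lborel" for n
      using simple_function_compose1 [OF s(1)] by (rule borel_measurable_simple_function)
    fix t
    show "(\<lambda>n. G (s n t)) \<longlonglongrightarrow> G (h t)"
    proof (rule metric_tendsto_imp_tendsto)
      show "(\<lambda>n. C * tn (s n t - h t)) \<longlonglongrightarrow> 0" using tendsto_mult_left [OF s(3), of C] by simp
      show "eventually (\<lambda>n. dist (G (s n t)) (G (h t)) \<le> dist (C * tn (s n t - h t)) 0) sequentially"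
        using G [OF s(2)] h by (intro always_eventually allI) (auto simp: S1_measurable_def intro: order_trans [OF _ abs_ge_self])
    qed
  qed
  then show ?thesis by simp
qed

lemma tn_lipschitz:
  assumes "S \<in> S_one" "T \<in> S_one" shows "dist (tn S) (tn T) \<le> 1 * tn (S - T)"
  using tn_add [of "S - T" T] tn_add [of "T - S" S] tn_minus_commute [OF assms] assms
  by (simp add: dist_real_def abs_le_iff)

lemma S1_measurable_tn: "S1_measurable h \<Longrightarrow> (\<lambda>t. tn (h t)) \<in> borel_measurable borel"
  by (rule S1_measurable_lipschitz [OF _ tn_lipschitz])

text \<open>For a simple function the trace is a finite sum, over its values \<open>A\<close>, of an
  indicator times \<open>tr (f t o\<^sub>L A)\<close>; trace norm convergence passes measurability
  on to \<open>h\<close>. The map \<open>w\<close> accommodates the reflected argument of a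
  convolution.\<close>

lemma S1_measurable_tr:
  assumes h: "S1_measurable h" and f: "\<And>t. clinear_op (f t)"
    and fA: "\<And>A. A \<in> S_one \<Longrightarrow> (\<lambda>t. tr (f t o\<^sub>L A)) \<in> borel_measurable M"
    and w: "w \<in> M \<rightarrow>\<^sub>M (borel :: real measure)"
  shows "(\<lambda>t. tr (f t o\<^sub>L h (w t))) \<in> borel_measurable M"
proof -
  obtain s where s: "\<And>n. simple_function lborel (s n)" "\<And>n t. s n t \<in> S_one" "\<And>t. (\<lambda>n. tn (s n t - h t)) \<longlonglongrightarrow> 0"
    using S1_measurableE [OF h] by blast
  have hS: "h t \<in> S_one" for t using h by (simp add: S1_measurable_def)
  show ?thesis
  proof (rule borel_measurable_LIMSEQ_metric)
    fix n
    have fin: "finite (range (s n))" and [measurable]: "s n -` {A} \<in> sets borel" for A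
      using simple_functionD [OF s(1) [of n]] by auto
    have [measurable]: "(\<lambda>t. tr (f t o\<^sub>L A)) \<in> borel_measurable M" if "A \<in> range (s n)" for A
      using fA s(2) that by blast
    have "tr (f t o\<^sub>L s n (w t)) = (\<Sum>A\<in>range (s n). indicator (s n -` {A}) (w t) * tr (f t o\<^sub>L A))" for t
    proof -
      have "(\<Sum>A\<in>range (s n). indicator (s n -` {A}) (w t) * tr (f t o\<^sub>L A))
          = (\<Sum>A\<in>range (s n). if A = s n (w t) then tr (f t o\<^sub>L A) else 0)"
        by (rule sum.cong) (auto simp: indicator_def)
      then show ?thesis using fin by simp
    qed
    moreover have "(\<lambda>t. \<Sum>A\<in>range (s n). indicator (s n -` {A}) (w t) * tr (f t o\<^sub>L A)) \<in> borel_measurable M"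
      using w by measurable
    ultimately show "(\<lambda>t. tr (f t o\<^sub>L s n (w t))) \<in> borel_measurable M" by simp
  next
    fix t
    show "(\<lambda>n. tr (f t o\<^sub>L s n (w t))) \<longlonglongrightarrow> tr (f t o\<^sub>L h (w t))"
    proof (rule metric_tendsto_imp_tendsto)
      show "(\<lambda>n. norm (f t) * tn (s n (w t) - h (w t))) \<longlonglongrightarrow> 0"
        using tendsto_mult_left [OF s(3), of "norm (f t)"] by simp
      have "dist (tr (f t o\<^sub>L s n (w t))) (tr (f t o\<^sub>L h (w t))) \<le> norm (f t) * tn (s n (w t) - h (w t))" for n
        using cmod_tr_le [of "s n (w t) - h (w t)" "f t"] s(2) hS f by (simp add: tr_diff_right dist_norm)
      then show "eventually (\<lambda>n. dist (tr (f t o\<^sub>L s n (w t))) (tr (f t o\<^sub>L h (w t)))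
          \<le> dist (norm (f t) * tn (s n (w t) - h (w t))) 0) sequentially"
        by (intro always_eventually allI) simp
    qed
  qed
qed

lemma S1_measurable_add:
  assumes "S1_measurable g" "S1_measurable h"
  shows "S1_measurable (\<lambda>t. g t + h t)"
proof -
  obtain r where r: "\<And>n. simple_function lborel (r n)" "\<And>n t. r n t \<in> S_one" "\<And>t. (\<lambda>n. tn (r n t - g t)) \<longlonglongrightarrow> 0"
    using S1_measurableE [OF assms(1)] by blast
  obtain s where s: "\<And>n. simple_function lborel (s n)" "\<And>n t. s n t \<in> S_one" "\<And>t. (\<lambda>n. tn (s n t - h t)) \<longlonglongrightarrow> 0"
    using S1_measurableE [OF assms(2)] by blast
  have S: "g t \<in> S_one" "h t \<in> S_one" for t using assms by (simp_all add: S1_measurable_def)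
  show ?thesis
  proof (rule S1_measurableI)
    show "simple_function lborel (\<lambda>t. r n t + s n t)" for n
      by (rule simple_function_compose2 [OF r(1) s(1)])
    show "(\<lambda>n. tn ((r n t + s n t) - (g t + h t))) \<longlonglongrightarrow> 0" for t
    proof (rule tendsto_sandwich [OF _ _ tendsto_const])
      show "(\<lambda>n. tn (r n t - g t) + tn (s n t - h t)) \<longlonglongrightarrow> 0" using tendsto_add [OF r(3) s(3)] by simp
      have "tn ((r n t + s n t) - (g t + h t)) \<le> tn (r n t - g t) + tn (s n t - h t)" for n
        using tn_add [of "r n t - g t" "s n t - h t"] S r(2) s(2) by (simp add: algebra_simps)
      then show "eventually (\<lambda>n. tn ((r n t + s n t) - (g t + h t)) \<le> tn (r n t - g t) + tn (s n t - h t)) sequentially"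
        by (intro always_eventually allI)
    qed auto
  qed (use S r(2) s(2) in auto)
qed

lemma tn_cscale_op_le: "T \<in> S_one \<Longrightarrow> tn (cscale_op c T) \<le> cmod c * tn T"
  using trace_norm_cscale_op [of T c] by (simp add: trace_norm_tn S_one_clinear flip: ennreal_mult)

lemma S1_measurable_cscale_op:
  assumes \<phi>: "\<phi> \<in> borel_measurable borel" and A: "A \<in> S_one"
  shows "S1_measurable (\<lambda>t. cscale_op (\<phi> t) A)"
proof -
  obtain F where F: "\<And>i. simple_function borel (F i)" "\<And>x. (\<lambda>i. F i x) \<longlonglongrightarrow> \<phi> x"
    using borel_measurable_implies_sequence_metric [OF \<phi>, of 0] by auto
  show ?thesis
  proof (rule S1_measurableI)
    show "simple_function lborel (\<lambda>t. cscale_op (F n t) A)" for n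
      using simple_function_compose1 [OF F(1)] by (simp add: simple_function_def)
    show "(\<lambda>n. tn (cscale_op (F n t) A - cscale_op (\<phi> t) A)) \<longlonglongrightarrow> 0" for t
    proof (rule tendsto_sandwich [OF _ _ tendsto_const])
      show "(\<lambda>n. cmod (F n t - \<phi> t) * tn A) \<longlonglongrightarrow> 0"
        using F(2) [of t] by (auto intro!: tendsto_eq_intros simp: LIM_zero_iff tendsto_norm_zero_iff)
      show "eventually (\<lambda>n. tn (cscale_op (F n t) A - cscale_op (\<phi> t) A) \<le> cmod (F n t - \<phi> t) * tn A) sequentially"
        using tn_cscale_op_le [OF A] by (simp flip: cscale_op.diff_left)
    qed auto
  qed (use A in auto)
qed

lemma S1_measurable_sum:
  assumes "finite I" "\<And>i. i \<in> I \<Longrightarrow> S1_measurable (h i)"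
  shows "S1_measurable (\<lambda>t. \<Sum>i\<in>I. h i t)"
  using assms
proof (induction I)
  case empty
  show ?case using S1_measurable_cscale_op [of "\<lambda>_. 0" 0] by (simp add: cscale_op.zero_right)
qed (simp add: S1_measurable_add)

lemma S1_measurable_cscale:
  assumes "S1_measurable h" shows "S1_measurable (\<lambda>t. cscale_op c (h t))"
proof -
  obtain s where s: "\<And>n. simple_function lborel (s n)" "\<And>n t. s n t \<in> S_one" "\<And>t. (\<lambda>n. tn (s n t - h t)) \<longlonglongrightarrow> 0"
    using S1_measurableE [OF assms] by blast
  have S: "h t \<in> S_one" for t using assms by (simp add: S1_measurable_def)
  show ?thesis
  proof (rule S1_measurableI)
    show "simple_function lborel (\<lambda>t. cscale_op c (s n t))" for n
      by (rule simple_function_compose1 [OF s(1)])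
    show "(\<lambda>n. tn (cscale_op c (s n t) - cscale_op c (h t))) \<longlonglongrightarrow> 0" for t
    proof (rule tendsto_sandwich [OF _ _ tendsto_const])
      show "(\<lambda>n. cmod c * tn (s n t - h t)) \<longlonglongrightarrow> 0" using tendsto_mult_left [OF s(3), of "cmod c"] by simp
      show "eventually (\<lambda>n. tn (cscale_op c (s n t) - cscale_op c (h t)) \<le> cmod c * tn (s n t - h t)) sequentially"
        using tn_cscale_op_le S s(2) by (simp flip: cscale_op.diff_right)
    qed auto
  qed (use S s(2) in auto)
qed

lemma S1_measurable_diff:
  assumes "S1_measurable g" "S1_measurable h"
  shows "S1_measurable (\<lambda>t. g t - h t)"
  using S1_measurable_add [OF assms(1) S1_measurable_cscale [OF assms(2), of "- 1"]]
  by (simp add: cscale_op_minus_one)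

section \<open>Integrability in trace norm\<close>

lemma L1_S1_iff: "h \<in> L1_S1 \<longleftrightarrow> S1_measurable h \<and> integrable lborel (\<lambda>t. tn (h t))"
proof -
  have "(\<integral>\<^sup>+t. trace_norm (h t) \<partial>lborel) < \<infinity> \<longleftrightarrow> integrable lborel (\<lambda>t. tn (h t))" if h: "S1_measurable h"
  proof -
    have "trace_norm (h t) = ennreal (tn (h t))" for t
      using h by (simp add: S1_measurable_def trace_norm_tn)
    then show ?thesis using S1_measurable_tn [OF h] by (simp add: integrable_iff_bounded)
  qed
  then show ?thesis by (auto simp: L1_S1_def S1_measurable_def)
qed

lemma L1_norm_eq:
  assumes "h \<in> L1_S1" shows "L1_norm h = (LINT t|lborel. tn (h t))"
proof -
  have "trace_norm (h t) = ennreal (tn (h t))" for t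
    using assms by (simp add: L1_S1_iff S1_measurable_def trace_norm_tn)
  then show ?thesis using assms unfolding L1_norm_def L1_S1_iff
    by (simp add: nn_integral_eq_integral)
qed

lemma L1_norm_nonneg [simp]: "0 \<le> L1_norm h" by (simp add: L1_norm_def)

lemma L1_S1_diff:
  assumes "g \<in> L1_S1" "h \<in> L1_S1"
  shows "(\<lambda>t. g t - h t) \<in> L1_S1" "L1_norm (\<lambda>t. g t - h t) \<le> L1_norm g + L1_norm h"
proof -
  have m: "S1_measurable (\<lambda>t. g t - h t)" using assms S1_measurable_diff L1_S1_iff by blast
  have le: "tn (g t - h t) \<le> tn (g t) + tn (h t)" for t
    using assms by (auto simp: L1_S1_iff S1_measurable_def intro!: tn_diff)
  have int: "integrable lborel (\<lambda>t. tn (g t) + tn (h t))" using assms by (simp add: L1_S1_iff)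
  show *: "(\<lambda>t. g t - h t) \<in> L1_S1"
    unfolding L1_S1_iff using m le S1_measurable_tn [OF m]
    by (intro conjI Bochner_Integration.integrable_bound [OF int]) auto
  have "L1_norm (\<lambda>t. g t - h t) \<le> (LINT t|lborel. tn (g t) + tn (h t))"
    unfolding L1_norm_eq [OF *] using * le int by (intro integral_mono) (auto simp: L1_S1_iff)
  then show "L1_norm (\<lambda>t. g t - h t) \<le> L1_norm g + L1_norm h"
    using assms by (simp add: L1_norm_eq L1_S1_iff)
qed

lemma integrable_reflect:
  fixes \<phi> :: "real \<Rightarrow> 'a :: {banach, second_countable_topology}"
  assumes "integrable lborel \<phi>"
  shows "integrable lborel (\<lambda>t. \<phi> (s - t))" "(LINT t|lborel. \<phi> (s - t)) = (LINT t|lborel. \<phi> t)"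
  using lborel_integrable_real_affine [OF assms, of "- 1" s] lborel_integral_real_affine [of "- 1" \<phi> s] by simp_all

lemma H1_S1_L1: "h \<in> H1_S1 \<Longrightarrow> h \<in> L1_S1"
  by (simp add: H1_S1_def)

section \<open>Functions in \<open>C0_Sinf\<close> and bounds for convolutions\<close>

lemma C0_Sinf_bounded:
  assumes "f \<in> C0_Sinf" shows "bdd_above (range (\<lambda>t. norm (f t)))"
proof -
  have cont: "continuous_on UNIV f" and lim: "(f \<longlongrightarrow> 0) at_infinity" using assms by (auto simp: C0_Sinf_def)
  obtain B where B: "\<And>t. norm t \<ge> B \<Longrightarrow> norm (f t) < 1"
    using tendstoD [OF lim, of 1] by (auto simp: eventually_at_infinity)
  have "compact ((\<lambda>t. norm (f t)) ` cball 0 B)"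
    by (intro compact_continuous_image continuous_on_norm continuous_on_subset [OF cont]) auto
  then have "bdd_above ((\<lambda>t. norm (f t)) ` cball 0 B)" by (intro bounded_imp_bdd_above compact_imp_bounded)
  then obtain C where C: "\<And>y. y \<in> (\<lambda>t. norm (f t)) ` cball 0 B \<Longrightarrow> y \<le> C"
    unfolding bdd_above_def by blast
  have "norm (f t) \<le> max 1 C" for t
    using B [of t] C [of "norm (f t)"] by (cases "norm t \<ge> B") auto
  then show ?thesis by (auto simp: bdd_above_def)
qed

lemma norm_le_sup_norm: "f \<in> C0_Sinf \<Longrightarrow> norm (f t) \<le> sup_norm f"
  unfolding sup_norm_def by (rule cSUP_upper [OF UNIV_I C0_Sinf_bounded])

lemma sup_norm_nonneg: "f \<in> C0_Sinf \<Longrightarrow> 0 \<le> sup_norm f"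
  using norm_le_sup_norm order_trans norm_ge_zero by blast

lemma sup_norm_leI: "(\<And>t. norm (f t) \<le> c) \<Longrightarrow> sup_norm f \<le> c"
  unfolding sup_norm_def by (rule cSUP_least) auto

lemma C0_Sinf_clinear: "f \<in> C0_Sinf \<Longrightarrow> clinear_op (f t)"
  by (simp add: C0_Sinf_def S_inf_clinear)

lemma C0_Sinf_tr_continuous:
  assumes f: "f \<in> C0_Sinf" and A: "A \<in> S_one"
  shows "continuous_on UNIV (\<lambda>t. tr (f t o\<^sub>L A))"
  unfolding continuous_on_def
proof
  fix t
  have "((\<lambda>x. norm (f x - f t) * tn A) \<longlongrightarrow> 0) (at t)"
    using f by (auto simp: C0_Sinf_def continuous_on_def LIM_zero_iff tendsto_norm_zero_iff intro!: tendsto_eq_intros)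
  then show "((\<lambda>t. tr (f t o\<^sub>L A)) \<longlongrightarrow> tr (f t o\<^sub>L A)) (at t)"
  proof (rule metric_tendsto_imp_tendsto)
    have "dist (tr (f x o\<^sub>L A)) (tr (f t o\<^sub>L A)) \<le> norm (f x - f t) * tn A" for x
      using cmod_tr_le [OF A, of "f x - f t"] C0_Sinf_clinear [OF f] A by (simp add: dist_norm tr_diff_left)
    then show "eventually (\<lambda>x. dist (tr (f x o\<^sub>L A)) (tr (f t o\<^sub>L A)) \<le> dist (norm (f x - f t) * tn A) 0) (at t)"
      by (intro always_eventually allI) simp
  qed
qed

lemma C0_Sinf_tr_measurable:
  assumes "f \<in> C0_Sinf" "A \<in> S_one"
  shows "(\<lambda>t. tr (f t o\<^sub>L A)) \<in> borel_measurable borel"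
  by (rule borel_measurable_continuous_onI [OF C0_Sinf_tr_continuous [OF assms]])

lemma conv_integrand:
  assumes f: "f \<in> C0_Sinf" and h: "h \<in> L1_S1"
  shows "integrable lborel (\<lambda>t. tr (f t o\<^sub>L h (s - t)))"
    and "cmod (tr (f t o\<^sub>L h u)) \<le> sup_norm f * tn (h u)"
proof -
  have hS: "h t \<in> S_one" for t using h by (simp add: L1_S1_iff S1_measurable_def)
  have hm: "S1_measurable h" and hi: "integrable lborel (\<lambda>t. tn (h t))"
    using h by (auto simp: L1_S1_iff S1_measurable_def)
  show le: "cmod (tr (f t o\<^sub>L h u)) \<le> sup_norm f * tn (h u)" for t u
    by (intro order_trans [OF cmod_tr_le] hS C0_Sinf_clinear f mult_right_mono norm_le_sup_norm) simp
  have "(\<lambda>t. tr (f t o\<^sub>L h (s - t))) \<in> borel_measurable borel"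
    using hm C0_Sinf_clinear [OF f] C0_Sinf_tr_measurable [OF f] by (rule S1_measurable_tr) auto
  then show "integrable lborel (\<lambda>t. tr (f t o\<^sub>L h (s - t)))"
    using le integrable_reflect(1) [OF integrable_mult_right [OF hi]]
    by (intro Bochner_Integration.integrable_bound [OF integrable_reflect(1) [OF integrable_mult_right [OF hi, of "sup_norm f"]], of _ s])
      (auto intro: order_trans [OF _ abs_ge_self])
qed

lemma conv_integrand_norm:
  assumes f: "f \<in> C0_Sinf" and h: "h \<in> L1_S1"
  shows "(LINT t|lborel. cmod (tr (f t o\<^sub>L h (s - t)))) \<le> sup_norm f * L1_norm h"
proof -
  have hi: "integrable lborel (\<lambda>t. sup_norm f * tn (h t))" using h by (simp add: L1_S1_iff)
  have "(LINT t|lborel. cmod (tr (f t o\<^sub>L h (s - t)))) \<le> (LINT t|lborel. sup_norm f * tn (h (s - t)))"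
    using integrable_reflect(1) [OF hi]
    by (intro integral_mono conv_integrand assms integrable_norm) auto
  also have "\<dots> = sup_norm f * L1_norm h"
    using integrable_reflect(2) [OF hi] h by (simp add: L1_norm_eq)
  finally show ?thesis .
qed

lemma cmod_conv_le:
  assumes "f \<in> C0_Sinf" "h \<in> L1_S1"
  shows "cmod (conv f h s) \<le> sup_norm f * L1_norm h"
  unfolding conv_def by (rule order_trans [OF integral_norm_bound conv_integrand_norm [OF assms]])

lemma conv_diff_right:
  assumes f: "f \<in> C0_Sinf" and h: "g \<in> L1_S1" "h \<in> L1_S1"
  shows "conv f (\<lambda>t. g t - h t) s = conv f g s - conv f h s"
proof -
  have "tr (f t o\<^sub>L (g (s - t) - h (s - t))) = tr (f t o\<^sub>L g (s - t)) - tr (f t o\<^sub>L h (s - t))" for t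
    using h C0_Sinf_clinear [OF f] by (intro tr_diff_right) (auto simp: L1_S1_iff S1_measurable_def)
  then show ?thesis
    unfolding conv_def using conv_integrand(1) [OF f] h by simp
qed

lemma C0_Sinf_cscale:
  assumes "f \<in> C0_Sinf"
  shows "(\<lambda>t. cscale_op c (f t)) \<in> C0_Sinf" "sup_norm (\<lambda>t. cscale_op c (f t)) \<le> cmod c * sup_norm f"
proof -
  show "(\<lambda>t. cscale_op c (f t)) \<in> C0_Sinf"
    using assms cscale_op.tendsto [OF tendsto_const, of f 0 at_infinity c]
    by (auto simp: C0_Sinf_def cscale_op.zero_right intro!: cscale_op.continuous_on continuous_on_const)
  show "sup_norm (\<lambda>t. cscale_op c (f t)) \<le> cmod c * sup_norm f"
    by (intro sup_norm_leI order_trans [OF norm_cscale_op_le] mult_left_mono norm_le_sup_norm assms) simp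
qed

lemma conv_cscale_left:
  assumes f: "f \<in> C0_Sinf" and h: "h \<in> L1_S1"
  shows "conv (\<lambda>t. cscale_op c (f t)) h s = c * conv f h s"
proof -
  have "tr (cscale_op c (f t) o\<^sub>L h (s - t)) = c * tr (f t o\<^sub>L h (s - t))" for t
    using h C0_Sinf_clinear [OF f] by (intro tr_cscale_left) (auto simp: L1_S1_iff S1_measurable_def)
  then show ?thesis unfolding conv_def by simp
qed

lemma C0_Sinf_0: "(\<lambda>_. 0) \<in> C0_Sinf"
  by (simp add: C0_Sinf_def)

lemma sup_norm_0: "sup_norm (\<lambda>_. 0) = 0"
  using sup_norm_leI [of "\<lambda>_. 0" 0] sup_norm_nonneg [OF C0_Sinf_0] by simp

lemma C0_Sinf_diff:
  assumes "f \<in> C0_Sinf" "g \<in> C0_Sinf" shows "(\<lambda>t. f t - g t) \<in> C0_Sinf"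
  using assms tendsto_diff [of f 0 at_infinity g 0]
  by (auto simp: C0_Sinf_def intro!: continuous_on_diff)

lemma C0_Sinf_shift:
  assumes "f \<in> C0_Sinf" shows "(\<lambda>t. f (t + r)) \<in> C0_Sinf"
proof -
  have cont: "continuous_on UNIV f" and lim: "(f \<longlongrightarrow> 0) at_infinity" using assms by (auto simp: C0_Sinf_def)
  have "filterlim (\<lambda>t. t + r) at_infinity at_infinity"
    by (rule tendsto_add_filterlim_at_infinity') (auto intro: filterlim_ident)
  from filterlim_compose [OF lim this] have "((\<lambda>t. f (t + r)) \<longlongrightarrow> 0) at_infinity" .
  moreover have "continuous_on UNIV (\<lambda>t. f (t + r))"
    by (rule continuous_on_compose2 [OF cont]) (auto intro!: continuous_intros)
  ultimately show ?thesis using assms by (simp add: C0_Sinf_def)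
qed

lemma C0_Sinf_tens:
  assumes f: "f \<in> C0_Sinf" and g: "g \<in> C0_Sinf"
  shows "(\<lambda>t. f t \<otimes>\<^sub>o g t) \<in> C0_Sinf" "sup_norm (\<lambda>t. f t \<otimes>\<^sub>o g t) \<le> sup_norm f * sup_norm g"
proof -
  show "(\<lambda>t. f t \<otimes>\<^sub>o g t) \<in> C0_Sinf"
    using assms tens_op.tendsto [of f 0 at_infinity g 0]
    by (auto simp: C0_Sinf_def tens_op.zero_left intro!: tens_op.continuous_on)
  show "sup_norm (\<lambda>t. f t \<otimes>\<^sub>o g t) \<le> sup_norm f * sup_norm g"
    by (intro sup_norm_leI order_trans [OF norm_tens_op_le] mult_mono norm_le_sup_norm sup_norm_nonneg f g) simp
qed

lemma C0_Sinf_uniformly_continuous: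
  assumes f: "f \<in> C0_Sinf" and e: "e > 0"
  obtains d where "d > 0" "\<And>x y. \<bar>x - y\<bar> < d \<Longrightarrow> norm (f x - f y) < e"
proof -
  have cont: "continuous_on UNIV f" and lim: "(f \<longlongrightarrow> 0) at_infinity" using f by (auto simp: C0_Sinf_def)
  obtain B where B: "\<And>t. \<bar>t\<bar> \<ge> B \<Longrightarrow> norm (f t) < e/2"
    using tendstoD [OF lim, of "e/2"] e by (auto simp: eventually_at_infinity)
  \<comment> \<open>The margin of 1 matches \<open>min d 1\<close> below: if one of the two points
    lies within \<open>B\<close> of the origin, both lie in this interval.\<close>
  have "uniformly_continuous_on {-B-1..B+1} f"
    by (intro compact_uniformly_continuous continuous_on_subset [OF cont]) auto
  then obtain d where d: "d > 0"
    "\<And>x y. x \<in> {-B-1..B+1} \<Longrightarrow> y \<in> {-B-1..B+1} \<Longrightarrow> \<bar>x - y\<bar> < d \<Longrightarrow> norm (f x - f y) < e"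
    using e unfolding uniformly_continuous_on_def dist_norm by (metis real_norm_def norm_minus_commute)
  have "norm (f x - f y) < e" if "\<bar>x - y\<bar> < min d 1" for x y
  proof (cases "\<bar>x\<bar> \<ge> B \<and> \<bar>y\<bar> \<ge> B")
    case True
    then show ?thesis using B [of x] B [of y] norm_triangle_ineq4 [of "f x" "f y"] by linarith
  next
    case False
    then have "x \<in> {-B-1..B+1}" "y \<in> {-B-1..B+1}" using that by auto
    then show ?thesis using d(2) that by simp
  qed
  then show thesis using that [of "min d 1"] d(1) by simp
qed

section \<open>Sums and limits in \<open>A0\<close>\<close>

lemma H1_scale: "\<phi> \<in> H1 \<Longrightarrow> (\<lambda>t. c * \<phi> t) \<in> H1"
  by (simp add: H1_def fourier_def mult.assoc)

lemma H1_minus: "\<phi> \<in> H1 \<Longrightarrow> (\<lambda>t. - \<phi> t) \<in> H1"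
  using H1_scale [of \<phi> "- 1"] by simp

lemma H1_tensor_S1_iff:
  "g \<in> H1_tensor_S1 \<longleftrightarrow> (\<exists>(n::nat) \<phi> A. (\<forall>i<n. \<phi> i \<in> H1 \<and> A i \<in> S_one) \<and> g = (\<lambda>t. \<Sum>i<n. cscale_op (\<phi> i t) (A i)))"
proof -
  have "(\<forall>t x. blinfun_apply (g t) x = (\<Sum>i<n. \<phi> i t *\<^sub>C blinfun_apply (A i) x))
      \<longleftrightarrow> g = (\<lambda>t. \<Sum>i<n. cscale_op (\<phi> i t) (A i))" for n :: nat and \<phi> A
    by (auto simp: fun_eq_iff blinfun.sum_left intro!: blinfun_eqI)
  then show ?thesis by (simp add: H1_tensor_S1_def)
qed

text \<open>Arbitrary finite index sets serve the disjoint unions in differences of tensors and the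
  product index sets in tensor products of them.\<close>

lemma H1_tensor_S1_sum:
  assumes "finite I" and \<phi>: "\<And>i. i \<in> I \<Longrightarrow> \<phi> i \<in> H1" "\<And>i. i \<in> I \<Longrightarrow> A i \<in> S_one"
  shows "(\<lambda>t. \<Sum>i\<in>I. cscale_op (\<phi> i t) (A i)) \<in> H1_tensor_S1"
proof -
  obtain e where e: "bij_betw e {0..<card I} I" using ex_bij_betw_nat_finite [OF assms(1)] by blast
  then have "e i \<in> I" if "i < card I" for i using that by (auto simp: bij_betw_def)
  moreover have "(\<Sum>i\<in>I. cscale_op (\<phi> i t) (A i)) = (\<Sum>i<card I. cscale_op (\<phi> (e i) t) (A (e i)))" for t
    using sum.reindex_bij_betw [OF e, of "\<lambda>i. cscale_op (\<phi> i t) (A i)"] by (simp add: atLeast0LessThan)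
  ultimately show ?thesis unfolding H1_tensor_S1_iff using \<phi>
    by (intro exI [of _ "card I"] exI [of _ "\<lambda>i. \<phi> (e i)"] exI [of _ "\<lambda>i. A (e i)"]) (simp add: fun_eq_iff)
qed

lemma H1_tensor_S1_diff:
  assumes "g \<in> H1_tensor_S1" "h \<in> H1_tensor_S1"
  shows "(\<lambda>t. g t - h t) \<in> H1_tensor_S1"
proof -
  obtain n \<phi> A where g: "\<And>i. i < n \<Longrightarrow> \<phi> i \<in> H1" "\<And>i. i < n \<Longrightarrow> A i \<in> S_one" "g = (\<lambda>t. \<Sum>i<n::nat. cscale_op (\<phi> i t) (A i))"
    using assms(1) unfolding H1_tensor_S1_iff by blast
  obtain m \<psi> B where h: "\<And>i. i < m \<Longrightarrow> \<psi> i \<in> H1" "\<And>i. i < m \<Longrightarrow> B i \<in> S_one" "h = (\<lambda>t. \<Sum>i<m::nat. cscale_op (\<psi> i t) (B i))"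
    using assms(2) unfolding H1_tensor_S1_iff by blast
  let ?\<phi> = "case_sum \<phi> (\<lambda>i t. - \<psi> i t)" and ?A = "case_sum A B"
  have "(\<lambda>t. \<Sum>i\<in>{..<n} <+> {..<m}. cscale_op (?\<phi> i t) (?A i)) \<in> H1_tensor_S1"
    by (rule H1_tensor_S1_sum) (use g(1,2) h(1,2) H1_minus in auto)
  moreover have "(\<Sum>i\<in>{..<n} <+> {..<m}. cscale_op (?\<phi> i t) (?A i)) = g t - h t" for t
    by (simp add: sum.Plus g(3) h(3) cscale_op.minus_left sum_negf)
  ultimately show ?thesis by simp
qed

lemma tn_sum_le:
  assumes "finite I" "\<And>i. i \<in> I \<Longrightarrow> A i \<in> S_one"
  shows "tn (\<Sum>i\<in>I. A i) \<le> (\<Sum>i\<in>I. tn (A i))"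
  using assms
proof (induction I)
  case (insert i I)
  have "A i \<in> S_one" "(\<Sum>i\<in>I. A i) \<in> S_one" using insert.prems by (simp, intro S_one_sum) simp
  then show ?case using tn_add [of "A i" "\<Sum>i\<in>I. A i"] insert by simp
qed (simp add: tn_def)

lemma H1_tensor_S1_L1:
  assumes "g \<in> H1_tensor_S1" shows "g \<in> L1_S1"
proof -
  obtain n \<phi> A where \<phi>: "\<And>i. i < n \<Longrightarrow> \<phi> i \<in> H1" and A: "\<And>i. i < n \<Longrightarrow> A i \<in> S_one"
    and g: "g = (\<lambda>t. \<Sum>i<n::nat. cscale_op (\<phi> i t) (A i))"
    using assms unfolding H1_tensor_S1_iff by blast
  have int: "integrable lborel (\<phi> i)" if "i < n" for i using \<phi> [OF that] by (simp add: H1_def)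
  have m: "S1_measurable g"
    unfolding g using int A
    by (intro S1_measurable_sum S1_measurable_cscale_op) (auto dest!: borel_measurable_integrable)
  have le: "tn (g t) \<le> (\<Sum>i<n. cmod (\<phi> i t) * tn (A i))" for t
    unfolding g using A by (intro order_trans [OF tn_sum_le] sum_mono tn_cscale_op_le) auto
  have "integrable lborel (\<lambda>t. \<Sum>i<n. cmod (\<phi> i t) * tn (A i))"
    using int by (intro Bochner_Integration.integrable_sum integrable_mult_left integrable_norm) auto
  then have "integrable lborel (\<lambda>t. tn (g t))"
  proof (rule Bochner_Integration.integrable_bound)
    show "AE t in lborel. norm (tn (g t)) \<le> norm (\<Sum>i<n. cmod (\<phi> i t) * tn (A i))"
      using le by (intro AE_I2) (simp add: order_trans [OF _ abs_ge_self])
  qed (use S1_measurable_tn [OF m] in simp)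
  then show ?thesis using m by (simp add: L1_S1_iff)
qed

lemma H1_tensor_S1_H1_S1: "g \<in> H1_tensor_S1 \<Longrightarrow> g \<in> H1_S1"
  by (auto simp: H1_S1_def H1_tensor_S1_L1 intro!: bexI [of _ g])

lemma zero_H1_S1: "(\<lambda>_. 0) \<in> H1_S1"
  using H1_tensor_S1_sum [of "{}"] by (intro H1_tensor_S1_H1_S1) simp

lemma H1_S1_approx:
  assumes h: "h \<in> H1_S1" and e: "e > 0"
  obtains g where "g \<in> H1_tensor_S1" "L1_norm (\<lambda>t. h t - g t) < e"
proof -
  obtain g where g: "g \<in> H1_tensor_S1" "(\<integral>\<^sup>+t. trace_norm (h t - g t) \<partial>lborel) < ennreal e"
    using h e unfolding H1_S1_def by blast
  have "L1_norm (\<lambda>t. h t - g t) < e"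
    using g(2) e unfolding L1_norm_def
    by (cases "\<integral>\<^sup>+t. trace_norm (h t - g t) \<partial>lborel") (auto simp: ennreal_less_iff)
  with g(1) show thesis by (rule that)
qed

text \<open>\<open>A0_norm\<close> is an infimum of reals and says something about \<open>F\<close>
  only if a representation exists. Bundling membership with the bound lets estimates pass through
  sums and limits without a separate membership proof.\<close>

definition A0_le :: "(real \<Rightarrow> complex) \<Rightarrow> real \<Rightarrow> bool"
  where "A0_le F c \<longleftrightarrow> F \<in> A0 \<and> A0_norm F \<le> c"

lemma A0_rep_terms:
  assumes "A0_rep F f h"
  shows "0 \<le> sup_norm (f k) * L1_norm (h k)" "cmod (conv (f k) (h k) s) \<le> sup_norm (f k) * L1_norm (h k)"
  using assms by (auto simp: A0_rep_def sup_norm_nonneg H1_S1_L1 intro!: cmod_conv_le)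

lemma A0_leI:
  assumes "A0_rep F f h" "(\<Sum>k. sup_norm (f k) * L1_norm (h k)) \<le> c"
  shows "A0_le F c"
proof -
  have "A0_norm F \<le> (\<Sum>k. sup_norm (f k) * L1_norm (h k))"
    unfolding A0_norm_def
  proof (rule cInf_lower)
    show "bdd_below {(\<Sum>k. sup_norm (f k) * L1_norm (h k)) | f h. A0_rep F f h}"
      by (rule bdd_belowI [of _ 0]) (auto intro!: suminf_nonneg A0_rep_terms simp: A0_rep_def)
  qed (use assms(1) in blast)
  then show ?thesis using assms by (auto simp: A0_le_def A0_def)
qed

lemma A0_leE:
  assumes "A0_le F c" "c < d"
  obtains f h where "A0_rep F f h" "(\<Sum>k. sup_norm (f k) * L1_norm (h k)) < d"
proof -
  have "\<exists>x\<in>{(\<Sum>k. sup_norm (f k) * L1_norm (h k)) | f h. A0_rep F f h}. x < d"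
    using assms by (intro cInf_lessD) (auto simp: A0_le_def A0_def A0_norm_def)
  then show thesis using that by blast
qed

lemma A0_le_epsilon:
  assumes "\<And>e. e > 0 \<Longrightarrow> A0_le F (c + e)" shows "A0_le F c"
  using assms zero_less_one unfolding A0_le_def by (blast intro: field_le_epsilon)

lemma A0_le_mono: "A0_le F c \<Longrightarrow> c \<le> d \<Longrightarrow> A0_le F d"
  by (auto simp: A0_le_def)

lemma A0_le_norm: "F \<in> A0 \<Longrightarrow> A0_le F (A0_norm F)"
  by (simp add: A0_le_def)

text \<open>The norm dominates the supremum norm. Hence only 0 has norm 0, and Cauchy sequences in
  \<open>A0\<close> converge pointwise.\<close>

lemma A0_le_bound:
  assumes "A0_le F c" shows "cmod (F s) \<le> c"
proof (rule field_le_epsilon)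
  fix e :: real assume "e > 0"
  then obtain f h where rep: "A0_rep F f h" "(\<Sum>k. sup_norm (f k) * L1_norm (h k)) < c + e"
    using A0_leE [OF assms, of "c + e"] by auto
  then have sums: "summable (\<lambda>k. sup_norm (f k) * L1_norm (h k))" "(\<lambda>k. conv (f k) (h k) s) sums F s"
    by (auto simp: A0_rep_def)
  have "cmod (\<Sum>k. conv (f k) (h k) s) \<le> (\<Sum>k. sup_norm (f k) * L1_norm (h k))"
    by (rule norm_suminf_le [OF A0_rep_terms(2) [OF rep(1)] sums(1)])
  then show "cmod (F s) \<le> c + e" using rep(2) sums(2) by (simp add: sums_iff)
qed

text \<open>For bounds such as \<open>(c + e) * (d + e)\<close>, where the slack enters
  multiplicatively and \<open>A0_le_epsilon\<close> does not fit.\<close>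

lemma A0_le_tendsto:
  assumes "\<And>n::nat. A0_le F (u n)" "u \<longlonglongrightarrow> c" shows "A0_le F c"
  using assms(1) LIMSEQ_le_const [OF assms(2), of "A0_norm F"] by (auto simp: A0_le_def)

lemma A0_le_nonneg: "A0_le F c \<Longrightarrow> 0 \<le> c"
  using A0_le_bound norm_ge_zero order_trans by blast

text \<open>The doubly indexed terms are enumerated by \<open>prod_decode\<close>. Summable costs
  dominate the values of the convolutions, which legitimates the rearrangement at every point
  \<open>s\<close>.\<close>

lemma A0_rep_suminf:
  assumes rep: "\<And>j. A0_rep (F j) (f j) (h j)"
    and c: "\<And>j. (\<Sum>k. sup_norm (f j k) * L1_norm (h j k)) \<le> c j" "summable c"
    and F: "\<And>s. (\<lambda>j. F j s) sums G s"
  shows "A0_le G (suminf c)"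
proof -
  let ?a = "\<lambda>j k. sup_norm (f j k) * L1_norm (h j k)"
  have a: "0 \<le> ?a j k" "cmod (conv (f j k) (h j k) s) \<le> ?a j k" for j k s
    using A0_rep_terms [OF rep] by auto
  have sa: "summable (\<lambda>k. ?a j k)" for j using rep by (simp add: A0_rep_def)
  have na: "0 \<le> (\<Sum>k. ?a j k)" for j by (rule suminf_nonneg [OF sa a(1)])
  have sas: "summable (\<lambda>j. \<Sum>k. ?a j k)"
    by (rule summable_comparison_test' [OF c(2)]) (use na c(1) in auto)
  have norm_a: "norm (?a j k) = ?a j k" for j k using a(1) [of j k] by simp
  note A = sums_prod_decode [of ?a, unfolded norm_a, OF sa sas]
  let ?f = "\<lambda>n. case prod_decode n of (j, k) \<Rightarrow> f j k" and ?h = "\<lambda>n. case prod_decode n of (j, k) \<Rightarrow> h j k"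
  have eqa: "sup_norm (?f n) * L1_norm (?h n) = (case prod_decode n of (j, k) \<Rightarrow> ?a j k)" for n
    by (simp add: case_prod_unfold)
  have eqc: "conv (?f n) (?h n) s = (case prod_decode n of (j, k) \<Rightarrow> conv (f j k) (h j k) s)" for n s
    by (simp add: case_prod_unfold)
  have "A0_rep G ?f ?h"
    unfolding A0_rep_def
  proof (intro conjI allI)
    show "?f n \<in> C0_Sinf" "?h n \<in> H1_S1" for n
      using rep by (auto simp: A0_rep_def split: prod.split)
    show "summable (\<lambda>n. sup_norm (?f n) * L1_norm (?h n))"
      unfolding eqa using A(2) by (rule sums_summable)
    fix s
    have 1: "summable (\<lambda>k. cmod (conv (f j k) (h j k) s))" for j
      by (rule summable_comparison_test' [OF sa]) (use a(2) in simp)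
    have 2: "summable (\<lambda>j. \<Sum>k. cmod (conv (f j k) (h j k) s))"
    proof (rule summable_comparison_test' [OF sas])
      show "norm (\<Sum>k. cmod (conv (f j k) (h j k) s)) \<le> (\<Sum>k. ?a j k)" for j
        using suminf_le [OF a(2) 1 sa] suminf_nonneg [OF 1] by simp
    qed
    have "(\<lambda>n. conv (?f n) (?h n) s) sums (\<Sum>j. \<Sum>k. conv (f j k) (h j k) s)"
      unfolding eqc using sums_prod_decode(2) [of "\<lambda>j k. conv (f j k) (h j k) s", OF 1 2] .
    moreover have "(\<Sum>k. conv (f j k) (h j k) s) = F j s" for j
      using rep by (auto simp: A0_rep_def sums_iff)
    ultimately show "(\<lambda>n. conv (?f n) (?h n) s) sums G s" using F [of s] by (simp add: sums_iff)
  qed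
  moreover have "(\<Sum>n. sup_norm (?f n) * L1_norm (?h n)) \<le> suminf c"
    unfolding eqa sums_unique [OF A(2), symmetric] by (rule suminf_le [OF c(1) sas c(2)])
  ultimately show ?thesis by (rule A0_leI)
qed

lemma A0_le_suminf:
  assumes F: "\<And>j. A0_le (F j) (c j)" and c: "summable c" and G: "\<And>s. (\<lambda>j. F j s) sums G s"
  shows "A0_le G (suminf c)"
proof (rule A0_le_epsilon)
  fix e :: real assume e: "e > 0"
  \<comment> \<open>The infimum need not be attained; the allowances
    \<open>e * (1/2) ^ Suc j\<close> add up to \<open>e\<close>.\<close>
  have "\<exists>f h. A0_rep (F j) f h \<and> (\<Sum>k. sup_norm (f k) * L1_norm (h k)) \<le> c j + e * (1/2) ^ Suc j" for j
  proof -
    have "c j < c j + e * (1/2) ^ Suc j" using e by simp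
    from A0_leE [OF F this] show ?thesis by (metis less_imp_le)
  qed
  then obtain f h where fh: "\<And>j. A0_rep (F j) (f j) (h j)"
    "\<And>j. (\<Sum>k. sup_norm (f j k) * L1_norm (h j k)) \<le> c j + e * (1/2) ^ Suc j" by metis
  have sums: "(\<lambda>j. c j + e * (1/2) ^ Suc j) sums (suminf c + e * 1)"
    by (intro sums_add summable_sums c sums_mult power_half_series)
  show "A0_le G (suminf c + e)"
    using A0_rep_suminf [OF fh sums_summable [OF sums] G] sums by (simp add: sums_iff)
qed

lemma A0_le_zero: "A0_le (\<lambda>_. 0) 0"
proof (rule A0_leI)
  show "A0_rep (\<lambda>_. 0) (\<lambda>_ _. 0) (\<lambda>_ _. 0)"
    by (simp add: A0_rep_def C0_Sinf_0 zero_H1_S1 sup_norm_0 conv_def tr_def cinner.zero_left)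
qed (simp add: sup_norm_0)

lemma A0_le_conv:
  assumes "f \<in> C0_Sinf" "h \<in> H1_S1"
  shows "A0_le (conv f h) (sup_norm f * L1_norm h)"
proof (rule A0_leI)
  let ?f = "\<lambda>k::nat. if k = 0 then f else (\<lambda>_. 0)" and ?h = "\<lambda>k::nat. if k = 0 then h else (\<lambda>_. 0)"
  have "(\<lambda>k. sup_norm (?f k) * L1_norm (?h k)) = (\<lambda>k. if k = 0 then sup_norm f * L1_norm h else 0)"
    by (auto simp: sup_norm_0)
  then have sums: "(\<lambda>k. sup_norm (?f k) * L1_norm (?h k)) sums (sup_norm f * L1_norm h)"
    using sums_single [of 0 "\<lambda>_. sup_norm f * L1_norm h"] by simp
  have "(\<lambda>k. conv (?f k) (?h k) s) = (\<lambda>k. if k = 0 then conv f h s else 0)" for s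
    by (auto simp: conv_def tr_def cinner.zero_left)
  then have "(\<lambda>k. conv (?f k) (?h k) s) sums conv f h s" for s
    using sums_single [of 0 "\<lambda>_. conv f h s"] by simp
  then show "A0_rep (conv f h) ?f ?h"
    using assms sums_summable [OF sums] by (simp add: A0_rep_def C0_Sinf_0 zero_H1_S1)
  show "(\<Sum>k. sup_norm (?f k) * L1_norm (?h k)) \<le> sup_norm f * L1_norm h"
    using sums by (simp add: sums_iff)
qed

lemma A0_le_add:
  assumes "A0_le F c" "A0_le G d"
  shows "A0_le (\<lambda>s. F s + G s) (c + d)"
proof -
  let ?F = "\<lambda>j::nat. if j = 0 then F else if j = 1 then G else (\<lambda>_. 0)"
  let ?c = "\<lambda>j::nat. if j = 0 then c else if j = 1 then d else 0"
  have "?c sums (\<Sum>j\<in>{0, 1}. ?c j)" by (rule sums_finite) auto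
  then have c: "?c sums (c + d)" by simp
  have "(\<lambda>j. ?F j s) sums (\<Sum>j\<in>{0, 1}. ?F j s)" for s by (rule sums_finite) auto
  then have "(\<lambda>j. ?F j s) sums (F s + G s)" for s by simp
  with A0_le_suminf [of ?F ?c "\<lambda>s. F s + G s"] show ?thesis
    using assms A0_le_zero c by (simp add: sums_iff)
qed

lemma A0_le_scale:
  assumes "A0_le F c" shows "A0_le (\<lambda>s. a * F s) (cmod a * c)"
proof (rule A0_le_epsilon)
  fix e :: real assume e: "e > 0"
  \<comment> \<open>Multiplied by \<open>cmod a\<close>, this allowance stays below
    \<open>e\<close>; the summand 1 covers \<open>a = 0\<close>.\<close>
  have "c < c + e / (cmod a + 1)" using e by (simp add: add_nonneg_pos)
  from A0_leE [OF assms this] obtain f h where rep: "A0_rep F f h"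
    and le: "(\<Sum>k. sup_norm (f k) * L1_norm (h k)) < c + e / (cmod a + 1)" by blast
  let ?f = "\<lambda>k t. cscale_op a (f k t)"
  have f: "f k \<in> C0_Sinf" and h: "h k \<in> H1_S1" for k using rep by (auto simp: A0_rep_def)
  have sum: "summable (\<lambda>k. sup_norm (f k) * L1_norm (h k))" using rep by (simp add: A0_rep_def)
  have term_le: "sup_norm (?f k) * L1_norm (h k) \<le> cmod a * (sup_norm (f k) * L1_norm (h k))" for k
    using C0_Sinf_cscale(2) [OF f, of a k] by (simp add: mult_right_mono flip: mult.assoc)
  have sum': "summable (\<lambda>k. sup_norm (?f k) * L1_norm (h k))"
    by (rule summable_comparison_test' [OF summable_mult [OF sum, of "cmod a"]])
      (use term_le sup_norm_nonneg [OF C0_Sinf_cscale(1) [OF f]] in \<open>simp add: abs_mult\<close>)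
  show "A0_le (\<lambda>s. a * F s) (cmod a * c + e)"
  proof (rule A0_leI)
    show "A0_rep (\<lambda>s. a * F s) ?f h"
      using rep f h sum' by (auto simp: A0_rep_def C0_Sinf_cscale conv_cscale_left H1_S1_L1 intro: sums_mult)
    have "(\<Sum>k. sup_norm (?f k) * L1_norm (h k)) \<le> cmod a * (\<Sum>k. sup_norm (f k) * L1_norm (h k))"
      using suminf_le [OF term_le sum' summable_mult [OF sum]] suminf_mult [OF sum] by simp
    also have "\<dots> \<le> cmod a * (c + e / (cmod a + 1))" using le by (intro mult_left_mono) auto
    also have "\<dots> = cmod a * c + e * (cmod a / (cmod a + 1))" by (simp add: distrib_left)
    also have "\<dots> \<le> cmod a * c + e * 1"
      using e by (intro add_left_mono mult_left_mono) (auto simp: divide_le_eq_1 add_nonneg_pos)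
    also have "\<dots> = cmod a * c + e" by simp
    finally show "(\<Sum>k. sup_norm (?f k) * L1_norm (h k)) \<le> cmod a * c + e" .
  qed
qed

lemma A0_le_diff: "A0_le F c \<Longrightarrow> A0_le G d \<Longrightarrow> A0_le (\<lambda>s. F s - G s) (c + d)"
  using A0_le_add [of F c "\<lambda>s. - 1 * G s" d] A0_le_scale [of G d "- 1"] by simp

text \<open>Only pointwise convergence to \<open>F\<close> is assumed. Along a rapidly Cauchy
  subsequence, \<open>F - X (N 0)\<close> is a telescoping series of total cost \<open>e\<close>;
  adding \<open>X (N 0)\<close> gives \<open>c + e\<close>, and \<open>e\<close> is
  arbitrary.\<close>

lemma A0_le_limit:
  assumes X: "\<And>n. A0_le (X n) c"
    and Cauchy: "\<And>e. e > 0 \<Longrightarrow> \<exists>M. \<forall>m\<ge>M. \<forall>n\<ge>M. A0_le (\<lambda>s. X m s - X n s) e"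
    and lim: "\<And>s. (\<lambda>n. X n s) \<longlonglongrightarrow> F s"
  shows "A0_le F c"
proof (rule A0_le_epsilon)
  fix e :: real assume e: "e > 0"
  have "\<forall>k. \<exists>M. \<forall>m\<ge>M. \<forall>n\<ge>M. A0_le (\<lambda>s. X m s - X n s) (e * (1/2) ^ Suc k)"
    using Cauchy e by simp
  then obtain M where M: "\<And>k m n. m \<ge> M k \<Longrightarrow> n \<ge> M k \<Longrightarrow> A0_le (\<lambda>s. X m s - X n s) (e * (1/2) ^ Suc k)"
    by metis
  \<comment> \<open>Summing the thresholds puts both \<open>N k\<close> and \<open>N (Suc k)\<close>
    above \<open>M k\<close> although \<open>M\<close> need not be monotone; the summand
    \<open>k\<close> makes \<open>N\<close> tend to infinity.\<close>
  define N where "N k = k + (\<Sum>i\<le>k. M i)" for k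
  have N: "N k \<ge> M k" "N (Suc k) \<ge> M k" "N k \<ge> k" for k
    using member_le_sum [of k "{..k}" M] by (auto simp: N_def)
  have "filterlim N at_top sequentially"
    using N(3) by (intro filterlim_at_top_mono [OF filterlim_ident]) auto
  then have "(\<lambda>k. X (N k) s) \<longlonglongrightarrow> F s" for s by (rule filterlim_compose [OF lim])
  then have sums: "(\<lambda>k. X (N (Suc k)) s - X (N k) s) sums (F s - X (N 0) s)" for s
    by (rule telescope_sums)
  have half: "(\<lambda>k. e * (1/2) ^ Suc k) sums (e * 1)" by (intro sums_mult power_half_series)
  have "A0_le (\<lambda>s. F s - X (N 0) s) (\<Sum>k. e * (1/2) ^ Suc k)"
    by (rule A0_le_suminf [OF M [OF N(2) N(1)] sums_summable [OF half] sums])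
  then have "A0_le (\<lambda>s. F s - X (N 0) s) e" using half by (simp add: sums_iff)
  from A0_le_add [OF X this, of "N 0"] show "A0_le F (c + e)" by simp
qed

text \<open>Near-optimal series for \<open>F\<close> and \<open>G\<close> multiply to a double
  series of products of single convolutions, whose costs factor. Submultiplicativity is thereby
  reduced to \<open>prod\<close>.\<close>

lemma A0_le_mult_of_conv:
  assumes prod: "\<And>f g h m. f \<in> C0_Sinf \<Longrightarrow> g \<in> C0_Sinf \<Longrightarrow> h \<in> H1_S1 \<Longrightarrow> m \<in> H1_S1 \<Longrightarrow>
      A0_le (\<lambda>s. conv f h s * conv g m s) ((sup_norm f * L1_norm h) * (sup_norm g * L1_norm m))"
    and F: "A0_le F c" and G: "A0_le G d"
  shows "A0_le (\<lambda>s. F s * G s) (c * d)"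
proof -
  have le: "A0_le (\<lambda>s. F s * G s) ((c + e) * (d + e))" if e: "e > 0" for e
  proof -
    obtain f h where F: "A0_rep F f h" "(\<Sum>k. sup_norm (f k) * L1_norm (h k)) < c + e"
      using A0_leE [OF F, of "c + e"] e by auto
    obtain g m where G: "A0_rep G g m" "(\<Sum>k. sup_norm (g k) * L1_norm (m k)) < d + e"
      using A0_leE [OF G, of "d + e"] e by auto
    define a where "a j = sup_norm (f j) * L1_norm (h j)" for j
    define b where "b k = sup_norm (g k) * L1_norm (m k)" for k
    have a: "0 \<le> a j" "cmod (conv (f j) (h j) s) \<le> a j" for j s using A0_rep_terms [OF F(1)] by (auto simp: a_def)
    have b: "0 \<le> b j" "cmod (conv (g j) (m j) s) \<le> b j" for j s using A0_rep_terms [OF G(1)] by (auto simp: b_def)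
    have ab_eq: "a = (\<lambda>j. sup_norm (f j) * L1_norm (h j))" "b = (\<lambda>k. sup_norm (g k) * L1_norm (m k))"
      by (simp_all add: a_def b_def fun_eq_iff)
    have sa: "summable a" and sb: "summable b" using F(1) G(1) by (simp_all add: A0_rep_def ab_eq)
    \<comment> \<open>Kept polymorphic: it is used for the real costs and for the complex
      values.\<close>
    have dec: "summable (\<lambda>n. norm (case prod_decode n of (j, k) \<Rightarrow> u j * v k))
        \<and> (\<lambda>n. case prod_decode n of (j, k) \<Rightarrow> u j * v k) sums (suminf u * suminf v)"
      if u: "summable (\<lambda>j. norm (u j))" and v: "summable (\<lambda>j. norm (v j))"
      for u v :: "nat \<Rightarrow> 'a :: {real_normed_field, banach}"
    proof -
      have 1: "summable (\<lambda>k. norm (u j * v k))" for j using summable_mult [OF v, of "norm (u j)"] by (simp only: norm_mult)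
      have "(\<Sum>k. norm (u j * v k)) = norm (u j) * (\<Sum>k. norm (v k))" for j
        using suminf_mult [OF v, of "norm (u j)"] by (simp only: norm_mult)
      then have 2: "summable (\<lambda>j. \<Sum>k. norm (u j * v k))" using summable_mult2 [OF u] by (simp only:)
      have "(\<Sum>k. u j * v k) = u j * suminf v" for j by (rule suminf_mult [OF summable_norm_cancel [OF v]])
      moreover have "(\<Sum>j. u j * suminf v) = suminf u * suminf v"
        by (rule suminf_mult2 [OF summable_norm_cancel [OF u], symmetric])
      ultimately show ?thesis
        using sums_prod_decode [of "\<lambda>j k. u j * v k", OF 1 2] by (simp only: simp_thms)
    qed
    have ab: "(\<lambda>n. case prod_decode n of (j, k) \<Rightarrow> a j * b k) sums (suminf a * suminf b)"
      using dec [of a b] sa sb a(1) b(1) by simp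
    have "A0_le (\<lambda>s. F s * G s) (\<Sum>n. case prod_decode n of (j, k) \<Rightarrow> a j * b k)"
    proof (rule A0_le_suminf [OF _ sums_summable [OF ab]])
      show "A0_le ((\<lambda>(j, k) s. conv (f j) (h j) s * conv (g k) (m k) s) (prod_decode n))
          (case prod_decode n of (j, k) \<Rightarrow> a j * b k)" for n
        using F(1) G(1) prod by (auto simp: A0_rep_def a_def b_def split: prod.split)
      fix s
      have "summable (\<lambda>j. cmod (conv (f j) (h j) s))" "summable (\<lambda>j. cmod (conv (g j) (m j) s))"
        using a(2) b(2) by (auto intro: summable_comparison_test' [OF sa] summable_comparison_test' [OF sb])
      from dec [OF this]
      show "(\<lambda>n. (\<lambda>(j, k) s. conv (f j) (h j) s * conv (g k) (m k) s) (prod_decode n) s) sums (F s * G s)"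
        using F(1) G(1) by (simp add: A0_rep_def sums_iff case_prod_unfold)
    qed
    moreover have "suminf a * suminf b \<le> (c + e) * (d + e)"
      using F(2) [folded ab_eq] G(2) [folded ab_eq] suminf_nonneg [OF sa a(1)] suminf_nonneg [OF sb b(1)]
      by (intro mult_mono) auto
    ultimately show ?thesis using ab by (auto simp: sums_iff intro: A0_le_mono)
  qed
  show ?thesis
  proof (rule A0_le_tendsto)
    show "A0_le (\<lambda>s. F s * G s) ((c + 1 / real (Suc n)) * (d + 1 / real (Suc n)))" for n
      by (rule le) simp
    have lim0: "(\<lambda>n. 1 / real (Suc n)) \<longlonglongrightarrow> 0" by (rule lim_const_over_n [THEN LIMSEQ_Suc])
    show "(\<lambda>n. (c + 1 / real (Suc n)) * (d + 1 / real (Suc n))) \<longlonglongrightarrow> c * d"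
      using tendsto_mult [OF tendsto_add [OF tendsto_const lim0] tendsto_add [OF tendsto_const lim0], of c d]
      by (simp only: add_0_right)
  qed
qed

text \<open>Apart from the product estimate, the substance is completeness:
  \<open>A0_le_bound\<close> provides a pointwise limit, and \<open>A0_le_limit\<close> upgrades it
  to a limit in norm.\<close>

lemma banach_algebra_pointwise_A0:
  assumes mult: "\<And>F G c d. A0_le F c \<Longrightarrow> A0_le G d \<Longrightarrow> A0_le (\<lambda>s. F s * G s) (c * d)"
  shows "banach_algebra_pointwise A0 A0_norm"
proof -
  have A0: "F \<in> A0" "A0_norm F \<le> c" if "A0_le F c" for F c using that by (auto simp: A0_le_def)
  have scale_le: "A0_norm (\<lambda>s. c * F s) \<le> cmod c * A0_norm F" if "F \<in> A0" for F c
    by (rule A0 [OF A0_le_scale [OF A0_le_norm [OF that]]])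
  have scale: "A0_norm (\<lambda>s. c * F s) = cmod c * A0_norm F" if F: "F \<in> A0" for F c
  proof (cases "c = 0")
    case True
    then show ?thesis
      using A0(2) [OF A0_le_zero] A0_le_nonneg [OF A0_le_norm [OF A0(1) [OF A0_le_zero]]] by simp
  next
    case False
    have "A0_norm F \<le> cmod (1 / c) * A0_norm (\<lambda>s. c * F s)"
      using scale_le [OF A0(1) [OF A0_le_scale [OF A0_le_norm [OF F], of c]], of "1 / c"] False by simp
    then show ?thesis using scale_le [OF F, of c] False by (simp add: norm_divide field_simps)
  qed
  have zero: "A0_norm F = 0 \<longleftrightarrow> F = (\<lambda>_. 0)" if F: "F \<in> A0" for F
  proof
    assume "A0_norm F = 0"
    then show "F = (\<lambda>_. 0)" using A0_le_bound [OF A0_le_norm [OF F]] by (auto simp: fun_eq_iff)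
  next
    assume "F = (\<lambda>_. 0)"
    then show "A0_norm F = 0" using scale [OF F, of 0] by simp
  qed
  have complete: "\<exists>F\<in>A0. (\<lambda>n. A0_norm (\<lambda>s. X n s - F s)) \<longlonglongrightarrow> 0"
    if X: "\<And>n::nat. X n \<in> A0" and C: "\<And>e. e > 0 \<Longrightarrow> \<exists>M. \<forall>m\<ge>M. \<forall>n\<ge>M. A0_norm (\<lambda>s. X m s - X n s) < e" for X
  proof -
    have diff: "(\<lambda>s. X m s - X n s) \<in> A0" for m n by (rule A0(1) [OF A0_le_diff [OF A0_le_norm A0_le_norm]]) (rule X)+
    have C': "\<exists>M. \<forall>m\<ge>M. \<forall>n\<ge>M. A0_le (\<lambda>s. X m s - X n s) e" if "e > 0" for e
      using C [OF that] diff unfolding A0_le_def by (meson less_imp_le)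
    have "Cauchy (\<lambda>n. X n s)" for s
    proof (rule CauchyI)
      fix e :: real assume "e > 0"
      then obtain M where "\<forall>m\<ge>M. \<forall>n\<ge>M. A0_le (\<lambda>s. X m s - X n s) (e/2)" using C' [of "e/2"] by auto
      then have "norm (X m s - X n s) \<le> e/2" if "m \<ge> M" "n \<ge> M" for m n using A0_le_bound that by blast
      then show "\<exists>M. \<forall>m\<ge>M. \<forall>n\<ge>M. norm (X m s - X n s) < e"
        using \<open>e > 0\<close> by (intro exI [of _ M] allI impI) fastforce
    qed
    then have F: "(\<lambda>n. X n s) \<longlonglongrightarrow> lim (\<lambda>n. X n s)" for s
      using Cauchy_convergent convergent_LIMSEQ_iff by blast
    define F where "F s = lim (\<lambda>n. X n s)" for s
    note F = F [folded F_def]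
    have lim: "\<exists>M. \<forall>n\<ge>M. A0_le (\<lambda>s. X n s - F s) e" if e: "e > 0" for e
    proof -
      obtain M where M: "\<And>m n. m \<ge> M \<Longrightarrow> n \<ge> M \<Longrightarrow> A0_le (\<lambda>s. X m s - X n s) e" using C' [OF e] by blast
      have "A0_le (\<lambda>s. X n s - F s) e" if n: "n \<ge> M" for n
      \<comment> \<open>The limit is taken in the second index with \<open>n\<close> fixed; shifting
        by \<open>M\<close> makes the Cauchy bound hold for every term of the sequence.\<close>
      proof (rule A0_le_limit)
        show "A0_le (\<lambda>s. X n s - X (k + M) s) e" for k using M n by simp
        show "(\<lambda>k. X n s - X (k + M) s) \<longlonglongrightarrow> X n s - F s" for s
          by (intro tendsto_intros LIMSEQ_ignore_initial_segment F)
        show "\<exists>K. \<forall>k\<ge>K. \<forall>l\<ge>K. A0_le (\<lambda>s. (X n s - X (k + M) s) - (X n s - X (l + M) s)) d" if d: "d > 0" for d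
        proof -
          obtain K where "\<forall>m\<ge>K. \<forall>n\<ge>K. A0_le (\<lambda>s. X m s - X n s) d" using C' [OF d] by blast
          then have "A0_le (\<lambda>s. X (l + M) s - X (k + M) s) d" if "k \<ge> K" "l \<ge> K" for k l using that by auto
          then show ?thesis by (intro exI [of _ K]) simp
        qed
      qed
      then show ?thesis by blast
    qed
    obtain M where "A0_le (\<lambda>s. X M s - F s) 1" using lim [of 1] by auto
    from A0_le_diff [OF A0_le_norm [OF X [of M]] this] have "F \<in> A0" using A0(1) by fastforce
    moreover have "(\<lambda>n. A0_norm (\<lambda>s. X n s - F s)) \<longlonglongrightarrow> 0"
    proof (rule LIMSEQ_I)
      fix e :: real assume "e > 0"
      then obtain M where M: "\<And>n. n \<ge> M \<Longrightarrow> A0_le (\<lambda>s. X n s - F s) (e/2)" using lim [of "e/2"] by auto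
      have "norm (A0_norm (\<lambda>s. X n s - F s) - 0) < e" if "n \<ge> M" for n
        using A0(2) [OF M [OF that]] A0_le_nonneg [OF A0_le_norm [OF A0(1) [OF M [OF that]]]] \<open>e > 0\<close> by simp
      then show "\<exists>M. \<forall>n\<ge>M. norm (A0_norm (\<lambda>s. X n s - F s) - 0) < e" by blast
    qed
    ultimately show ?thesis by blast
  qed
  show ?thesis
    unfolding banach_algebra_pointwise_def
    using A0(1) [OF A0_le_zero] A0 [OF A0_le_add [OF A0_le_norm A0_le_norm]] A0(1) [OF A0_le_scale [OF A0_le_norm]]
      A0 [OF mult [OF A0_le_norm A0_le_norm]] A0_le_nonneg [OF A0_le_norm] zero scale complete
    by (intro conjI ballI allI impI) auto
qed

section \<open>Products in \<open>H1\<close>\<close>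

text \<open>The positive and negative parts of \<open>k\<close> have the same mass \<open>a\<close>,
  by the hypothesis at frequency 0. Divided by \<open>a\<close> they are densities of probability
  measures with equal characteristic functions, which coincide by Levy's uniqueness theorem.\<close>

lemma integral_indicator_eq_0_of_fourier_real:
  fixes k :: "real \<Rightarrow> real"
  assumes k: "integrable lborel k" and zero: "\<And>w. (LINT r|lborel. k r *\<^sub>R iexp (w * r)) = 0"
    and I: "I \<in> sets borel"
  shows "(LINT r|lborel. k r * indicator I r) = 0"
proof -
  define p where "p r = max (k r) 0" for r
  define q where "q r = max (- k r) 0" for r
  have pq: "k r = p r - q r" "\<bar>k r\<bar> = p r + q r" "0 \<le> p r" "0 \<le> q r" for r by (auto simp: p_def q_def)
  have km [measurable]: "k \<in> borel_measurable borel" using borel_measurable_integrable [OF k] by simp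
  have m [measurable]: "p \<in> borel_measurable borel" "q \<in> borel_measurable borel"
    unfolding p_def q_def by measurable
  have ip: "integrable lborel p" and iq: "integrable lborel q"
    by (auto intro!: Bochner_Integration.integrable_bound [OF k] simp: p_def q_def)
  have split: "(LINT r|lborel. k r *\<^sub>R f r) = (LINT r|lborel. p r *\<^sub>R f r) - (LINT r|lborel. q r *\<^sub>R f r)"
    if [measurable]: "f \<in> borel_measurable borel" and "\<And>r. norm (f r) \<le> 1"
    for f :: "real \<Rightarrow> 'a :: {banach, second_countable_topology}"
  proof -
    have "integrable lborel (\<lambda>r. p r *\<^sub>R f r)"
      by (rule Bochner_Integration.integrable_bound [OF ip]) (use that(2) pq(3) in \<open>auto simp: mult_left_le\<close>)
    moreover have "integrable lborel (\<lambda>r. q r *\<^sub>R f r)"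
      by (rule Bochner_Integration.integrable_bound [OF iq]) (use that(2) pq(4) in \<open>auto simp: mult_left_le\<close>)
    ultimately show ?thesis by (simp add: pq(1) scaleR_diff_left)
  qed
  have eq: "(LINT r|lborel. p r *\<^sub>R iexp (w * r)) = (LINT r|lborel. q r *\<^sub>R iexp (w * r))" for w
    using split [of "\<lambda>r. iexp (w * r)"] zero [of w] by simp
  define a where "a = (LINT r|lborel. p r)"
  have aq: "(LINT r|lborel. q r) = a"
    using eq [of 0] by (simp add: a_def scaleR_conv_of_real integral_complex_of_real)
  have "a \<ge> 0" using pq(3) by (simp add: a_def integral_nonneg_AE)
  show ?thesis
  \<comment> \<open>Normalisation requires \<open>a > 0\<close>; for \<open>a = 0\<close> both parts
    of \<open>k\<close> have integral 0.\<close>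
  proof (cases "a = 0")
    case True
    have "norm (LINT r|lborel. k r * indicator I r) \<le> (LINT r|lborel. norm (k r * indicator I r))"
      by (rule integral_norm_bound)
    also have "\<dots> \<le> (LINT r|lborel. p r + q r)"
    proof (rule integral_mono)
      show "integrable lborel (\<lambda>r. norm (k r * indicator I r))"
        using I by (intro integrable_norm integrable_real_mult_indicator k) simp
      show "norm (k r * indicator I r) \<le> p r + q r" for r
        unfolding pq(2) [symmetric] by (simp add: indicator_def)
    qed (use ip iq in simp)
    also have "\<dots> = 0" using ip iq aq True by (simp add: a_def [symmetric])
    finally show ?thesis by simp
  next
    case False
    then have a: "a > 0" using \<open>a \<ge> 0\<close> by simp
    define D where "D u = density lborel (\<lambda>r. ennreal (u r / a))" for u :: "real \<Rightarrow> real"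
    have int_D: "integral\<^sup>L (D u) f = (LINT r|lborel. u r *\<^sub>R f r) /\<^sub>R a"
      if "u \<in> borel_measurable borel" "\<And>r. 0 \<le> u r" and f: "f \<in> borel_measurable borel"
      for u and f :: "real \<Rightarrow> 'a :: {banach, second_countable_topology}"
    proof -
      have "integral\<^sup>L (D u) f = (LINT r|lborel. (u r / a) *\<^sub>R f r)"
        unfolding D_def using that a by (intro integral_density) auto
      also have "\<dots> = (LINT r|lborel. inverse a *\<^sub>R (u r *\<^sub>R f r))" by (simp add: divide_inverse mult.commute)
      also have "\<dots> = inverse a *\<^sub>R (LINT r|lborel. u r *\<^sub>R f r)" by (rule integral_scaleR_right)
      finally show ?thesis .
    qed
    have D: "real_distribution (D u)"
      if u: "integrable lborel u" "\<And>r. 0 \<le> u r" "(LINT r|lborel. u r) = a" for u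
    proof -
      have "emeasure (D u) (space (D u)) = (\<integral>\<^sup>+r. ennreal (u r / a) \<partial>lborel)"
        unfolding D_def using borel_measurable_integrable [OF u(1)] by (subst emeasure_density) auto
      also have "\<dots> = ennreal (LINT r|lborel. u r / a)"
        using u a by (intro nn_integral_eq_integral) auto
      also have "\<dots> = 1" using u(3) a by simp
      finally have "prob_space (D u)" by (rule prob_spaceI)
      then show ?thesis by (simp add: real_distribution_def real_distribution_axioms_def D_def)
    qed
    have "char (D p) = char (D q)"
    proof
      fix t
      have "(\<lambda>r. iexp (t * r)) \<in> borel_measurable borel" by measurable
      from int_D [OF m(1) pq(3) this] int_D [OF m(2) pq(4) this]
      show "char (D p) t = char (D q) t" by (simp only: char_def eq)
    qed
    then have Deq: "D p = D q"
      by (intro Levy_uniqueness D ip iq pq aq) (simp add: a_def)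
    have ind: "indicator I \<in> borel_measurable borel" using I by simp
    have "(LINT r|lborel. p r *\<^sub>R indicator I r) /\<^sub>R a = (LINT r|lborel. q r *\<^sub>R (indicator I r :: real)) /\<^sub>R a"
      by (rule trans [OF sym [OF int_D [OF m(1) pq(3) ind, unfolded Deq]] int_D [OF m(2) pq(4) ind]])
    then have "(LINT r|lborel. p r *\<^sub>R indicator I r) = (LINT r|lborel. q r *\<^sub>R (indicator I r :: real))"
      using a by simp
    moreover have "norm (indicator I r :: real) \<le> 1" for r by (simp add: indicator_def)
    note split [OF ind this]
    ultimately show ?thesis by simp
  qed
qed

text \<open>The transform of \<open>Re L\<close> at a frequency combines that of \<open>L\<close>
  there with the conjugate of that of \<open>L\<close> at the opposite frequency, so it vanishes as
  well. The imaginary part of \<open>K\<close> is the real part of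
  \<open>- \<i> * K\<close>.\<close>

lemma integral_indicator_eq_0_of_fourier:
  fixes K :: "real \<Rightarrow> complex"
  assumes K: "integrable lborel K" and zero: "\<And>w. fourier K w = 0" and I: "I \<in> sets borel"
  shows "(LINT r|lborel. K r * indicator I r) = 0"
proof -
  have re: "(LINT r|lborel. Re (L r) * indicator I r) = 0"
    if L: "integrable lborel L" and zero: "\<And>w. fourier L w = 0" for L
  proof (rule integral_indicator_eq_0_of_fourier_real [OF _ _ I])
    show "integrable lborel (\<lambda>r. Re (L r))" using L by simp
    fix w
    have e: "integrable lborel (\<lambda>r. L r * iexp (u * r))" for u
      using borel_measurable_integrable [OF L]
      by (intro Bochner_Integration.integrable_bound [OF L]) (auto simp: norm_mult)
    have z: "(LINT r|lborel. L r * iexp (u * r)) = 0" for u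
      using zero [of "- u"] by (simp add: fourier_def mult.commute mult.left_commute)
    have "Re (L r) *\<^sub>R iexp (w * r) = (L r * iexp (w * r) + cnj (L r * iexp (- w * r))) / 2" for r
    proof -
      have "cnj (iexp (- w * r)) = iexp (w * r)" by (simp add: exp_cnj)
      then have "L r * iexp (w * r) + cnj (L r * iexp (- w * r)) = (L r + cnj (L r)) * iexp (w * r)"
        by (simp only: complex_cnj_mult distrib_right)
      then show ?thesis by (simp add: complex_add_cnj scaleR_conv_of_real)
    qed
    then have "(LINT r|lborel. Re (L r) *\<^sub>R iexp (w * r))
        = ((LINT r|lborel. L r * iexp (w * r)) + (LINT r|lborel. cnj (L r * iexp (- w * r)))) / 2"
      using Bochner_Integration.integral_add [OF e integrable_bounded_linear [OF bounded_linear_cnj e], of w "- w"]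
      by (simp only: integral_divide_zero)
    also have "(LINT r|lborel. cnj (L r * iexp (- w * r))) = cnj (LINT r|lborel. L r * iexp (- w * r))"
      by (rule integral_bounded_linear [OF bounded_linear_cnj e])
    finally show "(LINT r|lborel. Re (L r) *\<^sub>R iexp (w * r)) = 0" by (simp only: z) simp
  qed
  have "(LINT r|lborel. Re (K r) * indicator I r) = 0" by (rule re [OF K zero])
  moreover have "(LINT r|lborel. Re (- \<i> * K r) * indicator I r) = 0"
  proof (rule re)
    show "integrable lborel (\<lambda>r. - \<i> * K r)" using K by simp
    show "fourier (\<lambda>r. - \<i> * K r) w = 0" for w using zero [of w] by (simp add: fourier_def mult.assoc)
  qed
  moreover have int: "integrable lborel (\<lambda>r. K r * indicator I r)"
    using I borel_measurable_integrable [OF K]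
    by (intro Bochner_Integration.integrable_bound [OF K]) (auto simp: indicator_def)
  have "Re (K r * indicator I r) = Re (K r) * indicator I r" "Im (K r * indicator I r) = Im (K r) * indicator I r" for r
    by (auto simp: indicator_def)
  then have "Re (LINT r|lborel. K r * indicator I r) = (LINT r|lborel. Re (K r) * indicator I r)"
    "Im (LINT r|lborel. K r * indicator I r) = (LINT r|lborel. Im (K r) * indicator I r)"
    using integral_Re [OF int] integral_Im [OF int] by simp_all
  ultimately show ?thesis by (simp add: complex_eq_iff)
qed

text \<open>The convolution of \<open>\<phi>\<close> with the indicator of \<open>I\<close>. For
  integrable \<open>\<phi>\<close> it is bounded, unlike a single translate, so its product with an
  integrable function is integrable.\<close>

definition window :: "real set \<Rightarrow> (real \<Rightarrow> complex) \<Rightarrow> real \<Rightarrow> complex"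
  where "window I \<phi> u = (LINT r|lborel. \<phi> (u - r) * indicator I r)"

lemma window_bound:
  assumes "integrable lborel \<phi>" "I \<in> sets borel"
  shows "integrable lborel (\<lambda>r. \<phi> (u - r) * indicator I r)"
    and "cmod (window I \<phi> u) \<le> (LINT r|lborel. cmod (\<phi> r))"
proof -
  have i: "integrable lborel (\<lambda>r. \<phi> (u - r))" by (rule integrable_reflect(1) [OF assms(1)])
  show int: "integrable lborel (\<lambda>r. \<phi> (u - r) * indicator I r)"
    using assms(2) borel_measurable_integrable [OF i]
    by (intro Bochner_Integration.integrable_bound [OF i]) (auto simp: indicator_def)
  have "cmod (window I \<phi> u) \<le> (LINT r|lborel. cmod (\<phi> (u - r) * indicator I r))"
    unfolding window_def by (rule integral_norm_bound)
  also have "\<dots> \<le> (LINT r|lborel. cmod (\<phi> (u - r)))"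
    using int i by (intro integral_mono integrable_norm) (auto simp: indicator_def)
  also have "\<dots> = (LINT r|lborel. cmod (\<phi> r))"
    by (rule integrable_reflect(2) [OF integrable_norm [OF assms(1)]])
  finally show "cmod (window I \<phi> u) \<le> (LINT r|lborel. cmod (\<phi> r))" .
qed

text \<open>The Fourier transform of \<open>\<psi> \<cdot> window I \<phi>\<close> at \<open>v \<le> 0\<close> is the integral over \<open>I\<close> of the correlation \<open>K\<close>
  of \<open>\<psi> e\<^sub>v\<close> with \<open>\<phi>\<close>. The Fourier transform of \<open>K\<close> at \<open>w\<close> is that of \<open>\<psi>\<close> at \<open>v + w\<close> times that of \<open>\<phi>\<close> at
  \<open>- w\<close>, and one of the two factors always vanishes.\<close>

lemma H1_mult_window:
  assumes \<psi>: "\<psi> \<in> H1" and \<phi>: "\<phi> \<in> H1" and I: "I \<in> sets borel"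
  shows "(\<lambda>u. \<psi> u * window I \<phi> u) \<in> H1"
proof -
  have i\<psi>: "integrable lborel \<psi>" and i\<phi>: "integrable lborel \<phi>" using \<psi> \<phi> by (auto simp: H1_def)
  have [measurable]: "\<psi> \<in> borel_measurable borel" "\<phi> \<in> borel_measurable borel" "I \<in> sets borel"
    using borel_measurable_integrable [OF i\<psi>] borel_measurable_integrable [OF i\<phi>] I by auto
  have wm [measurable]: "window I \<phi> \<in> borel_measurable borel"
    unfolding window_def [abs_def] by measurable
  have int: "integrable lborel (\<lambda>u. \<psi> u * window I \<phi> u)"
  proof (rule Bochner_Integration.integrable_bound)
    show "integrable lborel (\<lambda>u. \<psi> u * of_real (LINT r|lborel. cmod (\<phi> r)))" using i\<psi> by simp
    have "0 \<le> (LINT r|lborel. cmod (\<phi> r))" by simp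
    then show "AE u in lborel. norm (\<psi> u * window I \<phi> u) \<le> norm (\<psi> u * of_real (LINT r|lborel. cmod (\<phi> r)))"
      using window_bound(2) [OF i\<phi> I] by (intro AE_I2) (simp add: norm_mult mult_left_mono)
  qed measurable
  have "fourier (\<lambda>u. \<psi> u * window I \<phi> u) v = 0" if v: "v \<le> 0" for v
  proof -
    define e where "e x u = exp (- (\<i> * of_real u * of_real x))" for x u :: real
    have em [measurable]: "e x \<in> borel_measurable borel" for x unfolding e_def by measurable
    have ne: "cmod (e x u) = 1" for x u by (simp add: e_def)
    define \<psi>v where "\<psi>v u = \<psi> u * e v u" for u
    have [measurable]: "\<psi>v \<in> borel_measurable borel" unfolding \<psi>v_def by measurable
    have i\<psi>v: "integrable lborel \<psi>v"
      by (rule Bochner_Integration.integrable_bound [OF i\<psi>]) (auto simp: \<psi>v_def norm_mult ne)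
    \<comment> \<open>The bounded multiplier \<open>z\<close> will be an exponential, for the
      Fourier transform of \<open>K\<close>, and the indicator of \<open>I\<close>, for the window;
      one use of Fubini covers both.\<close>
    have joint: "integrable (lborel \<Otimes>\<^sub>M lborel) (\<lambda>(u, r). \<psi>v u * \<phi> (u - r) * z r)"
      if [measurable]: "z \<in> borel_measurable borel" and z: "\<And>r. cmod (z r) \<le> 1" for z :: "real \<Rightarrow> complex"
    proof (rule Bochner_Integration.integrable_bound)
      show "integrable (lborel \<Otimes>\<^sub>M lborel) (\<lambda>(u, r). \<psi>v u * \<phi> (u - r))"
      proof (rule lborel_pair.Fubini_integrable)
        have "(LINT r|lborel. norm (\<psi>v u * \<phi> (u - r))) = norm (\<psi>v u) * (LINT r|lborel. norm (\<phi> r))" for u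
          using integrable_reflect(2) [OF integrable_norm [OF i\<phi>], of u] by (simp add: norm_mult)
        then show "integrable lborel (\<lambda>u. LINT r|lborel. norm (case (u, r) of (u, r) \<Rightarrow> \<psi>v u * \<phi> (u - r)))"
          using i\<psi>v by simp
        show "AE u in lborel. integrable lborel (\<lambda>r. case (u, r) of (u, r) \<Rightarrow> \<psi>v u * \<phi> (u - r))"
          using integrable_reflect(1) [OF i\<phi>] by (intro AE_I2) simp
      qed measurable
      show "AE p in lborel \<Otimes>\<^sub>M lborel. norm (case p of (u, r) \<Rightarrow> \<psi>v u * \<phi> (u - r) * z r)
          \<le> norm (case p of (u, r) \<Rightarrow> \<psi>v u * \<phi> (u - r))"
        using z by (intro AE_I2) (auto simp: norm_mult mult_left_le split: prod.split)
    qed measurable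
    define K where "K r = (LINT u|lborel. \<psi>v u * \<phi> (u - r))" for r
    have swap: "(LINT r|lborel. K r * z r) = (LINT u|lborel. \<psi>v u * (LINT r|lborel. \<phi> (u - r) * z r))"
      if z: "z \<in> borel_measurable borel" "\<And>r. cmod (z r) \<le> 1" for z :: "real \<Rightarrow> complex"
      using lborel_pair.Fubini_integral [OF joint [OF z]] by (simp add: K_def mult.assoc flip: integral_mult_left_zero)
    have iK: "integrable lborel K"
      using lborel_pair.integrable_snd [OF joint [of "\<lambda>_. 1"]] by (simp add: K_def [abs_def])
    have "fourier K w = 0" for w
    proof -
      have inner: "(LINT r|lborel. \<phi> (u - r) * e w r) = e w u * fourier \<phi> (- w)" for u
      proof -
        have "(\<lambda>x. e w u * (\<phi> x * e (- w) x)) = (\<lambda>x. \<phi> x * e w (u - x))"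
          by (rule ext) (simp add: e_def algebra_simps flip: exp_add)
        then have "e w u * fourier \<phi> (- w) = (LINT x|lborel. \<phi> x * e w (u - x))"
          unfolding fourier_def e_def [symmetric] by (simp only: flip: integral_mult_right_zero)
        also have "\<dots> = (LINT r|lborel. \<phi> (u - r) * e w (u - (u - r)))"
        proof (rule integrable_reflect(2) [symmetric, of "\<lambda>x. \<phi> x * e w (u - x)"])
          show "integrable lborel (\<lambda>x. \<phi> x * e w (u - x))"
            by (rule Bochner_Integration.integrable_bound [OF i\<phi>]) (auto simp: norm_mult ne)
        qed
        finally show ?thesis by simp
      qed
      have "fourier K w = (LINT u|lborel. \<psi>v u * (LINT r|lborel. \<phi> (u - r) * e w r))"
        unfolding fourier_def e_def [symmetric] by (rule swap) (simp_all add: ne)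
      also have "\<dots> = (LINT u|lborel. \<psi>v u * (e w u * fourier \<phi> (- w)))" by (simp only: inner)
      also have "\<dots> = fourier \<psi> (v + w) * fourier \<phi> (- w)"
      proof -
        have eq: "\<psi>v u * (e w u * fourier \<phi> (- w)) = \<psi> u * e (v + w) u * fourier \<phi> (- w)" for u
        proof -
          have "e v u * e w u = e (v + w) u" by (simp add: e_def algebra_simps flip: exp_add)
          then show ?thesis by (simp add: \<psi>v_def mult.assoc flip: mult.assoc [of "e v u"])
        qed
        have "fourier \<psi> (v + w) = (LINT u|lborel. \<psi> u * e (v + w) u)"
          by (simp only: fourier_def e_def)
        then show ?thesis by (simp only: eq integral_mult_left_zero)
      qed
      \<comment> \<open>For \<open>w \<ge> 0\<close> the frequency \<open>- w\<close> is at most 0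
        and the factor of \<open>\<phi>\<close> vanishes; for \<open>w < 0\<close> so is
        \<open>v + w\<close>, and the factor of \<open>\<psi>\<close> vanishes.\<close>
      also have "\<dots> = 0"
        using \<psi> \<phi> v by (cases "w \<ge> 0") (auto simp: H1_def)
      finally show ?thesis .
    qed
    then have "(LINT r|lborel. K r * indicator I r) = 0"
      by (rule integral_indicator_eq_0_of_fourier [OF iK _ I])
    also have "(LINT r|lborel. K r * indicator I r) = (LINT u|lborel. \<psi>v u * window I \<phi> u)"
      unfolding window_def by (rule swap) (auto simp: indicator_def)
    finally show ?thesis by (simp add: fourier_def \<psi>v_def e_def mult_ac)
  qed
  with int show ?thesis by (simp add: H1_def)
qed

section \<open>Products of two convolutions\<close>

lemma tens_cscale_op:
  assumes "clinear_op A" "clinear_op B"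
  shows "cscale_op c A \<otimes>\<^sub>o cscale_op d B = cscale_op (c * d) (A \<otimes>\<^sub>o B)"
  by (rule clinear_op_eqI) (use assms in \<open>auto simp: tens_op_ket coord_vtens intro!: ell2_eqI\<close>)

lemma tn_tens: "A \<in> S_one \<Longrightarrow> B \<in> S_one \<Longrightarrow> tn (A \<otimes>\<^sub>o B) = tn A * tn B"
  by (simp add: tn_def trace_norm_tens S_one_clinear enn2real_mult)

lemma integrable_tr_reflect:
  assumes G: "clinear_op G" and m: "m \<in> L1_S1"
  shows "integrable lborel (\<lambda>r. tr (G o\<^sub>L m (u - r)))"
proof -
  have mS: "m t \<in> S_one" for t using m by (simp add: L1_S1_iff S1_measurable_def)
  have mm: "S1_measurable m" and mi: "integrable lborel (\<lambda>t. norm G * tn (m t))"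
    using m by (auto simp: L1_S1_iff)
  have meas: "(\<lambda>r. tr (G o\<^sub>L m (u - r))) \<in> borel_measurable borel"
    by (rule S1_measurable_tr [OF mm]) (use G in auto)
  have le: "cmod (tr (G o\<^sub>L m (u - r))) \<le> norm G * tn (m (u - r))" for r by (rule cmod_tr_le [OF mS G])
  show ?thesis
    by (rule Bochner_Integration.integrable_bound [OF integrable_reflect(1) [OF mi, of u]])
      (use meas le in \<open>auto intro: order_trans [OF _ abs_ge_self]\<close>)
qed

text \<open>Stands for the integral of \<open>m (u - r)\<close> over \<open>r\<close> in
  \<open>I\<close>, where \<open>m\<close> is the tensor given by \<open>\<phi>\<close> and
  \<open>A\<close>; only scalar integrals occur.\<close>

definition window_S1 :: "real set \<Rightarrow> nat \<Rightarrow> (nat \<Rightarrow> real \<Rightarrow> complex) \<Rightarrow> (nat \<Rightarrow> oper) \<Rightarrow> real \<Rightarrow> oper"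
  where "window_S1 I q \<phi> A u = (\<Sum>i<q. cscale_op (window I (\<phi> i) u) (A i))"

text \<open>Fixes one representation of an element of \<open>H1_tensor_S1\<close>, because
  \<open>window_S1\<close> is written in terms of it.\<close>

locale tensor_sum =
  fixes q :: nat and \<phi> :: "nat \<Rightarrow> real \<Rightarrow> complex" and A :: "nat \<Rightarrow> oper" and m :: "real \<Rightarrow> oper"
  assumes \<phi>: "\<And>i. i < q \<Longrightarrow> \<phi> i \<in> H1" and A: "\<And>i. i < q \<Longrightarrow> A i \<in> S_one"
    and m_eq: "m = (\<lambda>t. \<Sum>i<q. cscale_op (\<phi> i t) (A i))"
begin

lemma m_tensor: "m \<in> H1_tensor_S1"
  unfolding m_eq using \<phi> A by (intro H1_tensor_S1_sum) auto

lemma m_L1: "m \<in> L1_S1" by (rule H1_tensor_S1_L1 [OF m_tensor])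

lemma m_S_one: "m t \<in> S_one"
  using m_L1 by (simp add: L1_S1_iff S1_measurable_def)

lemma window_S1_S_one: "window_S1 I q \<phi> A u \<in> S_one"
  unfolding window_S1_def using A by (intro S_one_sum) auto

text \<open>Linearity of \<open>L\<close> is asked along combinations of the \<open>A i\<close>,
  where it holds both for the trace pairing with \<open>G\<close> and for the finite diagonal sums
  of the duality.\<close>

lemma window_S1_functional:
  assumes L: "\<And>c. L (\<Sum>i<q. cscale_op (c i) (A i)) = (\<Sum>i<q. c i * L (A i))" and I: "I \<in> sets borel"
  shows "L (window_S1 I q \<phi> A u) = (LINT r|lborel. L (m (u - r)) * indicator I r)"
proof -
  have int: "integrable lborel (\<lambda>r. \<phi> i (u - r) * indicator I r * L (A i))" if "i < q" for i
    using \<phi> [OF that] window_bound(1) [OF _ I, of "\<phi> i" u] by (simp add: H1_def)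
  have "L (window_S1 I q \<phi> A u) = (\<Sum>i<q. (LINT r|lborel. \<phi> i (u - r) * indicator I r * L (A i)))"
    unfolding window_S1_def L window_def by simp
  also have "\<dots> = (LINT r|lborel. (\<Sum>i<q. \<phi> i (u - r) * indicator I r * L (A i)))"
    using int by (intro Bochner_Integration.integral_sum [symmetric]) auto
  also have "\<dots> = (LINT r|lborel. L (m (u - r)) * indicator I r)"
    unfolding m_eq L by (simp add: sum_distrib_left sum_distrib_right mult_ac)
  finally show ?thesis .
qed

lemma tr_window_S1:
  assumes G: "clinear_op G" and I: "I \<in> sets borel"
  shows "tr (G o\<^sub>L window_S1 I q \<phi> A u) = (LINT r|lborel. tr (G o\<^sub>L m (u - r)) * indicator I r)"
proof (rule window_S1_functional [OF _ I])
  fix c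
  have "tr (G o\<^sub>L (\<Sum>i<q. cscale_op (c i) (A i))) = (\<Sum>i<q. tr (G o\<^sub>L cscale_op (c i) (A i)))"
    using A by (intro tr_sum_right G) auto
  then show "tr (G o\<^sub>L (\<Sum>i<q. cscale_op (c i) (A i))) = (\<Sum>i<q. c i * tr (G o\<^sub>L A i))"
    using A G by (simp add: tr_cscale_right)
qed

lemma tn_m_integrable: "integrable lborel (\<lambda>r. tn (m (u - r)) * indicator I r)" if I: "I \<in> sets borel"
proof -
  have i: "integrable lborel (\<lambda>r. tn (m (u - r)))"
    using m_L1 by (intro integrable_reflect(1)) (simp add: L1_S1_iff)
  show ?thesis using I by (intro integrable_real_mult_indicator i) simp
qed

lemma tn_m_reflect: "(LINT r|lborel. tn (m (u - r))) = L1_norm m"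
  using integrable_reflect(2) [of "\<lambda>r. tn (m r)" u] m_L1 by (simp add: L1_norm_eq L1_S1_iff)

lemma sum_tn_m_le:
  fixes I :: "nat \<Rightarrow> real set"
  assumes I: "\<And>j. I j \<in> sets borel" and disj: "disjoint_family I"
  shows "(\<Sum>j<J. (LINT r|lborel. tn (m (u - r)) * indicator (I j) r)) \<le> L1_norm m"
proof -
  have "(\<Sum>j<J. (LINT r|lborel. tn (m (u - r)) * indicator (I j) r))
      = (LINT r|lborel. (\<Sum>j<J. tn (m (u - r)) * indicator (I j) r))"
    using tn_m_integrable I by (intro Bochner_Integration.integral_sum [symmetric]) auto
  also have "\<dots> \<le> (LINT r|lborel. tn (m (u - r)))"
  proof (rule integral_mono)
    show "integrable lborel (\<lambda>r. \<Sum>j<J. tn (m (u - r)) * indicator (I j) r)"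
      using tn_m_integrable I by (intro Bochner_Integration.integrable_sum) auto
    show "integrable lborel (\<lambda>r. tn (m (u - r)))" using tn_m_integrable [of UNIV u] by simp
    fix r
    have "(\<Sum>j<J. indicator (I j) r :: real) = indicator (\<Union>j<J. I j) r"
      using disj by (intro indicator_UN_disjoint [symmetric]) (auto intro: disjoint_family_on_mono)
    also have "\<dots> \<le> 1" by (simp add: indicator_def)
    finally have "tn (m (u - r)) * (\<Sum>j<J. indicator (I j) r) \<le> tn (m (u - r)) * 1"
      by (intro mult_left_mono) auto
    then show "(\<Sum>j<J. tn (m (u - r)) * indicator (I j) r) \<le> tn (m (u - r))"
      by (simp add: sum_distrib_left)
  qed
  finally show ?thesis by (simp only: tn_m_reflect)
qed

text \<open>Minkowski's integral inequality for the trace norm, by duality: every diagonal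
  functional \<open>L\<close> against a contraction satisfies \<open>cmod (L T) \<le> tn T\<close>
  and may be moved inside the integral.\<close>

lemma tn_window_S1:
  assumes I: "I \<in> sets borel"
  shows "tn (window_S1 I q \<phi> A u) \<le> (LINT r|lborel. tn (m (u - r)) * indicator I r)"
proof -
  let ?t = "LINT r|lborel. tn (m (u - r)) * indicator I r"
  have "trace_norm (window_S1 I q \<phi> A u) \<le> ennreal ?t"
  proof (rule trace_norm_leI)
    show "clinear_op (window_S1 I q \<phi> A u)" by (rule S_one_clinear [OF window_S1_S_one])
    fix Z :: oper and N assume Z: "clinear_op Z" "norm Z \<le> 1"
    define L where "L T = (\<Sum>n<N. cinner (Z (T (ket n))) (ket n))" for T :: oper
    have Le: "cmod (L T) \<le> tn T" if T: "T \<in> S_one" for T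
    proof -
      have "ennreal (cmod (L T)) \<le> ennreal (\<Sum>n<N. cmod (cinner (Z (T (ket n))) (ket n)))"
        unfolding L_def by (intro ennreal_leI norm_sum)
      also have "\<dots> \<le> ennreal (tn T)"
        using trace_pairing_le [OF S_one_clinear [OF T] Z] by (simp add: trace_norm_tn T)
      finally show ?thesis by simp
    qed
    have "L (\<Sum>i<q. cscale_op (c i) (A i)) = (\<Sum>i<q. c i * L (A i))" for c
      unfolding L_def
      by (simp add: blinfun.sum_left blinfun.sum_right coord_sum clinear_opD [OF Z(1)] sum_distrib_left)
        (rule sum.swap)
    from window_S1_functional [of L, OF this I]
    have "cmod (L (window_S1 I q \<phi> A u)) \<le> (LINT r|lborel. cmod (L (m (u - r)) * indicator I r))"
      by simp
    also have "\<dots> \<le> ?t"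
    proof (rule integral_mono')
      show "integrable lborel (\<lambda>r. tn (m (u - r)) * indicator I r)" by (rule tn_m_integrable [OF I])
      show "cmod (L (m (u - r)) * indicator I r) \<le> tn (m (u - r)) * indicator I r" for r
        using Le [OF m_S_one] by (simp add: norm_mult indicator_def)
    qed (simp add: indicator_def)
    finally show "ennreal (cmod (\<Sum>n<N. cinner (Z (window_S1 I q \<phi> A u (ket n))) (ket n))) \<le> ennreal ?t"
      unfolding L_def by (rule ennreal_leI)
  qed
  moreover have "0 \<le> ?t" by (intro integral_nonneg_AE AE_I2) (simp add: indicator_def)
  ultimately show ?thesis by (simp add: trace_norm_tn [OF window_S1_S_one])
qed

end

locale tensor_pair = m: tensor_sum q \<phi> A m + h: tensor_sum p \<psi> B h
  for q \<phi> A m p \<psi> B h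
begin

text \<open>The point where analyticity of products enters: expanding both sums leaves scalar
  coefficients that are products of an \<open>H1\<close> function and a window, handled by
  \<open>H1_mult_window\<close>.\<close>

lemma tens_window_tensor:
  assumes I: "I \<in> sets borel"
  shows "(\<lambda>u. h u \<otimes>\<^sub>o window_S1 I q \<phi> A u) \<in> H1_tensor_S1"
proof -
  have "h u \<otimes>\<^sub>o window_S1 I q \<phi> A u
      = (\<Sum>(j, i)\<in>{..<q} \<times> {..<p}. cscale_op (\<psi> i u * window I (\<phi> j) u) (B i \<otimes>\<^sub>o A j))" for u
    unfolding h.m_eq window_S1_def tens_op.sum_left tens_op.sum_right sum.cartesian_product
    using h.A m.A by (intro sum.cong) (auto simp: tens_cscale_op S_one_clinear)
  moreover have "(\<lambda>u. \<Sum>ji\<in>{..<q} \<times> {..<p}. cscale_op ((case ji of (j, i) \<Rightarrow> \<lambda>u. \<psi> i u * window I (\<phi> j) u) u)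
      (case ji of (j, i) \<Rightarrow> B i \<otimes>\<^sub>o A j)) \<in> H1_tensor_S1"
    using h.A m.A h.\<phi> m.\<phi> I by (intro H1_tensor_S1_sum) (auto intro: H1_mult_window)
  ultimately show ?thesis by (simp add: case_prod_unfold)
qed

text \<open>Cutting the line into cells costs nothing: at each \<open>u\<close> the trace norms of
  the windows over disjoint sets add up to at most \<open>L1_norm m\<close>, and \<open>tn\<close>
  is multiplicative under tensor products. Integration in \<open>u\<close> does the rest.\<close>

lemma sum_L1_norm_tens_window:
  fixes I :: "nat \<Rightarrow> real set"
  assumes I: "\<And>j. I j \<in> sets borel" and disj: "disjoint_family I"
  shows "(\<Sum>j<J. L1_norm (\<lambda>u. h u \<otimes>\<^sub>o window_S1 (I j) q \<phi> A u)) \<le> L1_norm h * L1_norm m"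
proof -
  let ?w = "\<lambda>j u. window_S1 (I j) q \<phi> A u"
  have L1: "(\<lambda>u. h u \<otimes>\<^sub>o ?w j u) \<in> L1_S1" for j by (rule H1_tensor_S1_L1 [OF tens_window_tensor [OF I]])
  have "(\<Sum>j<J. L1_norm (\<lambda>u. h u \<otimes>\<^sub>o ?w j u)) = (\<Sum>j<J. (LINT u|lborel. tn (h u \<otimes>\<^sub>o ?w j u)))"
    by (simp add: L1_norm_eq [OF L1])
  also have "\<dots> = (LINT u|lborel. (\<Sum>j<J. tn (h u \<otimes>\<^sub>o ?w j u)))"
    using L1 by (intro Bochner_Integration.integral_sum [symmetric]) (auto simp: L1_S1_iff)
  also have "\<dots> \<le> (LINT u|lborel. tn (h u) * L1_norm m)"
  proof (rule integral_mono)
    show "integrable lborel (\<lambda>u. \<Sum>j<J. tn (h u \<otimes>\<^sub>o ?w j u))" using L1 by (auto simp: L1_S1_iff)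
    show "integrable lborel (\<lambda>u. tn (h u) * L1_norm m)" using h.m_L1 by (simp add: L1_S1_iff)
    fix u
    have "(\<Sum>j<J. tn (?w j u)) \<le> (\<Sum>j<J. (LINT r|lborel. tn (m (u - r)) * indicator (I j) r))"
      by (intro sum_mono m.tn_window_S1 I)
    also have "\<dots> \<le> L1_norm m" by (rule m.sum_tn_m_le [OF I disj])
    finally have "(\<Sum>j<J. tn (?w j u)) \<le> L1_norm m" .
    then show "(\<Sum>j<J. tn (h u \<otimes>\<^sub>o ?w j u)) \<le> tn (h u) * L1_norm m"
      by (simp add: tn_tens h.m_S_one m.window_S1_S_one mult_left_mono flip: sum_distrib_left)
  qed
  also have "\<dots> = L1_norm h * L1_norm m" using h.m_L1 by (simp add: L1_norm_eq)
  finally show ?thesis .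
qed

text \<open>With \<open>I\<^sub>j = \<iota>\<^sup>-\<^sup>1 {j}\<close>, the integral is the sum over \<open>j\<close> of the convolutions of \<open>f \<otimes> \<Gamma>\<^sub>j\<close> with the
  product of \<open>h\<close> and the window of \<open>m\<close> over \<open>I\<^sub>j\<close>; the \<open>L\<^sup>1\<close> norms of these products add up to at most that of
  \<open>h\<close> times that of \<open>m\<close>, because the \<open>I\<^sub>j\<close> are disjoint.\<close>

lemma A0_le_step:
  assumes f: "f \<in> C0_Sinf" and \<Gamma>: "\<And>j. \<Gamma> j \<in> C0_Sinf" "\<And>j. sup_norm (\<Gamma> j) \<le> \<kappa>"
    and \<iota>: "\<iota> \<in> borel \<rightarrow>\<^sub>M count_space (UNIV :: nat set)"
  defines "avg \<equiv> \<lambda>s t. LINT r|lborel. tr (\<Gamma> (\<iota> r) t o\<^sub>L m (s - t - r))"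
  shows "integrable lborel (\<lambda>r. tr (\<Gamma> (\<iota> r) t o\<^sub>L m (u - r)))"
    and "integrable lborel (\<lambda>t. tr (f t o\<^sub>L h (s - t)) * avg s t)"
    and "A0_le (\<lambda>s. LINT t|lborel. tr (f t o\<^sub>L h (s - t)) * avg s t) (sup_norm f * \<kappa> * (L1_norm h * L1_norm m))"
proof -
  define I where "I j = \<iota> -` {j}" for j
  have I: "I j \<in> sets borel" for j using measurable_sets [OF \<iota>, of "{j}"] by (simp add: I_def)
  have disj: "disjoint_family I" by (auto simp: disjoint_family_on_def I_def)
  have \<kappa>: "0 \<le> \<kappa>" using sup_norm_nonneg [OF \<Gamma>(1)] \<Gamma>(2) order_trans by blast
  note cl = C0_Sinf_clinear [OF \<Gamma>(1)] C0_Sinf_clinear [OF f]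
  let ?w = "\<lambda>j u. window_S1 (I j) q \<phi> A u"
  let ?F = "\<lambda>j t. f t \<otimes>\<^sub>o \<Gamma> j t" and ?H = "\<lambda>j u. h u \<otimes>\<^sub>o ?w j u"
  have F: "?F j \<in> C0_Sinf" "sup_norm (?F j) \<le> sup_norm f * \<kappa>" for j
    using C0_Sinf_tens [OF f \<Gamma>(1)] mult_left_mono [OF \<Gamma>(2) sup_norm_nonneg [OF f]] by (auto intro: order_trans)
  have H: "?H j \<in> H1_S1" "?H j \<in> L1_S1" for j
    using tens_window_tensor [OF I] by (auto intro: H1_tensor_S1_H1_S1 H1_tensor_S1_L1)
  have cost: "sup_norm (?F j) * L1_norm (?H j) \<le> sup_norm f * \<kappa> * L1_norm (?H j)" for j
    by (intro mult_right_mono F) simp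
  have sumH: "summable (\<lambda>j. L1_norm (?H j))"
    using sum_L1_norm_tens_window [OF I disj] by (intro summableI_nonneg_bounded) auto
  have sumH_le: "(\<Sum>j. L1_norm (?H j)) \<le> L1_norm h * L1_norm m"
    by (intro suminf_le_const sumH sum_L1_norm_tens_window I disj)
  have cost_sum: "summable (\<lambda>j. sup_norm f * \<kappa> * L1_norm (?H j))" by (rule summable_mult [OF sumH])
  \<comment> \<open>For each \<open>r\<close> only the cell \<open>j = \<iota> r\<close>
    contributes. The trivial series is written out in order to exchange it with the integral over
    \<open>r\<close>.\<close>
  have g_sums: "(\<lambda>j. tr (\<Gamma> j t o\<^sub>L m (u - r)) * indicator (I j) r) sums tr (\<Gamma> (\<iota> r) t o\<^sub>L m (u - r))"
    and g_norm: "summable (\<lambda>j. norm (tr (\<Gamma> j t o\<^sub>L m (u - r)) * indicator (I j) r))" for t u r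
  proof -
    have "(\<lambda>j. tr (\<Gamma> j t o\<^sub>L m (u - r)) * indicator (I j) r)
        = (\<lambda>j. if j = \<iota> r then tr (\<Gamma> j t o\<^sub>L m (u - r)) else 0)"
      by (auto simp: I_def indicator_def)
    then show "(\<lambda>j. tr (\<Gamma> j t o\<^sub>L m (u - r)) * indicator (I j) r) sums tr (\<Gamma> (\<iota> r) t o\<^sub>L m (u - r))"
      using sums_single [of "\<iota> r" "\<lambda>j. tr (\<Gamma> j t o\<^sub>L m (u - r))"] by simp
    show "summable (\<lambda>j. norm (tr (\<Gamma> j t o\<^sub>L m (u - r)) * indicator (I j) r))"
      by (rule summable_finite [of "{\<iota> r}"]) (auto simp: I_def indicator_def)
  qed
  have g_int: "integrable lborel (\<lambda>r. tr (\<Gamma> j t o\<^sub>L m (u - r)) * indicator (I j) r)" for j t u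
    using integrable_tr_reflect [OF cl(1) m.m_L1, of j t u] I
      borel_measurable_integrable [OF integrable_tr_reflect [OF cl(1) m.m_L1, of j t u]]
    by (intro Bochner_Integration.integrable_bound [OF integrable_tr_reflect [OF cl(1) m.m_L1, of j t u]])
      (auto simp: indicator_def)
  have g_int_le: "(LINT r|lborel. norm (tr (\<Gamma> j t o\<^sub>L m (u - r)) * indicator (I j) r))
      \<le> \<kappa> * (LINT r|lborel. tn (m (u - r)) * indicator (I j) r)" for j t u
  proof -
    have "(LINT r|lborel. norm (tr (\<Gamma> j t o\<^sub>L m (u - r)) * indicator (I j) r))
        \<le> (LINT r|lborel. \<kappa> * (tn (m (u - r)) * indicator (I j) r))"
    proof (rule integral_mono)
      have "cmod (tr (\<Gamma> j t o\<^sub>L m v)) \<le> \<kappa> * tn (m v)" for v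
        using norm_le_sup_norm [OF \<Gamma>(1), of j t] \<Gamma>(2) [of j]
        by (intro order_trans [OF cmod_tr_le [OF m.m_S_one cl(1)]] mult_right_mono) auto
      then show "norm (tr (\<Gamma> j t o\<^sub>L m (u - r)) * indicator (I j) r) \<le> \<kappa> * (tn (m (u - r)) * indicator (I j) r)" for r
        by (simp add: indicator_def)
    qed (use g_int m.tn_m_integrable [OF I] in auto)
    then show ?thesis by simp
  qed
  have g_int_sum: "summable (\<lambda>j. LINT r|lborel. norm (tr (\<Gamma> j t o\<^sub>L m (u - r)) * indicator (I j) r))" for t u
  proof (rule summable_comparison_test')
    have "summable (\<lambda>j. LINT r|lborel. tn (m (u - r)) * indicator (I j) r)"
      using m.sum_tn_m_le [OF I disj]
      by (intro summableI_nonneg_bounded integral_nonneg_AE AE_I2) (auto simp: indicator_def)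
    then show "summable (\<lambda>j. \<kappa> * (LINT r|lborel. tn (m (u - r)) * indicator (I j) r))"
      by (rule summable_mult)
  qed (use g_int_le in simp)
  show "integrable lborel (\<lambda>r. tr (\<Gamma> (\<iota> r) t o\<^sub>L m (u - r)))" for t u
    using integrable_suminf [OF g_int AE_I2 [OF g_norm] g_int_sum, of t u] sums_unique [OF g_sums] by simp
  have avg_sums: "(\<lambda>j. tr (\<Gamma> j t o\<^sub>L ?w j (s - t))) sums avg s t" for s t
    using sums_integral [OF g_int AE_I2 [OF g_norm] g_int_sum, of t "s - t"] sums_unique [OF g_sums]
    unfolding avg_def by (simp add: m.tr_window_S1 cl I)
  have avg_norm: "summable (\<lambda>j. norm (tr (\<Gamma> j t o\<^sub>L ?w j u)))" for t u
    by (rule summable_comparison_test' [OF g_int_sum [of t u]])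
      (use integral_norm_bound in \<open>auto simp: m.tr_window_S1 cl I\<close>)
  have eq: "tr (?F j t o\<^sub>L ?H j (s - t)) = tr (f t o\<^sub>L h (s - t)) * tr (\<Gamma> j t o\<^sub>L ?w j (s - t))" for j s t
    by (rule tr_tens) (auto intro: cl h.m_S_one m.window_S1_S_one)
  have o_int: "integrable lborel (\<lambda>t. tr (?F j t o\<^sub>L ?H j (s - t)))" for j s
    by (rule conv_integrand(1) [OF F(1) H(2)])
  have o_sums: "(\<lambda>j. tr (?F j t o\<^sub>L ?H j (s - t))) sums (tr (f t o\<^sub>L h (s - t)) * avg s t)" for s t
    unfolding eq by (rule sums_mult [OF avg_sums])
  have o_norm: "summable (\<lambda>j. norm (tr (?F j t o\<^sub>L ?H j (s - t))))" for s t
    unfolding eq norm_mult by (rule summable_mult [OF avg_norm])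
  \<comment> \<open>The second exchange, with the integral over \<open>t\<close>, rests on the
    summable costs supplied by \<open>sum_L1_norm_tens_window\<close>.\<close>
  have o_int_sum: "summable (\<lambda>j. LINT t|lborel. norm (tr (?F j t o\<^sub>L ?H j (s - t))))" for s
    by (rule summable_comparison_test' [OF cost_sum])
      (use order_trans [OF conv_integrand_norm [OF F(1) H(2)] cost] in simp)
  show "integrable lborel (\<lambda>t. tr (f t o\<^sub>L h (s - t)) * avg s t)"
    using integrable_suminf [OF o_int AE_I2 [OF o_norm] o_int_sum, of s] sums_unique [OF o_sums] by simp
  have "A0_le (\<lambda>s. LINT t|lborel. tr (f t o\<^sub>L h (s - t)) * avg s t) (\<Sum>j. sup_norm f * \<kappa> * L1_norm (?H j))"
  proof (rule A0_le_suminf [OF _ cost_sum])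
    show "A0_le (conv (?F j) (?H j)) (sup_norm f * \<kappa> * L1_norm (?H j))" for j
      by (rule A0_le_mono [OF A0_le_conv [OF F(1) H(1)] cost])
    show "(\<lambda>j. conv (?F j) (?H j) s) sums (LINT t|lborel. tr (f t o\<^sub>L h (s - t)) * avg s t)" for s
      using sums_integral [OF o_int AE_I2 [OF o_norm] o_int_sum, of s] sums_unique [OF o_sums]
      unfolding conv_def by simp
  qed
  then show "A0_le (\<lambda>s. LINT t|lborel. tr (f t o\<^sub>L h (s - t)) * avg s t) (sup_norm f * \<kappa> * (L1_norm h * L1_norm m))"
    using sumH_le \<kappa> sup_norm_nonneg [OF f] suminf_mult [OF sumH, of "sup_norm f * \<kappa>"]
    by (elim A0_le_mono) (simp add: mult_left_mono)
qed

end

section \<open>Refinement of the grid\<close>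

lemma norm_lebesgue_integral_le:
  fixes f :: "'a \<Rightarrow> 'b :: {banach, second_countable_topology}"
  assumes "integrable M f" "integrable M g" "\<And>x. norm (f x) \<le> g x"
  shows "norm (integral\<^sup>L M f) \<le> integral\<^sup>L M g"
  by (rule order_trans [OF integral_norm_bound]) (intro integral_mono integrable_norm assms)

definition grid :: "nat \<Rightarrow> real \<Rightarrow> real"
  where "grid n r = of_int \<lfloor>real (Suc n) * r\<rfloor> / real (Suc n)"

lemma grid_dist: "\<bar>grid n r - r\<bar> \<le> 1 / real (Suc n)"
proof -
  have "\<bar>of_int \<lfloor>real (Suc n) * r\<rfloor> - real (Suc n) * r\<bar> \<le> 1" by linarith
  then have "\<bar>(of_int \<lfloor>real (Suc n) * r\<rfloor> - real (Suc n) * r) / real (Suc n)\<bar> \<le> 1 / real (Suc n)"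
    by (simp add: abs_divide divide_right_mono)
  moreover have "(of_int \<lfloor>real (Suc n) * r\<rfloor> - real (Suc n) * r) / real (Suc n) = grid n r - r"
    by (simp add: grid_def diff_divide_distrib)
  ultimately show ?thesis by (simp only:)
qed

context tensor_pair
begin

text \<open>\<open>F G = \<integral> conv (f \<otimes> g(\<cdot> + r)) (h \<otimes> m(\<cdot> - r)) dr\<close> is approximated by rounding \<open>r\<close> to a grid in \<open>g\<close> only.\<close>

lemma A0_le_conv_mult_tensor:
  assumes f: "f \<in> C0_Sinf" and g: "g \<in> C0_Sinf"
  shows "A0_le (\<lambda>s. conv f h s * conv g m s) ((sup_norm f * L1_norm h) * (sup_norm g * L1_norm m))"
proof -
  define \<iota> where "\<iota> n r = int_encode \<lfloor>real (Suc n) * r\<rfloor>" for n r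
  have \<iota>: "\<iota> n \<in> borel \<rightarrow>\<^sub>M count_space UNIV" for n unfolding \<iota>_def by measurable
  define \<Gamma> where "\<Gamma> n j t = g (t + of_int (int_decode j) / real (Suc n))" for n j t
  have \<Gamma>: "\<Gamma> n j \<in> C0_Sinf" "sup_norm (\<Gamma> n j) \<le> sup_norm g" for n j
    unfolding \<Gamma>_def [abs_def] by (auto intro!: C0_Sinf_shift sup_norm_leI norm_le_sup_norm g)
  have \<Gamma>\<iota>: "\<Gamma> n (\<iota> n r) t = g (t + grid n r)" for n r t by (simp add: \<Gamma>_def \<iota>_def grid_def)
  define X where "X n s = (LINT t|lborel. tr (f t o\<^sub>L h (s - t)) *
      (LINT r|lborel. tr (g (t + grid n r) o\<^sub>L m (s - t - r))))" for n s
  define C where "C = sup_norm f * (L1_norm h * L1_norm m)"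
  have C: "0 \<le> C" by (simp add: C_def sup_norm_nonneg f)
  note clg = C0_Sinf_clinear [OF g] and clf = C0_Sinf_clinear [OF f]
  have avg_int: "integrable lborel (\<lambda>r. tr (g (t + grid n r) o\<^sub>L m (u - r)))" for n t u
    using A0_le_step(1) [of f "\<Gamma> n" "sup_norm g" "\<iota> n", OF f \<Gamma> \<iota>, where t = t and u = u] by (simp only: \<Gamma>\<iota>)
  have X_int: "integrable lborel (\<lambda>t. tr (f t o\<^sub>L h (s - t)) *
      (LINT r|lborel. tr (g (t + grid n r) o\<^sub>L m (s - t - r))))" for n s
    using A0_le_step(2) [of f "\<Gamma> n" "sup_norm g" "\<iota> n", OF f \<Gamma> \<iota>, where s = s] by (simp only: \<Gamma>\<iota>)
  have X_le: "A0_le (X n) (C * sup_norm g)" for n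
    using A0_le_step(3) [of f "\<Gamma> n" "sup_norm g" "\<iota> n", OF f \<Gamma> \<iota>] by (simp only: \<Gamma>\<iota> X_def [abs_def] C_def mult_ac)
  have unif: "\<exists>N. \<forall>n\<ge>N. \<forall>r t. norm (g (t + grid n r) - g (t + r)) < e" if e: "e > 0" for e
  proof -
    obtain d where d: "d > 0" "\<And>x y. \<bar>x - y\<bar> < d \<Longrightarrow> norm (g x - g y) < e"
      using C0_Sinf_uniformly_continuous [OF g e] by blast
    obtain N where N: "1 / real (Suc N) < d" using d(1) nat_approx_posE by blast
    have "norm (g (t + grid n r) - g (t + r)) < e" if "n \<ge> N" for n r t
    proof (rule d(2))
      have "1 / real (Suc n) \<le> 1 / real (Suc N)" using that by (simp add: frac_le)
      then show "\<bar>t + grid n r - (t + r)\<bar> < d" using grid_dist [of n r] N by simp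
    qed
    then show ?thesis by blast
  qed
  have diff: "A0_le (\<lambda>s. X n s - X k s) (C * e)"
    if e: "0 \<le> e" and le: "\<And>r t. norm (g (t + grid n r) - g (t + grid k r)) \<le> e" for n k e
  proof -
    define \<iota>' where "\<iota>' r = prod_encode (\<iota> n r, \<iota> k r)" for r
    \<comment> \<open>\<open>\<iota>'\<close> indexes the common refinement of the two grids. The
      bound \<open>e\<close> is known only for pairs of grid points arising from one
      \<open>r\<close>, so other codes \<open>j\<close> are given the zero function to keep the
      supremum norm below \<open>e\<close> for all \<open>j\<close>.\<close>
    define \<Gamma>' where "\<Gamma>' j = (if j \<in> range \<iota>' then (\<lambda>t. \<Gamma> n (fst (prod_decode j)) t - \<Gamma> k (snd (prod_decode j)) t)
      else (\<lambda>_. 0))" for j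
    have \<iota>'m: "\<iota>' \<in> borel \<rightarrow>\<^sub>M count_space UNIV"
      unfolding \<iota>'_def \<iota>_def by measurable
    have \<Gamma>'\<iota>: "\<Gamma>' (\<iota>' r) t = g (t + grid n r) - g (t + grid k r)" for r t
      by (simp add: \<Gamma>'_def) (simp add: \<iota>'_def \<Gamma>\<iota>)
    have \<Gamma>'C: "\<Gamma>' j \<in> C0_Sinf" for j
      by (auto simp: \<Gamma>'_def C0_Sinf_0 intro!: C0_Sinf_diff \<Gamma>)
    have \<Gamma>'s: "sup_norm (\<Gamma>' j) \<le> e" for j
    proof (rule sup_norm_leI)
      show "norm (\<Gamma>' j t) \<le> e" for t
      proof (cases "j \<in> range \<iota>'")
        case True
        then obtain r where "j = \<iota>' r" by blast
        then show ?thesis using le by (simp add: \<Gamma>'\<iota>)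
      qed (simp add: \<Gamma>'_def e)
    qed
    have "tr ((g (t + grid n r) - g (t + grid k r)) o\<^sub>L m u)
        = tr (g (t + grid n r) o\<^sub>L m u) - tr (g (t + grid k r) o\<^sub>L m u)" for t r u
      by (rule tr_diff_left [OF m.m_S_one clg clg])
    then have "(LINT t|lborel. tr (f t o\<^sub>L h (s - t)) * (LINT r|lborel. tr (\<Gamma>' (\<iota>' r) t o\<^sub>L m (s - t - r)))) = X n s - X k s" for s
      using avg_int X_int unfolding X_def \<Gamma>'\<iota> by (simp add: right_diff_distrib)
    then show ?thesis
      using A0_le_step(3) [of f \<Gamma>' e \<iota>', OF f \<Gamma>'C \<Gamma>'s \<iota>'m] by (simp only: C_def mult_ac)
  qed
  have scale: "\<exists>e'>0. C * e' < e" if "e > 0" for e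
  proof -
    \<comment> \<open>The denominator \<open>C + 1\<close> covers \<open>C = 0\<close>.\<close>
    have "C * (e / (C + 1)) < e" using that C by (simp add: pos_divide_less_eq add_nonneg_pos algebra_simps)
    moreover have "e / (C + 1) > 0" using that C by (simp add: add_nonneg_pos)
    ultimately show ?thesis by blast
  qed
  have "A0_le (\<lambda>s. conv f h s * conv g m s) (C * sup_norm g)"
  proof (rule A0_le_limit [OF X_le])
    fix e :: real assume "e > 0"
    then obtain e' where e': "e' > 0" "C * e' < e" using scale by blast
    obtain N where N: "\<And>n r t. n \<ge> N \<Longrightarrow> norm (g (t + grid n r) - g (t + r)) < e'/2"
      using unif [of "e'/2"] e'(1) by auto
    have "A0_le (\<lambda>s. X n s - X k s) e" if "n \<ge> N" "k \<ge> N" for n k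
    proof (rule A0_le_mono [OF diff])
      fix r t
      have "g (t + grid n r) - g (t + grid k r) = (g (t + grid n r) - g (t + r)) - (g (t + grid k r) - g (t + r))" by simp
      then have "norm (g (t + grid n r) - g (t + grid k r)) \<le> norm (g (t + grid n r) - g (t + r)) + norm (g (t + grid k r) - g (t + r))"
        by (simp only: norm_triangle_ineq4)
      then show "norm (g (t + grid n r) - g (t + grid k r)) \<le> e'"
        using N [OF that(1), of t r] N [OF that(2), of t r] by simp
    qed (use e' in auto)
    then show "\<exists>N. \<forall>n\<ge>N. \<forall>k\<ge>N. A0_le (\<lambda>s. X n s - X k s) e" by blast
  next
    fix s
    \<comment> \<open>Without rounding, the substitution by \<open>t + r\<close> shows that the
      inner integral does not depend on \<open>t\<close>; this is why it factors out of the outer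
      one.\<close>
    have g_shift: "integrable lborel (\<lambda>r. tr (g (t + r) o\<^sub>L m (s - t - r)))"
      "(LINT r|lborel. tr (g (t + r) o\<^sub>L m (s - t - r))) = conv g m s" for t
      using lborel_integrable_real_affine [OF conv_integrand(1) [OF g m.m_L1, of s], of 1 t]
        lborel_integral_real_affine [of 1 "\<lambda>t. tr (g t o\<^sub>L m (s - t))" t]
      by (simp_all add: conv_def diff_diff_eq)
    have f_int: "integrable lborel (\<lambda>t. tr (f t o\<^sub>L h (s - t)))" by (rule conv_integrand(1) [OF f h.m_L1])
    show "(\<lambda>n. X n s) \<longlonglongrightarrow> conv f h s * conv g m s"
    proof (rule LIMSEQ_I)
      fix e :: real assume "e > 0"
      then obtain e' where e': "e' > 0" "C * e' < e" using scale by blast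
      obtain N where N: "\<And>n r t. n \<ge> N \<Longrightarrow> norm (g (t + grid n r) - g (t + r)) < e'"
        using unif [OF e'(1)] by blast
      have "norm (X n s - conv f h s * conv g m s) < e" if n: "n \<ge> N" for n
      proof -
        let ?J = "\<lambda>t. LINT r|lborel. tr (g (t + grid n r) o\<^sub>L m (s - t - r))"
        \<comment> \<open>The rounded inner integral is close to the constant
          \<open>conv g m s\<close> uniformly in \<open>t\<close>, so the outer integral preserves
          the estimate.\<close>
        have J: "cmod (?J t - conv g m s) \<le> e' * L1_norm m" for t
        proof -
          have "?J t - conv g m s = (LINT r|lborel. tr (g (t + grid n r) o\<^sub>L m (s - t - r)) - tr (g (t + r) o\<^sub>L m (s - t - r)))"
            using avg_int g_shift by simp
          also have "cmod \<dots> \<le> (LINT r|lborel. e' * tn (m (s - t - r)))"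
          proof (rule norm_lebesgue_integral_le)
            show "integrable lborel (\<lambda>r. tr (g (t + grid n r) o\<^sub>L m (s - t - r)) - tr (g (t + r) o\<^sub>L m (s - t - r)))"
              by (intro Bochner_Integration.integrable_diff avg_int g_shift)
            show "integrable lborel (\<lambda>r. e' * tn (m (s - t - r)))"
              using m.tn_m_integrable [of UNIV] by simp
            fix r
            show "cmod (tr (g (t + grid n r) o\<^sub>L m (s - t - r)) - tr (g (t + r) o\<^sub>L m (s - t - r))) \<le> e' * tn (m (s - t - r))"
              unfolding tr_diff_left [OF m.m_S_one clg clg, symmetric]
              using N [OF n, of t r]
              by (intro order_trans [OF cmod_tr_le [OF m.m_S_one clinear_op_intros(5) [OF clg clg]]] mult_right_mono) auto
          qed
          also have "\<dots> = e' * L1_norm m" by (simp add: m.tn_m_reflect)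
          finally show ?thesis .
        qed
        have "X n s - conv f h s * conv g m s
            = X n s - (LINT t|lborel. tr (f t o\<^sub>L h (s - t)) * conv g m s)" by (simp add: conv_def)
        also have "\<dots> = (LINT t|lborel. tr (f t o\<^sub>L h (s - t)) * ?J t - tr (f t o\<^sub>L h (s - t)) * conv g m s)"
          unfolding X_def by (intro Bochner_Integration.integral_diff [symmetric] X_int integrable_mult_left f_int)
        finally have eq: "X n s - conv f h s * conv g m s
            = (LINT t|lborel. tr (f t o\<^sub>L h (s - t)) * ?J t - tr (f t o\<^sub>L h (s - t)) * conv g m s)" .
        have "cmod (X n s - conv f h s * conv g m s) \<le> (LINT t|lborel. cmod (tr (f t o\<^sub>L h (s - t))) * (e' * L1_norm m))"
          unfolding eq
        proof (rule norm_lebesgue_integral_le)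
          show "integrable lborel (\<lambda>t. tr (f t o\<^sub>L h (s - t)) * ?J t - tr (f t o\<^sub>L h (s - t)) * conv g m s)"
            by (intro Bochner_Integration.integrable_diff X_int integrable_mult_left f_int)
          show "integrable lborel (\<lambda>t. cmod (tr (f t o\<^sub>L h (s - t))) * (e' * L1_norm m))"
            by (intro integrable_mult_left integrable_norm f_int)
          show "cmod (tr (f t o\<^sub>L h (s - t)) * ?J t - tr (f t o\<^sub>L h (s - t)) * conv g m s)
              \<le> cmod (tr (f t o\<^sub>L h (s - t))) * (e' * L1_norm m)" for t
            unfolding right_diff_distrib [symmetric] norm_mult by (intro mult_left_mono J) simp
        qed
        also have "\<dots> = (LINT t|lborel. cmod (tr (f t o\<^sub>L h (s - t)))) * (e' * L1_norm m)" by (rule integral_mult_left_zero)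
        also have "\<dots> \<le> (sup_norm f * L1_norm h) * (e' * L1_norm m)"
          using e'(1) by (intro mult_right_mono conv_integrand_norm f h.m_L1) auto
        also have "\<dots> = C * e'" by (simp add: C_def)
        finally show ?thesis using e'(2) by simp
      qed
      then show "\<exists>N. \<forall>n\<ge>N. norm (X n s - conv f h s * conv g m s) < e" by blast
    qed
  qed
  then show ?thesis by (simp add: C_def mult_ac)
qed

end

section \<open>From finite tensors to all of \<open>H1_S1\<close>\<close>

lemma A0_le_conv_mult_H1_tensor_S1:
  assumes "f \<in> C0_Sinf" "g \<in> C0_Sinf" "h \<in> H1_tensor_S1" "m \<in> H1_tensor_S1"
  shows "A0_le (\<lambda>s. conv f h s * conv g m s) ((sup_norm f * L1_norm h) * (sup_norm g * L1_norm m))"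
proof -
  obtain q \<phi> A where m: "tensor_sum q \<phi> A m"
    using assms(4) unfolding H1_tensor_S1_iff tensor_sum_def by blast
  obtain p \<psi> B where h: "tensor_sum p \<psi> B h"
    using assms(3) unfolding H1_tensor_S1_iff tensor_sum_def by blast
  interpret tensor_pair q \<phi> A m p \<psi> B h using m h by (rule tensor_pair.intro)
  show ?thesis by (rule A0_le_conv_mult_tensor [OF assms(1,2)])
qed

lemma H1_S1_approx_seq:
  assumes h: "h \<in> H1_S1" and d: "d > 0"
  obtains G where "\<And>n. G n \<in> H1_tensor_S1" "\<And>n::nat. L1_norm (\<lambda>t. h t - G n t) < d / real (Suc n)"
proof -
  have "\<exists>g. g \<in> H1_tensor_S1 \<and> L1_norm (\<lambda>t. h t - g t) < d / real (Suc n)" for n :: nat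
    using H1_S1_approx [OF h, of "d / real (Suc n)"] d by (metis divide_pos_pos of_nat_0_less_iff zero_less_Suc)
  then show thesis using that by metis
qed

text \<open>Everything is reduced to differences: \<open>G = h - (h - G)\<close> and
  \<open>G - H = (h - H) - (h - G)\<close>.\<close>

lemma L1_norm_approx:
  assumes h: "h \<in> L1_S1" and G: "G \<in> L1_S1" "H \<in> L1_S1"
    and le: "L1_norm (\<lambda>t. h t - G t) \<le> a" "L1_norm (\<lambda>t. h t - H t) \<le> b"
  shows "L1_norm G \<le> L1_norm h + a" "L1_norm (\<lambda>t. G t - H t) \<le> b + a"
  using L1_S1_diff(2) [OF h L1_S1_diff(1) [OF h G(1)]] le
    L1_S1_diff(2) [OF L1_S1_diff(1) [OF h G(2)] L1_S1_diff(1) [OF h G(1)]] by simp_all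

text \<open>Differences of tensors are again tensors, so bilinearity turns the estimate for tensors
  into the Cauchy property in \<open>A0\<close> of the approximating products. Their limit is
  identified pointwise, and the slack \<open>d\<close> in the norms is removed at the end.\<close>

lemma A0_le_conv_mult:
  assumes f: "f \<in> C0_Sinf" and g: "g \<in> C0_Sinf" and h: "h \<in> H1_S1" and m: "m \<in> H1_S1"
  shows "A0_le (\<lambda>s. conv f h s * conv g m s) ((sup_norm f * L1_norm h) * (sup_norm g * L1_norm m))"
proof -
  note L1 = H1_S1_L1 [OF h] H1_S1_L1 [OF m]
  have pos: "0 \<le> sup_norm f" "0 \<le> sup_norm g" using sup_norm_nonneg f g by auto
  have le: "A0_le (\<lambda>s. conv f h s * conv g m s) ((sup_norm f * (L1_norm h + d)) * (sup_norm g * (L1_norm m + d)))"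
    if d: "d > 0" for d
  proof -
    obtain G where G: "\<And>n. G n \<in> H1_tensor_S1" "\<And>n::nat. L1_norm (\<lambda>t. h t - G n t) < d / real (Suc n)"
      using H1_S1_approx_seq [OF h d] by blast
    obtain Q where Q: "\<And>n. Q n \<in> H1_tensor_S1" "\<And>n::nat. L1_norm (\<lambda>t. m t - Q n t) < d / real (Suc n)"
      using H1_S1_approx_seq [OF m d] by blast
    note GQ = H1_tensor_S1_L1 [OF G(1)] H1_tensor_S1_L1 [OF Q(1)]
    have small: "d / real (Suc n) \<le> d / real (Suc N)" if "n \<ge> N" for n N
      using that d by (intro divide_left_mono) auto
    have n1: "L1_norm (G n) \<le> L1_norm h + d" "L1_norm (Q n) \<le> L1_norm m + d" for n
      using L1_norm_approx(1) [OF L1(1) GQ(1) GQ(1), of n d n d] L1_norm_approx(1) [OF L1(2) GQ(2) GQ(2), of n d n d]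
        G(2) [of n] Q(2) [of n] small [of 0 n] by auto
    have n2: "L1_norm (\<lambda>t. G n t - G k t) \<le> 2 * (d / real (Suc N))" "L1_norm (\<lambda>t. Q n t - Q k t) \<le> 2 * (d / real (Suc N))"
      if "n \<ge> N" "k \<ge> N" for n k N
      using L1_norm_approx(2) [OF L1(1) GQ(1) GQ(1), of n "d / real (Suc N)" k "d / real (Suc N)"]
        L1_norm_approx(2) [OF L1(2) GQ(2) GQ(2), of n "d / real (Suc N)" k "d / real (Suc N)"]
        G(2) [of n] Q(2) [of n] G(2) [of k] Q(2) [of k] small [OF that(1)] small [OF that(2)] by auto
    define X where "X n s = conv f (G n) s * conv g (Q n) s" for n s
    \<comment> \<open>\<open>D\<close> collects the two cross terms: changing one convolution factor
      costs \<open>\<delta>\<close> times the bound for the other.\<close>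
    define D where "D = sup_norm f * sup_norm g * (L1_norm m + d + (L1_norm h + d))"
    have D: "0 \<le> D" using d pos by (simp add: D_def)
    show ?thesis
    proof (rule A0_le_limit [of X])
      show "A0_le (X n) ((sup_norm f * (L1_norm h + d)) * (sup_norm g * (L1_norm m + d)))" for n
        unfolding X_def [abs_def]
        by (rule A0_le_mono [OF A0_le_conv_mult_H1_tensor_S1 [OF f g G(1) Q(1)]])
          (use d pos n1 in \<open>auto intro!: mult_mono\<close>)
      fix e :: real assume e: "e > 0"
      have "(\<lambda>N. D * (2 * (d / real (Suc N)))) \<longlonglongrightarrow> D * (2 * 0)"
        by (intro tendsto_mult tendsto_const) (rule lim_const_over_n [THEN LIMSEQ_Suc])
      then have "eventually (\<lambda>N. D * (2 * (d / real (Suc N))) < e) sequentially"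
        using e by (intro order_tendstoD(2)) auto
      then obtain N where N: "D * (2 * (d / real (Suc N))) < e" by (auto simp: eventually_sequentially)
      define \<delta> where "\<delta> = 2 * (d / real (Suc N))"
      have \<delta>: "0 \<le> \<delta>" using d by (simp add: \<delta>_def)
      have "A0_le (\<lambda>s. X n s - X k s) e" if nk: "n \<ge> N" "k \<ge> N" for n k
      proof -
        have 1: "A0_le (\<lambda>s. conv f (\<lambda>t. G n t - G k t) s * conv g (Q n) s) ((sup_norm f * \<delta>) * (sup_norm g * (L1_norm m + d)))"
          by (rule A0_le_mono [OF A0_le_conv_mult_H1_tensor_S1 [OF f g H1_tensor_S1_diff [OF G(1) G(1)] Q(1)]])
            (use d pos n1 n2 [OF nk, folded \<delta>_def] \<delta> in \<open>auto intro!: mult_mono\<close>)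
        have 2: "A0_le (\<lambda>s. conv f (G k) s * conv g (\<lambda>t. Q n t - Q k t) s) ((sup_norm f * (L1_norm h + d)) * (sup_norm g * \<delta>))"
          by (rule A0_le_mono [OF A0_le_conv_mult_H1_tensor_S1 [OF f g G(1) H1_tensor_S1_diff [OF Q(1) Q(1)]]])
            (use d pos n1 n2 [OF nk, folded \<delta>_def] \<delta> in \<open>auto intro!: mult_mono\<close>)
        have "(\<lambda>s. X n s - X k s) = (\<lambda>s. conv f (\<lambda>t. G n t - G k t) s * conv g (Q n) s + conv f (G k) s * conv g (\<lambda>t. Q n t - Q k t) s)"
          by (simp add: X_def conv_diff_right f g GQ algebra_simps)
        moreover have "(sup_norm f * \<delta>) * (sup_norm g * (L1_norm m + d)) + (sup_norm f * (L1_norm h + d)) * (sup_norm g * \<delta>) = D * \<delta>"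
          unfolding D_def by algebra
        ultimately show ?thesis using A0_le_add [OF 1 2] N [folded \<delta>_def]
          by (simp only:) (erule A0_le_mono, simp)
      qed
      then show "\<exists>N. \<forall>n\<ge>N. \<forall>k\<ge>N. A0_le (\<lambda>s. X n s - X k s) e" by blast
    next
      fix s
      have lim: "(\<lambda>n. conv f' (G' n) s) \<longlonglongrightarrow> conv f' h' s"
        if f': "f' \<in> C0_Sinf" "h' \<in> L1_S1" "\<And>n. G' n \<in> L1_S1" and G': "\<And>n::nat. L1_norm (\<lambda>t. h' t - G' n t) < d / real (Suc n)"
        for f' h' G'
      proof (rule metric_tendsto_imp_tendsto)
        have "(\<lambda>n. sup_norm f' * (d / real (Suc n))) \<longlonglongrightarrow> sup_norm f' * 0"
          by (intro tendsto_mult tendsto_const) (rule lim_const_over_n [THEN LIMSEQ_Suc])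
        then show "(\<lambda>n. sup_norm f' * (d / real (Suc n))) \<longlonglongrightarrow> 0" by simp
        have "dist (conv f' (G' n) s) (conv f' h' s) \<le> sup_norm f' * (d / real (Suc n))" for n
        proof -
          have "dist (conv f' (G' n) s) (conv f' h' s) = cmod (conv f' (\<lambda>t. h' t - G' n t) s)"
            using f' by (simp add: conv_diff_right dist_norm norm_minus_commute)
          also have "\<dots> \<le> sup_norm f' * L1_norm (\<lambda>t. h' t - G' n t)"
            by (intro cmod_conv_le f' L1_S1_diff)
          also have "\<dots> \<le> sup_norm f' * (d / real (Suc n))"
            using G' [of n] sup_norm_nonneg [OF f'(1)] by (intro mult_left_mono) auto
          finally show ?thesis .
        qed
        then show "eventually (\<lambda>n. dist (conv f' (G' n) s) (conv f' h' s) \<le> dist (sup_norm f' * (d / real (Suc n))) 0) sequentially"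
          unfolding dist_real_def [of _ 0] diff_0_right
          by (intro always_eventually allI order_trans [OF _ abs_ge_self])
      qed
      show "(\<lambda>n. X n s) \<longlonglongrightarrow> conv f h s * conv g m s"
        unfolding X_def by (intro tendsto_mult lim f g L1 GQ G(2) Q(2))
    qed
  qed
  have lim0: "(\<lambda>n. 1 / real (Suc n)) \<longlonglongrightarrow> 0" by (rule lim_const_over_n [THEN LIMSEQ_Suc])
  show ?thesis
  proof (rule A0_le_tendsto)
    show "A0_le (\<lambda>s. conv f h s * conv g m s)
        ((sup_norm f * (L1_norm h + 1 / real (Suc n))) * (sup_norm g * (L1_norm m + 1 / real (Suc n))))" for n
      by (rule le) simp
    have "(\<lambda>n. (sup_norm f * (L1_norm h + 1 / real (Suc n))) * (sup_norm g * (L1_norm m + 1 / real (Suc n))))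
        \<longlonglongrightarrow> (sup_norm f * (L1_norm h + 0)) * (sup_norm g * (L1_norm m + 0))"
      by (intro tendsto_mult tendsto_add tendsto_const lim0)
    then show "(\<lambda>n. (sup_norm f * (L1_norm h + 1 / real (Suc n))) * (sup_norm g * (L1_norm m + 1 / real (Suc n))))
        \<longlonglongrightarrow> (sup_norm f * L1_norm h) * (sup_norm g * L1_norm m)" by (simp only: add_0_right)
  qed
qed

theorem proposition4p1:
  shows "banach_algebra_pointwise A0 A0_norm"
  by (rule banach_algebra_pointwise_A0) (rule A0_le_mult_of_conv [OF A0_le_conv_mult])

end
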